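(* Let $d\in\mathbb{R}\setminus\{0\}$ and $f_0,\zeta,\mu\in\mathbb{R}$ be fixed, and let $V$ be a real-valued, $2\pi$-periodic, continuously differentiable function. Let $u_0\in H^2_{\mathrm{per}}([-\pi,\pi],\mathbb{C})$ be a non-constant, non-degenerate solution of the stationary equation $$-d u''+\mathrm{i}\epsilon V(x)u'+(\zeta-\mathrm{i}\mu)u-|u|^2u+\mathrm{i}f_0=0\qquad (S_\epsilon)$$ for $\epsilon=0$, and let $\phi_0^*$ span $\ker L_{u_0}^*$. If $\sigma_0\in\mathbb{R}$ is a simple zero of the function $$\sigma\mapsto V_{\mathrm{eff}}(\sigma):=\operatorname{Re}\int_{-\pi}^{\pi}\mathrm{i}\,V(x+\sigma)\,u_0'(x)\,\overline{\phi_0^*(x)}\,dx$$ (that is, $V_{\mathrm{eff}}(\sigma_0)=0$ and $V_{\mathrm{eff}}'(\sigma_0)\neq0$), then there exist $\epsilon^*>0$, a constant $C>0$ and a continuous curve $(-\epsilon^*,\epsilon^* )\ni\epsilon\mapsto u(\epsilon)\in H^2_{\mathrm{per}}([-\pi,\pi],\mathbb{C})$ such that, for every $\epsilon\in(-\epsilon^*,\epsilon^* )$, $u(\epsilon)$ is a solution of $(S_\epsilon)$ and $$\|u(\epsilon)-u_0(\cdot-\sigma_0)\|_{H^2}\le C|\epsilon|.$$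
   Context: $H^2_{\mathrm{per}}([-\pi,\pi],\mathbb{C})$ is the Sobolev space of $2\pi$-periodic complex-valued $H^2$ functions; all functions on $[-\pi,\pi]$ are extended $2\pi$-periodically to $\mathbb{R}$. Complex-valued function spaces are regarded as real Hilbert spaces with $\langle f,g\rangle_{L^2}=\operatorname{Re}\int_{-\pi}^{\pi}f\bar g\,dx$; spans, kernels and adjoints are taken over $\mathbb{R}$. For $u\in H^2_{\mathrm{per}}([-\pi,\pi],\mathbb{C})$ define the (real-linear) operator $L_u:H^2_{\mathrm{per}}([-\pi,\pi],\mathbb{C})\to L^2([-\pi,\pi],\mathbb{C})$ by $L_u\varphi:=-d\varphi''+(\zeta-\mathrm{i}\mu-2|u|^2)\varphi-u^2\bar\varphi$. It is a Fredholm operator of index $0$. A non-constant solution $u$ of the stationary equation with $\epsilon=0$ is called non-degenerate if $\ker L_u=\operatorname{span}\{u'\}$. In this case the kernel of the adjoint $L_u^*$ is also one-dimensional; $\phi_0^*\in H^2_{\mathrm{per}}([-\pi,\pi],\mathbb{C})$ denotes a function with $\ker L_{u_0}^*=\operatorname{span}\{\phi_0^*\}$. *)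

theory Defs
  imports "HOL-Analysis.Analysis"
begin

text \<open>
  Elements of \<open>L\<^sup>2([-\<pi>,\<pi>],\<complex>)\<close> are represented by their \<open>2\<pi>\<close>-periodic extensions to \<open>\<real>\<close>. No
  quotient is taken: functions that agree almost everywhere represent the same element, so
  equations between elements are stated almost everywhere, and subspaces are represented by sets
  of functions that are closed under modification on null sets.
\<close>

definition periodic_2pi :: "(real \<Rightarrow> 'a) \<Rightarrow> bool" where
  "periodic_2pi f \<longleftrightarrow> (\<forall>x. f (x + 2 * pi) = f x)"

definition L2per :: "(real \<Rightarrow> complex) set" where
  "L2per = {f. f \<in> borel_measurable lebesgue \<and> periodic_2pi f \<and>
                set_integrable lebesgue {-pi..pi} (\<lambda>x. (cmod (f x))\<^sup>2)}"

definition L2inner :: "(real \<Rightarrow> complex) \<Rightarrow> (real \<Rightarrow> complex) \<Rightarrow> real" where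
  "L2inner f g = Re (LINT x:{-pi..pi}|lebesgue. f x * cnj (g x))"

definition test_functions :: "(real \<Rightarrow> real) set" where
  "test_functions = {\<eta>. periodic_2pi \<eta> \<and> (\<forall>n x. (deriv ^^ n) \<eta> differentiable at x)}"

definition is_weak_deriv :: "(real \<Rightarrow> complex) \<Rightarrow> (real \<Rightarrow> complex) \<Rightarrow> bool" where
  "is_weak_deriv f g \<longleftrightarrow>
     (\<forall>\<eta>\<in>test_functions.
        (LINT x:{-pi..pi}|lebesgue. f x * complex_of_real (deriv \<eta> x)) =
        - (LINT x:{-pi..pi}|lebesgue. g x * complex_of_real (\<eta> x)))"

definition H1per :: "(real \<Rightarrow> complex) set" where
  "H1per = {f \<in> L2per. \<exists>g\<in>L2per. is_weak_deriv f g}"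

text \<open>A weak derivative in \<open>L2per\<close> is unique up to null sets; an arbitrary representative is chosen.\<close>

definition wderiv :: "(real \<Rightarrow> complex) \<Rightarrow> (real \<Rightarrow> complex)" where
  "wderiv f = (SOME g. g \<in> L2per \<and> is_weak_deriv f g)"

definition H2per :: "(real \<Rightarrow> complex) set" where
  "H2per = {f \<in> H1per. wderiv f \<in> H1per}"

definition H2norm :: "(real \<Rightarrow> complex) \<Rightarrow> real" where
  "H2norm f = sqrt (L2inner f f + L2inner (wderiv f) (wderiv f)
                    + L2inner (wderiv (wderiv f)) (wderiv (wderiv f)))"

definition H2_continuous_on :: "real set \<Rightarrow> (real \<Rightarrow> (real \<Rightarrow> complex)) \<Rightarrow> bool" where
  "H2_continuous_on S u \<longleftrightarrow>
     (\<forall>t\<in>S. u t \<in> H2per) \<and>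
     (\<forall>t\<in>S. ((\<lambda>s. H2norm (\<lambda>x. u s x - u t x)) \<longlongrightarrow> 0) (at t within S))"

definition real_span1 :: "(real \<Rightarrow> complex) \<Rightarrow> (real \<Rightarrow> complex) set" where
  "real_span1 v = {f \<in> L2per. \<exists>c::real. AE x in lebesgue. f x = complex_of_real c * v x}"

definition op_kernel ::
  "(real \<Rightarrow> complex) set \<Rightarrow> ((real \<Rightarrow> complex) \<Rightarrow> (real \<Rightarrow> complex)) \<Rightarrow> (real \<Rightarrow> complex) set" where
  "op_kernel D A = {f \<in> D. AE x in lebesgue. A f x = 0}"

text \<open>
  The graph of the adjoint with respect to \<open>L2inner\<close> of the operator \<open>A\<close> with domain \<open>D\<close>, as a
  densely defined operator in \<open>L\<^sup>2\<close>.
\<close>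

definition adjoint_graph ::
  "(real \<Rightarrow> complex) set \<Rightarrow> ((real \<Rightarrow> complex) \<Rightarrow> (real \<Rightarrow> complex))
     \<Rightarrow> ((real \<Rightarrow> complex) \<times> (real \<Rightarrow> complex)) set" where
  "adjoint_graph D A =
     {(g, h). g \<in> L2per \<and> h \<in> L2per \<and> (\<forall>f\<in>D. L2inner (A f) g = L2inner f h)}"

definition adjoint_kernel ::
  "(real \<Rightarrow> complex) set \<Rightarrow> ((real \<Rightarrow> complex) \<Rightarrow> (real \<Rightarrow> complex)) \<Rightarrow> (real \<Rightarrow> complex) set" where
  "adjoint_kernel D A = {g. (g, \<lambda>x. 0) \<in> adjoint_graph D A}"

definition lin_op ::
  "real \<Rightarrow> real \<Rightarrow> real \<Rightarrow> (real \<Rightarrow> complex) \<Rightarrow> (real \<Rightarrow> complex) \<Rightarrow> (real \<Rightarrow> complex)" where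
  "lin_op d \<zeta> \<mu> u \<phi> =
     (\<lambda>x. - complex_of_real d * wderiv (wderiv \<phi>) x
          + (complex_of_real \<zeta> - \<i> * complex_of_real \<mu> - 2 * complex_of_real ((cmod (u x))\<^sup>2)) * \<phi> x
          - (u x)\<^sup>2 * cnj (\<phi> x))"

definition stationary_solution ::
  "real \<Rightarrow> real \<Rightarrow> real \<Rightarrow> real \<Rightarrow> (real \<Rightarrow> real) \<Rightarrow> real \<Rightarrow> (real \<Rightarrow> complex) \<Rightarrow> bool" where
  "stationary_solution d f0 \<zeta> \<mu> V \<epsilon> u \<longleftrightarrow>
     u \<in> H2per \<and>
     (AE x in lebesgue.
        - complex_of_real d * wderiv (wderiv u) x
        + \<i> * complex_of_real \<epsilon> * complex_of_real (V x) * wderiv u x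
        + (complex_of_real \<zeta> - \<i> * complex_of_real \<mu>) * u x
        - complex_of_real ((cmod (u x))\<^sup>2) * u x
        + \<i> * complex_of_real f0 = 0)"

definition non_constant :: "(real \<Rightarrow> complex) \<Rightarrow> bool" where
  "non_constant u \<longleftrightarrow> \<not> (\<exists>c. AE x in lebesgue. u x = c)"

definition non_degenerate :: "real \<Rightarrow> real \<Rightarrow> real \<Rightarrow> (real \<Rightarrow> complex) \<Rightarrow> bool" where
  "non_degenerate d \<zeta> \<mu> u \<longleftrightarrow> op_kernel H2per (lin_op d \<zeta> \<mu> u) = real_span1 (wderiv u)"

definition V_eff ::
  "(real \<Rightarrow> real) \<Rightarrow> (real \<Rightarrow> complex) \<Rightarrow> (real \<Rightarrow> complex) \<Rightarrow> real \<Rightarrow> real" where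
  "V_eff V u \<phi> \<sigma> =
     Re (LINT x:{-pi..pi}|lebesgue. \<i> * complex_of_real (V (x + \<sigma>)) * wderiv u x * cnj (\<phi> x))"

definition simple_zero :: "(real \<Rightarrow> real) \<Rightarrow> real \<Rightarrow> bool" where
  "simple_zero g s \<longleftrightarrow> g s = 0 \<and> (\<exists>D. (g has_real_derivative D) (at s) \<and> D \<noteq> 0)"

end

theory Submission
  imports Defs "HOL-Complex_Analysis.Great_Picard"
begin

text \<open>
  Translating by \<open>\<sigma>0\<close>, one may look for solutions near \<open>U\<close>, the continuous version of \<open>u0\<close>, with the
  potential \<open>V(\<cdot> + \<sigma>0)\<close>. Write \<open>W = \<i>V(\<cdot> + \<sigma>0)\<close>, let \<open>L\<close> be the linearisation at \<open>U\<close>, and let \<open>\<psi>\<close>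
  be the continuous version of \<open>\<phi>0\<close>, so that the range of \<open>L\<close> is orthogonal to \<open>\<psi>\<close>. With
  \<open>u = U + \<epsilon> v\<close> the stationary equation, divided by \<open>\<epsilon>\<close>, reads
  \<open>L v + W U' + \<epsilon> R(\<epsilon>, v) = 0\<close> where \<open>R(\<epsilon>, v) = W v' - H(v, v) - \<epsilon> |v|\<^sup>2 v\<close> and \<open>H(v, v)\<close> is the
  part of \<open>|u|\<^sup>2 u\<close> that is quadratic in \<open>v\<close>. At \<open>\<epsilon> = 0\<close> this is solvable because
  \<open>\<langle>W U', \<psi>\<rangle> = V_eff(\<sigma>0) = 0\<close>, but \<open>L\<close> is not invertible: its kernel is spanned by \<open>U'\<close>.

  The degeneracy is removed by solving \<open>L v + W U' + \<epsilon> R(\<epsilon>, v) + \<langle>R(\<epsilon>, v), \<psi>\<rangle> \<psi> = 0\<close> instead. Pairing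
  this equation with \<open>\<psi>\<close> gives \<open>(\<epsilon> + \<langle>\<psi>, \<psi>\<rangle>) \<langle>R(\<epsilon>, v), \<psi>\<rangle> = 0\<close>, so for small \<open>\<epsilon>\<close> nothing has been changed.
  The modified equation has a solution \<open>v\<^sub>*\<close> at \<open>\<epsilon> = 0\<close> (\<open>first_order_corrector\<close>), and its
  linearisation there, \<open>z \<mapsto> L z + \<langle>W z' - 2 H(v\<^sub>*, z), \<psi>\<rangle> \<psi>\<close>, is injective: a kernel element is a multiple
  of \<open>U'\<close>, and differentiating \<open>L v\<^sub>* = - W U'\<close> shows that the functional takes the value
  \<open>- V_eff'(\<sigma>0) \<noteq> 0\<close> at \<open>U'\<close> (\<open>corrector_transversal\<close>). By the Fredholm alternative it is invertible, and a
  contraction argument (\<open>perturbed_zero_curve\<close>) continues \<open>v\<^sub>*\<close> to a continuous bounded curve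
  \<open>v(\<epsilon>)\<close>. Then \<open>U + \<epsilon> v(\<epsilon>)\<close>, translated back, is the desired branch, and it stays within
  \<open>O(|\<epsilon>|)\<close> of the wave.

  All of this takes place in the Banach algebra of continuous \<open>2\<pi>\<close>-periodic functions with the
  maximum norm. The unknown is not \<open>v\<close> but a continuous function \<open>w\<close> with \<open>v'' = w - mean w\<close> and
  \<open>mean v = mean w\<close>. The map \<open>w \<mapsto> v\<close> is compact, so that \<open>L\<close> becomes \<open>-d\<close> times the identity plus a
  compact operator, and a bound on \<open>w\<close> is a bound on \<open>v\<close>, \<open>v'\<close> and \<open>v''\<close>.

  The link to Sobolev functions is regularity: elements of \<open>H1per\<close> have continuous
  representatives, and the equation then makes \<open>u0\<close> twice continuously differentiable. Conversely,
  by the fundamental lemma weak derivatives are unique almost everywhere, so that for functions of class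
  \<open>C\<^sup>2\<close> the weak derivatives, and hence \<open>H2norm\<close>, are the classical ones.
\<close>

section \<open>Compact operators and the Fredholm alternative\<close>

definition compact_operator :: "('a::real_normed_vector \<Rightarrow> 'b::real_normed_vector) \<Rightarrow> bool" where
  "compact_operator S \<longleftrightarrow> bounded_linear S \<and>
     (\<forall>x :: nat \<Rightarrow> 'a. bounded (range x) \<longrightarrow> (\<exists>r. strict_mono r \<and> convergent (\<lambda>n. S (x (r n)))))"

lemma compact_operatorD:
  assumes "compact_operator S" "bounded (range (x :: nat \<Rightarrow> 'a::real_normed_vector))"
  obtains r l where "strict_mono (r :: nat \<Rightarrow> nat)" "(\<lambda>n. S (x (r n))) \<longlonglongrightarrow> l"
  using assms unfolding compact_operator_def convergent_def by blast

lemma compact_operator_add: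
  fixes S T :: "'a::real_normed_vector \<Rightarrow> 'b::real_normed_vector"
  assumes S: "compact_operator S" and T: "compact_operator T"
  shows "compact_operator (\<lambda>x. S x + T x)"
  unfolding compact_operator_def
proof (intro conjI allI impI)
  show "bounded_linear (\<lambda>x. S x + T x)"
    using S T by (auto simp: compact_operator_def intro: bounded_linear_add)
  fix x :: "nat \<Rightarrow> 'a" assume bd: "bounded (range x)"
  from compact_operatorD[OF S bd] obtain r l
    where r: "strict_mono (r :: nat \<Rightarrow> nat)" "(\<lambda>n. S (x (r n))) \<longlonglongrightarrow> l" .
  have "bounded (range (\<lambda>n. x (r n)))"
    using bd by (rule bounded_subset) auto
  from compact_operatorD[OF T this] obtain q k
    where q: "strict_mono (q :: nat \<Rightarrow> nat)" "(\<lambda>n. T (x (r (q n)))) \<longlonglongrightarrow> k" .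
  have "(\<lambda>n. S (x (r (q n)))) \<longlonglongrightarrow> l"
    using LIMSEQ_subseq_LIMSEQ[OF r(2) q(1)] by (simp add: o_def)
  hence "(\<lambda>n. S (x ((r \<circ> q) n)) + T (x ((r \<circ> q) n))) \<longlonglongrightarrow> l + k"
    using q(2) by (auto intro: tendsto_add)
  moreover have "strict_mono (r \<circ> q)"
    using r(1) q(1) by (rule strict_mono_o)
  ultimately show "\<exists>r. strict_mono r \<and> convergent (\<lambda>n. S (x (r n)) + T (x (r n)))"
    unfolding convergent_def by blast
qed

lemma compact_operator_compose:
  fixes S :: "'a::real_normed_vector \<Rightarrow> 'b::real_normed_vector"
    and T :: "'b \<Rightarrow> 'c::real_normed_vector"
  assumes T: "bounded_linear T" and S: "compact_operator S"
  shows "compact_operator (\<lambda>x. T (S x))"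
  unfolding compact_operator_def
proof (intro conjI allI impI)
  show "bounded_linear (\<lambda>x. T (S x))"
    using S T by (auto simp: compact_operator_def intro: bounded_linear_compose)
  fix x :: "nat \<Rightarrow> 'a" assume bd: "bounded (range x)"
  from compact_operatorD[OF S bd] obtain r l
    where r: "strict_mono (r :: nat \<Rightarrow> nat)" "(\<lambda>n. S (x (r n))) \<longlonglongrightarrow> l" .
  thus "\<exists>r. strict_mono r \<and> convergent (\<lambda>n. T (S (x (r n))))"
    using bounded_linear.tendsto[OF T r(2)] unfolding convergent_def by blast
qed

text \<open>
  Bounded sequences in a finite-dimensional space have convergent subsequences.
\<close>

lemma compact_operator_finite_rank:
  fixes l :: "'a::real_normed_vector \<Rightarrow> 'b::euclidean_space"
  assumes l: "bounded_linear l"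
  shows "compact_operator l"
  unfolding compact_operator_def
proof (intro conjI allI impI l)
  fix x :: "nat \<Rightarrow> 'a" assume "bounded (range x)"
  hence "bounded (range (\<lambda>n. l (x n)))"
    using bounded_linear_image[OF _ l, of "range x"] by (simp add: image_image)
  from bounded_imp_convergent_subsequence[OF this]
  show "\<exists>r. strict_mono r \<and> convergent (\<lambda>n. l (x (r n)))"
    by (auto simp: convergent_def o_def)
qed

text \<open>
  Scale \<open>z - y\<close> to unit length, where \<open>z \<in> M - N\<close> and \<open>y \<in> N\<close> realises the distance from \<open>z\<close>
  to \<open>N\<close> up to a factor of two.
\<close>

lemma riesz_lemma:
  fixes N :: "'a::real_normed_vector set"
  assumes N: "closed N" "subspace N" and M: "subspace M" and "N \<subset> M"
  shows "\<exists>x\<in>M. norm x \<le> 1 \<and> (\<forall>y\<in>N. norm (x - y) \<ge> 1/2)"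
proof -
  obtain z where z: "z \<in> M" "z \<notin> N" using \<open>N \<subset> M\<close> by blast
  have ne: "N \<noteq> {}" using subspace_0[OF N(2)] by blast
  define \<delta> where "\<delta> = infdist z N"
  have \<delta>: "\<delta> > 0"
    using in_closed_iff_infdist_zero[OF N(1) ne, of z] z infdist_nonneg[of z N]
    unfolding \<delta>_def by linarith
  have "\<exists>y\<in>N. dist z y < 2 * \<delta>"
    using \<delta> ne cINF_less_iff[of N "dist z" "2 * \<delta>"] infdist_notempty[OF ne, of z]
    by (auto simp: \<delta>_def intro!: bdd_belowI[of _ 0])
  then obtain y where y: "y \<in> N" "dist z y < 2 * \<delta>" by blast
  have le: "\<delta> \<le> dist z w" if "w \<in> N" for w
    unfolding \<delta>_def using that by (rule infdist_le)
  define c where "c = norm (z - y)"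
  have c: "c > 0" "c < 2 * \<delta>"
    using le[OF y(1)] \<delta> y(2) by (auto simp: c_def dist_norm)
  show ?thesis
  proof (intro bexI conjI ballI)
    show "(1/c) *\<^sub>R (z - y) \<in> M"
      using z(1) y(1) \<open>N \<subset> M\<close> by (intro subspace_scale[OF M] subspace_diff[OF M]) auto
    show "norm ((1/c) *\<^sub>R (z - y)) \<le> 1" using c by (simp add: c_def)
    fix w assume w: "w \<in> N"
    have "y + c *\<^sub>R w \<in> N"
      by (intro subspace_add[OF N(2)] subspace_scale[OF N(2)] y w)
    from le[OF this] have "\<delta> \<le> norm (z - (y + c *\<^sub>R w))" by (simp add: dist_norm)
    also have "z - (y + c *\<^sub>R w) = c *\<^sub>R ((1/c) *\<^sub>R (z - y) - w)"
      using c by (simp add: algebra_simps)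
    also have "norm \<dots> = c * norm ((1/c) *\<^sub>R (z - y) - w)" using c by simp
    finally have "c * (1/2) \<le> c * norm ((1/c) *\<^sub>R (z - y) - w)" using c by linarith
    thus "1/2 \<le> norm ((1/c) *\<^sub>R (z - y) - w)" using c by simp
  qed
qed

text \<open>
  Riesz's argument. Compactness makes the injective operator \<open>T = id - S\<close> bounded below. If \<open>T\<close> were not
  onto, the ranges of its powers would be a strictly decreasing sequence of closed subspaces; the
  nearly orthogonal unit vectors that Riesz's lemma picks from them are mapped by \<open>S\<close> to a sequence
  with mutual distances at least \<open>1/2\<close>, against compactness.
\<close>

theorem fredholm_alternative:
  fixes S :: "'a::banach \<Rightarrow> 'a"
  assumes S: "compact_operator S" and inj: "\<And>x. x - S x = 0 \<Longrightarrow> x = 0"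
  shows "\<exists>Ti. bounded_linear Ti \<and> (\<forall>x. Ti x - S (Ti x) = x)"
proof -
  define T where "T = (\<lambda>x. x - S x)"
  interpret S: bounded_linear S using S by (simp add: compact_operator_def)
  have blT: "bounded_linear T"
    unfolding T_def by (intro bounded_linear_sub bounded_linear_ident S.bounded_linear_axioms)
  interpret T: bounded_linear T by (rule blT)
  have T0: "x = 0" if "T x = 0" for x using inj that by (simp add: T_def)
  have injT: "inj T" using T0 linear_injective_0[OF T.linear_axioms] by blast
  \<comment> \<open>Unit vectors with \<open>T (x n) \<longlonglongrightarrow> 0\<close> would accumulate at a unit vector in the kernel of \<open>T\<close>.\<close>
  have "\<exists>c>0. \<forall>x. norm x \<le> c * norm (T x)"
  proof (rule ccontr)
    assume neg: "\<not> ?thesis"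
    have "\<exists>x. norm x = 1 \<and> norm (T x) < 1 / real (Suc n)" for n
    proof -
      obtain x where x: "norm x > real (Suc n) * norm (T x)"
        using neg by (metis not_less of_nat_0_less_iff zero_less_Suc)
      hence "norm x > 0" by (smt (verit) mult_nonneg_nonneg norm_ge_zero of_nat_0_le_iff)
      thus ?thesis using x
        by (intro exI[of _ "(1 / norm x) *\<^sub>R x"]) (simp add: T.scaleR field_simps)
    qed
    then obtain x where x: "\<And>n. norm (x n) = 1" "\<And>n. norm (T (x n)) < 1 / real (Suc n)"
      by metis
    have "bounded (range x)" using x(1) by (auto simp: bounded_iff intro!: exI[of _ 1])
    from compact_operatorD[OF S this] obtain r l
      where r: "strict_mono (r :: nat \<Rightarrow> nat)" "(\<lambda>n. S (x (r n))) \<longlonglongrightarrow> l" .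
    have "(\<lambda>n. T (x n)) \<longlonglongrightarrow> 0"
      by (rule Lim_null_comparison[OF _ LIMSEQ_inverse_real_of_nat])
         (use x(2) in \<open>auto intro!: always_eventually less_imp_le simp: divide_inverse\<close>)
    hence Tx: "(\<lambda>n. T (x (r n))) \<longlonglongrightarrow> 0"
      using LIMSEQ_subseq_LIMSEQ[OF _ r(1)] by (fastforce simp: o_def)
    have "(\<lambda>n. T (x (r n)) + S (x (r n))) \<longlonglongrightarrow> 0 + l" by (intro tendsto_add Tx r)
    hence xl: "(\<lambda>n. x (r n)) \<longlonglongrightarrow> l" by (simp add: T_def)
    have "T l = 0" using T.tendsto[OF xl] Tx LIMSEQ_unique by blast
    hence "l = 0" by (rule T0)
    moreover have "norm l = 1" using tendsto_norm[OF xl] x(1) by (simp add: LIMSEQ_const_iff)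
    ultimately show False by simp
  qed
  then obtain c where c: "c > 0" "\<And>x. norm x \<le> c * norm (T x)" by blast
  have surjT: "surj T"
  proof (rule ccontr)
    assume "\<not> surj T"
    then obtain z where z: "z \<notin> range T" by blast
    define R where "R = (\<lambda>n. (T ^^ n) ` UNIV)"
    have R_Suc: "R (Suc n) = T ` R n" for n by (auto simp: R_def image_image)
    have sub: "subspace (R n)" for n
    proof (induction n)
      case (Suc n)
      thus ?case unfolding R_Suc by (rule linear_subspace_image[OF T.linear_axioms])
    qed (auto simp: R_def)
    have clo: "closed (R n)" for n
    proof (induction n)
      case (Suc n)
      have "complete (T ` R n)"
        by (rule complete_isometric_image[of "1/c"])
           (use c Suc sub blT in \<open>auto simp: complete_eq_closed field_simps mult.commute\<close>)
      thus ?case by (simp add: R_Suc complete_eq_closed)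
    qed (auto simp: R_def)
    have ss: "R (Suc n) \<subset> R n" for n
    proof (induction n)
      case 0
      thus ?case using z by (auto simp: R_def)
    next
      case (Suc n)
      thus ?case unfolding R_Suc[of "Suc n"] R_Suc[of n]
        using injT by (simp add: psubset_eq inj_image_subset_iff inj_image_eq_iff)
    qed
    have mono: "R n \<subseteq> R m" if "m \<le> n" for m n
      using lift_Suc_antimono_le[of R m n] ss that by blast
    obtain x where x: "\<And>n. x n \<in> R n" "\<And>n. norm (x n) \<le> 1"
        "\<And>n y. y \<in> R (Suc n) \<Longrightarrow> norm (x n - y) \<ge> 1/2"
      using riesz_lemma[OF clo sub sub ss] by metis
    \<comment> \<open>\<open>S (x m) - S (x n) = x m - y\<close> with \<open>y = T (x m) + x n - T (x n)\<close> in the smaller range.\<close>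
    have sep: "norm (S (x m) - S (x n)) \<ge> 1/2" if "m < n" for m n
    proof -
      have "x n \<in> R (Suc m)" using mono[of "Suc m" n] x(1) that by auto
      moreover have "T (x m) \<in> R (Suc m)" using x(1) by (simp add: R_Suc)
      moreover have "T (x n) \<in> R (Suc m)"
        using mono[of "Suc m" "Suc n"] x(1)[of n] that R_Suc[of n] by auto
      ultimately have "T (x m) + x n - T (x n) \<in> R (Suc m)"
        by (intro subspace_diff[OF sub] subspace_add[OF sub])
      from x(3)[OF this] show ?thesis by (simp add: T_def algebra_simps)
    qed
    have "bounded (range x)" using x(2) by (auto simp: bounded_iff)
    from compact_operatorD[OF S this] obtain r l
      where r: "strict_mono (r :: nat \<Rightarrow> nat)" "(\<lambda>n. S (x (r n))) \<longlonglongrightarrow> l" .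
    have "Cauchy (\<lambda>n. S (x (r n)))" using r(2) by (rule LIMSEQ_imp_Cauchy)
    then obtain N where "\<And>m n. m \<ge> N \<Longrightarrow> n \<ge> N \<Longrightarrow> norm (S (x (r m)) - S (x (r n))) < 1/2"
      using CauchyD[of _ "1/2"] by (metis half_gt_zero_iff zero_less_one)
    from this[of N "Suc N"] sep[of "r N" "r (Suc N)"] r(1)
    show False by (auto simp: strict_mono_def)
  qed
  define Ti where "Ti = inv T"
  have TTi: "T (Ti x) = x" for x unfolding Ti_def using surjT by (rule surj_f_inv_f)
  have TiT: "Ti (T x) = x" for x unfolding Ti_def using injT by (rule inv_f_f)
  have "bounded_linear Ti"
  proof (rule bounded_linear_intro)
    show "Ti (x + y) = Ti x + Ti y" for x y by (metis T.add TTi TiT)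
    show "Ti (a *\<^sub>R x) = a *\<^sub>R Ti x" for a x by (metis T.scaleR TTi TiT)
    show "norm (Ti x) \<le> norm x * c" for x using c(2)[of "Ti x"] by (simp add: TTi mult.commute)
  qed
  thus ?thesis using TTi by (auto simp: T_def)
qed

corollary compact_perturbation_invertible:
  fixes C :: "'a::banach \<Rightarrow> 'a"
  assumes c: "c \<noteq> 0" and C: "compact_operator C"
    and inj: "\<And>x. c *\<^sub>R x + C x = 0 \<Longrightarrow> x = 0"
  shows "\<exists>B. bounded_linear B \<and> (\<forall>x. c *\<^sub>R B x + C (B x) = x)"
proof -
  have "\<exists>Ti. bounded_linear Ti \<and> (\<forall>x. Ti x - (- 1 / c) *\<^sub>R C (Ti x) = x)"
  proof (rule fredholm_alternative)
    show "compact_operator (\<lambda>x. (- 1 / c) *\<^sub>R C x)"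
      by (rule compact_operator_compose[OF bounded_linear_scaleR_right C])
    fix x assume "x - (- 1 / c) *\<^sub>R C x = 0"
    hence "c *\<^sub>R (x - (- 1 / c) *\<^sub>R C x) = 0" by simp
    hence "c *\<^sub>R x + C x = 0" using c by (simp add: scaleR_add_right)
    thus "x = 0" by (rule inj)
  qed
  then obtain Ti where Ti: "bounded_linear Ti" "\<And>x. Ti x - (- 1 / c) *\<^sub>R C (Ti x) = x" by blast
  interpret C: bounded_linear C using C by (simp add: compact_operator_def)
  interpret Ti: bounded_linear Ti by fact
  have "c *\<^sub>R Ti ((1/c) *\<^sub>R x) + C (Ti ((1/c) *\<^sub>R x)) = x" for x
  proof -
    have "c *\<^sub>R (Ti ((1/c) *\<^sub>R x) - (- 1 / c) *\<^sub>R C (Ti ((1/c) *\<^sub>R x))) = c *\<^sub>R (1/c) *\<^sub>R x"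
      by (subst Ti(2)) simp
    thus ?thesis using c by (simp add: scaleR_add_right)
  qed
  moreover have "bounded_linear (\<lambda>x. Ti ((1/c) *\<^sub>R x))"
    by (rule bounded_linear_compose[OF Ti(1) bounded_linear_scaleR_right])
  ultimately show ?thesis by blast
qed

section \<open>Zeros of a perturbed quadratic equation\<close>

text \<open>
  Lipschitz on every bounded set. This class is closed under sums and bounded bilinear products, so
  that for polynomial expressions the property follows from the shape of the expression.
\<close>

definition locally_lipschitz :: "('a::real_normed_vector \<Rightarrow> 'b::real_normed_vector) \<Rightarrow> bool" where
  "locally_lipschitz f \<longleftrightarrow>
     (\<forall>r. \<exists>C. \<forall>x y. norm x \<le> r \<longrightarrow> norm y \<le> r \<longrightarrow> norm (f x - f y) \<le> C * norm (x - y))"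

lemma locally_lipschitzD:
  assumes "locally_lipschitz f"
  shows "\<exists>C>0. \<forall>x y. norm x \<le> r \<longrightarrow> norm y \<le> r \<longrightarrow> norm (f x - f y) \<le> C * norm (x - y)"
proof -
  from assms obtain C where
    C: "\<And>x y. norm x \<le> r \<Longrightarrow> norm y \<le> r \<Longrightarrow> norm (f x - f y) \<le> C * norm (x - y)"
    unfolding locally_lipschitz_def by metis
  have "norm (f x - f y) \<le> max C 1 * norm (x - y)" if "norm x \<le> r" "norm y \<le> r" for x y
    by (rule order_trans[OF C[OF that]]) (auto intro: mult_right_mono)
  thus ?thesis by (intro exI[of _ "max C 1"]) auto
qed

lemma locally_lipschitz_bounded_linear:
  assumes "bounded_linear f"
  shows "locally_lipschitz f"
proof -
  interpret bounded_linear f by fact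
  obtain K where "\<And>x. norm (f x) \<le> norm x * K" using bounded by blast
  hence "norm (f x - f y) \<le> K * norm (x - y)" for x y
    by (metis diff mult.commute)
  thus ?thesis unfolding locally_lipschitz_def by blast
qed

lemma locally_lipschitz_const: "locally_lipschitz (\<lambda>_. c)"
  unfolding locally_lipschitz_def by (auto intro!: exI[of _ 0])

lemma locally_lipschitz_add:
  assumes "locally_lipschitz f" "locally_lipschitz g"
  shows "locally_lipschitz (\<lambda>x. f x + g x)"
  unfolding locally_lipschitz_def
proof
  fix r
  obtain C where C: "\<And>x y. norm x \<le> r \<Longrightarrow> norm y \<le> r \<Longrightarrow> norm (f x - f y) \<le> C * norm (x - y)"
    using locally_lipschitzD[OF assms(1), of r] by blast
  obtain D where D: "\<And>x y. norm x \<le> r \<Longrightarrow> norm y \<le> r \<Longrightarrow> norm (g x - g y) \<le> D * norm (x - y)"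
    using locally_lipschitzD[OF assms(2), of r] by blast
  have "norm (f x + g x - (f y + g y)) \<le> (C + D) * norm (x - y)" if "norm x \<le> r" "norm y \<le> r" for x y
  proof -
    have "f x + g x - (f y + g y) = (f x - f y) + (g x - g y)" by simp
    thus ?thesis using C[OF that] D[OF that] norm_triangle_ineq[of "f x - f y" "g x - g y"]
      by (simp add: algebra_simps)
  qed
  thus "\<exists>C. \<forall>x y. norm x \<le> r \<longrightarrow> norm y \<le> r \<longrightarrow> norm (f x + g x - (f y + g y)) \<le> C * norm (x - y)"
    by blast
qed

lemma locally_lipschitz_compose_linear:
  assumes l: "bounded_linear l" and f: "locally_lipschitz f"
  shows "locally_lipschitz (\<lambda>x. l (f x))"
  unfolding locally_lipschitz_def
proof
  fix r
  interpret l: bounded_linear l by fact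
  obtain C where C: "\<And>x y. norm x \<le> r \<Longrightarrow> norm y \<le> r \<Longrightarrow> norm (f x - f y) \<le> C * norm (x - y)"
    using locally_lipschitzD[OF f, of r] by blast
  obtain K where K: "K > 0" "\<And>x. norm (l x) \<le> norm x * K" using l.pos_bounded by blast
  have "norm (l (f x) - l (f y)) \<le> (C * K) * norm (x - y)" if "norm x \<le> r" "norm y \<le> r" for x y
  proof -
    have "norm (l (f x) - l (f y)) \<le> norm (f x - f y) * K" using K(2) by (metis l.diff)
    also have "\<dots> \<le> (C * norm (x - y)) * K" using C[OF that] K(1) by (intro mult_right_mono) auto
    finally show ?thesis by (simp add: mult_ac)
  qed
  thus "\<exists>C. \<forall>x y. norm x \<le> r \<longrightarrow> norm y \<le> r \<longrightarrow> norm (l (f x) - l (f y)) \<le> C * norm (x - y)"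
    by blast
qed

lemma locally_lipschitz_bilinear:
  assumes p: "bounded_bilinear p" and f: "locally_lipschitz f" and g: "locally_lipschitz g"
  shows "locally_lipschitz (\<lambda>x. p (f x) (g x))"
  unfolding locally_lipschitz_def
proof
  fix r :: real
  interpret p: bounded_bilinear p by fact
  obtain C where C: "C > 0" "\<And>x y. norm x \<le> \<bar>r\<bar> \<Longrightarrow> norm y \<le> \<bar>r\<bar> \<Longrightarrow> norm (f x - f y) \<le> C * norm (x - y)"
    using locally_lipschitzD[OF f, of "\<bar>r\<bar>"] by blast
  obtain D where D: "D > 0" "\<And>x y. norm x \<le> \<bar>r\<bar> \<Longrightarrow> norm y \<le> \<bar>r\<bar> \<Longrightarrow> norm (g x - g y) \<le> D * norm (x - y)"
    using locally_lipschitzD[OF g, of "\<bar>r\<bar>"] by blast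
  obtain K where K: "K > 0" "\<And>x y. norm (p x y) \<le> norm x * norm y * K" using p.pos_bounded by blast
  define Mf where "Mf = norm (f 0) + C * \<bar>r\<bar>"
  define Mg where "Mg = norm (g 0) + D * \<bar>r\<bar>"
  have Mf: "norm (f x) \<le> Mf" if "norm x \<le> \<bar>r\<bar>" for x
  proof -
    have "norm (f x) \<le> norm (f 0) + norm (f x - f 0)" by (rule norm_triangle_sub)
    also have "norm (f x - f 0) \<le> C * norm (x - 0)" by (rule C(2)) (use that in auto)
    also have "\<dots> \<le> C * \<bar>r\<bar>" using C(1) that by simp
    finally show ?thesis by (simp add: Mf_def)
  qed
  have Mg: "norm (g x) \<le> Mg" if "norm x \<le> \<bar>r\<bar>" for x
  proof -
    have "norm (g x) \<le> norm (g 0) + norm (g x - g 0)" by (rule norm_triangle_sub)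
    also have "norm (g x - g 0) \<le> D * norm (x - 0)" by (rule D(2)) (use that in auto)
    also have "\<dots> \<le> D * \<bar>r\<bar>" using D(1) that by simp
    finally show ?thesis by (simp add: Mg_def)
  qed
  have "norm (p (f x) (g x) - p (f y) (g y)) \<le> (C * Mg * K + Mf * D * K) * norm (x - y)"
    if "norm x \<le> r" "norm y \<le> r" for x y
  proof -
    have that': "norm x \<le> \<bar>r\<bar>" "norm y \<le> \<bar>r\<bar>" using that by auto
    have "p (f x) (g x) - p (f y) (g y) = p (f x - f y) (g x) + p (f y) (g x - g y)"
      by (simp add: p.diff_left p.diff_right)
    also have "norm \<dots> \<le> norm (f x - f y) * norm (g x) * K + norm (f y) * norm (g x - g y) * K"
      by (intro norm_triangle_le add_mono K)
    also have "\<dots> \<le> (C * norm (x - y)) * Mg * K + Mf * (D * norm (x - y)) * K"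
      using C(1) D(1) K(1) Mf[OF that'(2)] Mg[OF that'(1)]
      by (intro add_mono mult_right_mono mult_mono C(2) D(2) that' Mf Mg)
         (auto intro: order_trans[OF norm_ge_zero])
    finally show ?thesis by (simp add: algebra_simps)
  qed
  thus "\<exists>C. \<forall>x y. norm x \<le> r \<longrightarrow> norm y \<le> r \<longrightarrow>
          norm (p (f x) (g x) - p (f y) (g y)) \<le> C * norm (x - y)"
    by blast
qed

lemma bounded_bilinear_sum:
  assumes "bounded_bilinear p" "bounded_bilinear q"
  shows "bounded_bilinear (\<lambda>x y. p x y + q x y)"
proof -
  interpret p: bounded_bilinear p by fact
  interpret q: bounded_bilinear q by fact
  obtain K where K: "\<And>x y. norm (p x y) \<le> norm x * norm y * K" using p.bounded by blast
  obtain L where L: "\<And>x y. norm (q x y) \<le> norm x * norm y * L" using q.bounded by blast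
  show ?thesis
  proof
    show "\<exists>K. \<forall>x y. norm (p x y + q x y) \<le> norm x * norm y * K"
    proof (intro exI[of _ "K + L"] allI)
      fix x y
      show "norm (p x y + q x y) \<le> norm x * norm y * (K + L)"
        unfolding distrib_left by (intro norm_triangle_mono K L)
    qed
  qed (simp_all add: p.add_left p.add_right q.add_left q.add_right p.scaleR_left p.scaleR_right
      q.scaleR_left q.scaleR_right scaleR_add_right)
qed

lemma bounded_bilinear_post:
  assumes "bounded_linear l" "bounded_bilinear p"
  shows "bounded_bilinear (\<lambda>x y. l (p x y))"
proof -
  interpret l: bounded_linear l by fact
  interpret p: bounded_bilinear p by fact
  obtain K where K: "K > 0" "\<And>x. norm (l x) \<le> norm x * K" using l.pos_bounded by blast
  obtain L where L: "\<And>x y. norm (p x y) \<le> norm x * norm y * L" using p.bounded by blast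
  show ?thesis
  proof
    show "\<exists>K. \<forall>x y. norm (l (p x y)) \<le> norm x * norm y * K"
    proof (intro exI[of _ "L * K"] allI)
      fix x y
      have "norm (l (p x y)) \<le> norm (p x y) * K" by (rule K)
      also have "\<dots> \<le> (norm x * norm y * L) * K" using K(1) L by (intro mult_right_mono) auto
      finally show "norm (l (p x y)) \<le> norm x * norm y * (L * K)" by (simp add: mult.assoc)
    qed
  qed (simp_all add: p.add_left p.add_right p.scaleR_left p.scaleR_right l.add l.scaleR)
qed

text \<open>
  Continuation of the solution \<open>z = 0\<close> of \<open>z + B (\<beta> z z) = 0\<close>. On a small ball the quadratic term has a
  small Lipschitz constant, and so does the perturbation for small \<open>\<epsilon>\<close>; the map
  \<open>z \<mapsto> - B (\<beta> z z + \<epsilon> G \<epsilon> z)\<close> is therefore a contraction of that ball, uniformly in \<open>\<epsilon>\<close>, and its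
  fixed point depends on \<open>\<epsilon>\<close> in a Lipschitz way.
\<close>

theorem perturbed_zero_curve:
  fixes B :: "'a::banach \<Rightarrow> 'a" and \<beta> :: "'a \<Rightarrow> 'a \<Rightarrow> 'a" and G :: "real \<Rightarrow> 'a \<Rightarrow> 'a"
  assumes B: "bounded_linear B" and \<beta>: "bounded_bilinear \<beta>"
    and G: "locally_lipschitz (\<lambda>p. G (fst p) (snd p))"
  shows "\<exists>\<epsilon>s>0. \<exists>z. continuous_on {-\<epsilon>s<..<\<epsilon>s} z \<and>
           (\<forall>\<epsilon>\<in>{-\<epsilon>s<..<\<epsilon>s}. norm (z \<epsilon>) \<le> 1 \<and> z \<epsilon> + B (\<beta> (z \<epsilon>) (z \<epsilon>) + \<epsilon> *\<^sub>R G \<epsilon> (z \<epsilon>)) = 0)"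
proof -
  interpret B: bounded_linear B by fact
  interpret \<beta>: bounded_bilinear \<beta> by fact
  have fstl: "locally_lipschitz (fst :: real \<times> 'a \<Rightarrow> real)"
    by (rule locally_lipschitz_bounded_linear[OF bounded_linear_fst])
  have sndl: "locally_lipschitz (snd :: real \<times> 'a \<Rightarrow> 'a)"
    by (rule locally_lipschitz_bounded_linear[OF bounded_linear_snd])
  obtain b where b: "b > 0" "\<And>x. norm (B x) \<le> norm x * b" using B.pos_bounded by blast
  obtain k where k: "k > 0" "\<And>x y. norm (\<beta> x y) \<le> norm x * norm y * k"
    using \<beta>.pos_bounded by blast
  obtain L where L: "L > 0" "\<And>p p'. norm p \<le> 2 \<Longrightarrow> norm p' \<le> 2 \<Longrightarrow>
      norm (G (fst p) (snd p) - G (fst p') (snd p')) \<le> L * norm (p - p')"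
    using locally_lipschitzD[OF G, of 2] by blast
  have pair: "norm (e, z) \<le> 2" if "\<bar>e\<bar> \<le> 1" "norm z \<le> 1" for e :: real and z :: 'a
    using norm_Pair_le[of e z] that by simp
  \<comment> \<open>On the ball of radius \<open>r\<close> the quadratic term contributes at most \<open>1/4\<close> to the Lipschitz
  constant of the fixed-point map; \<open>es\<close> bounds the contribution of \<open>G\<close> by \<open>1/4\<close> and the value at \<open>0\<close> by \<open>r / 2\<close>.\<close>
  define r where "r = min 1 (1 / (8 * b * k))"
  have r: "0 < r" "r \<le> 1" "r * (8 * b * k) \<le> 1"
    using b k by (auto simp: r_def min_def field_simps)
  define M where "M = norm (G 0 0) + L"
  have M: "M > 0" using L by (simp add: M_def add_nonneg_pos)
  define es where "es = min 1 (min (1 / (4 * b * L)) (r / (2 * b * M)))"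
  have es: "0 < es" "es \<le> 1" "es * (4 * b * L) \<le> 1" "es * (2 * b * M) \<le> r"
  proof -
    show "0 < es" "es \<le> 1" using r b L M by (auto simp: es_def)
    have "es \<le> 1 / (4 * b * L)" "es \<le> r / (2 * b * M)" by (auto simp: es_def)
    thus "es * (4 * b * L) \<le> 1" "es * (2 * b * M) \<le> r"
      using b(1) L(1) M by (auto simp: pos_le_divide_eq)
  qed
  define F where "F = (\<lambda>e z. - B (\<beta> z z + e *\<^sub>R G e z))"
  have lip: "norm (F e z - F e z') \<le> 1/2 * norm (z - z')"
    if "\<bar>e\<bar> \<le> es" "norm z \<le> r" "norm z' \<le> r" for e z z'
  proof -
    have "\<beta> z z - \<beta> z' z' = \<beta> (z - z') z + \<beta> z' (z - z')"
      by (simp add: \<beta>.diff_left \<beta>.diff_right)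
    hence "norm (\<beta> z z - \<beta> z' z') \<le> norm (z - z') * norm z * k + norm z' * norm (z - z') * k"
      by (simp only:) (intro norm_triangle_le add_mono k)
    also have "\<dots> \<le> norm (z - z') * r * k + r * norm (z - z') * k"
      using that k by (intro add_mono mult_right_mono mult_left_mono) auto
    finally have 1: "norm (\<beta> z z - \<beta> z' z') \<le> 2 * r * k * norm (z - z')"
      by (simp add: algebra_simps)
    have "norm (G e z - G e z') \<le> L * norm ((e, z) - (e, z'))"
      using L(2)[of "(e, z)" "(e, z')"] pair that es r by auto
    also have "norm ((e, z) - (e, z')) = norm (z - z')" by (simp add: norm_Pair)
    finally have "norm (e *\<^sub>R (G e z - G e z')) \<le> es * (L * norm (z - z'))"
      using that(1) L(1) by (simp only: norm_scaleR) (intro mult_mono, auto)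
    with 1 have "norm ((\<beta> z z - \<beta> z' z') + e *\<^sub>R (G e z - G e z'))
        \<le> 2 * r * k * norm (z - z') + es * (L * norm (z - z'))"
      by (intro norm_triangle_le add_mono)
    hence "norm ((\<beta> z z - \<beta> z' z') + e *\<^sub>R (G e z - G e z')) * b
        \<le> (2 * r * k * norm (z - z') + es * (L * norm (z - z'))) * b"
      using b by (intro mult_right_mono) auto
    also have "\<dots> = (r * (8 * b * k) / 4 + es * (4 * b * L) / 4) * norm (z - z')"
      by (simp add: field_simps)
    also have "\<dots> \<le> (1/4 + 1/4) * norm (z - z')"
      by (intro mult_right_mono add_mono divide_right_mono r(3) es(3)) auto
    finally have "norm ((\<beta> z z - \<beta> z' z') + e *\<^sub>R (G e z - G e z')) * b \<le> 1/2 * norm (z - z')" by simp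
    moreover have "F e z - F e z' = - B ((\<beta> z z - \<beta> z' z') + e *\<^sub>R (G e z - G e z'))"
      by (simp add: F_def B.add B.diff B.scaleR algebra_simps)
    ultimately show ?thesis using b(2) by (metis norm_minus_cancel order_trans)
  qed
  have F0: "norm (F e 0) \<le> r / 2" if "\<bar>e\<bar> \<le> es" for e
  proof -
    have "norm (G e 0 - G 0 0) \<le> L * norm ((e, 0::'a) - (0, 0))"
      using L(2)[of "(e, 0)" "(0, 0)"] pair that es by auto
    also have "\<dots> \<le> L * 1" using that es L by (intro mult_left_mono) (auto simp: norm_Pair)
    finally have "norm (G e 0) \<le> M" using norm_triangle_sub[of "G e 0" "G 0 0"] by (simp add: M_def)
    hence "norm (e *\<^sub>R G e 0) \<le> es * M" using that by (simp add: mult_mono)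
    hence "norm (e *\<^sub>R G e 0) * b \<le> es * M * b" using b by (intro mult_right_mono) auto
    also have "\<dots> \<le> r / 2" using es(4) by (simp add: field_simps)
    finally show ?thesis using b(2)[of "e *\<^sub>R G e 0"] by (simp add: F_def \<beta>.zero_left)
  qed
  have "\<exists>z. norm z \<le> r \<and> F e z = z" if e: "\<bar>e\<bar> \<le> es" for e
  proof -
    have "\<exists>!z. z \<in> cball 0 r \<and> F e z = z"
    proof (rule Banach_fix[of _ "1/2"])
      show "complete (cball 0 r :: 'a set)" by (simp add: complete_eq_closed)
      show "F e ` cball 0 r \<subseteq> cball 0 r"
      proof safe
        fix z :: 'a assume "z \<in> cball 0 r"
        hence z: "norm z \<le> r" by simp
        have "norm (F e z) \<le> norm (F e 0) + norm (F e z - F e 0)" by (rule norm_triangle_sub)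
        also have "\<dots> \<le> r / 2 + 1 / 2 * norm (z - 0)"
          using F0[OF e] lip[OF e z, of 0] r by (intro add_mono) auto
        also have "\<dots> \<le> r" using z by simp
        finally show "F e z \<in> cball 0 r" by simp
      qed
    qed (use r lip[OF e] in \<open>auto simp: dist_norm\<close>)
    thus ?thesis by auto
  qed
  then obtain z where z: "\<And>e. \<bar>e\<bar> \<le> es \<Longrightarrow> norm (z e) \<le> r" "\<And>e. \<bar>e\<bar> \<le> es \<Longrightarrow> F e (z e) = z e"
    by metis
  have FL: "locally_lipschitz (\<lambda>p. - B (\<beta> (snd p) (snd p) + fst p *\<^sub>R G (fst p) (snd p)))"
    by (intro locally_lipschitz_compose_linear[OF bounded_linear_minus[OF B]] locally_lipschitz_add
        locally_lipschitz_bilinear[OF \<beta>] locally_lipschitz_bilinear[OF bounded_bilinear_scaleR] fstl sndl G)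
  obtain D where D: "D > 0" "\<And>p p'. norm p \<le> 2 \<Longrightarrow> norm p' \<le> 2 \<Longrightarrow>
      norm (F (fst p) (snd p) - F (fst p') (snd p')) \<le> D * norm (p - p')"
    unfolding F_def using locally_lipschitzD[OF FL, of 2] by blast
  have zL: "norm (z e - z e') \<le> (2 * D) * \<bar>e - e'\<bar>" if "\<bar>e\<bar> \<le> es" "\<bar>e'\<bar> \<le> es" for e e'
  proof -
    have "z e - z e' = (F e (z e) - F e (z e')) + (F e (z e') - F e' (z e'))" using z that by simp
    hence "norm (z e - z e') \<le> norm (F e (z e) - F e (z e')) + norm (F e (z e') - F e' (z e'))"
      by (metis norm_triangle_ineq)
    also have "\<dots> \<le> 1/2 * norm (z e - z e') + D * norm ((e, z e') - (e', z e'))"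
      using D(2)[of "(e, z e')" "(e', z e')"] pair z[OF that(2)] r es that
      by (intro add_mono lip z) auto
    also have "norm ((e, z e') - (e', z e')) = \<bar>e - e'\<bar>" by (simp add: norm_Pair)
    finally show ?thesis by simp
  qed
  have "continuous_on {-es<..<es} z"
  proof (rule lipschitz_on_continuous_on)
    show "(2 * D)-lipschitz_on {-es<..<es} z"
      using D(1) zL by (intro lipschitz_onI) (auto simp: dist_norm)
  qed
  moreover have "norm (z e) \<le> 1 \<and> z e + B (\<beta> (z e) (z e) + e *\<^sub>R G e (z e)) = 0"
    if "e \<in> {-es<..<es}" for e
  proof
    have e: "\<bar>e\<bar> \<le> es" using that by auto
    show "norm (z e) \<le> 1" using z(1)[OF e] r(2) by linarith
    have "z e = - B (\<beta> (z e) (z e) + e *\<^sub>R G e (z e))" using z(2)[OF e] by (simp add: F_def)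
    thus "z e + B (\<beta> (z e) (z e) + e *\<^sub>R G e (z e)) = 0" by (simp only: eq_neg_iff_add_eq_0)
  qed
  ultimately show ?thesis using es(1) by blast
qed

section \<open>The Banach algebra of continuous periodic functions\<close>

text \<open>
  The continuous \<open>2\<pi>\<close>-periodic functions, as a type of their own so that the results on Banach spaces
  apply to them. The norm is inherited from the bounded continuous functions.
\<close>

typedef pcf = "{f :: real \<Rightarrow>\<^sub>C complex. periodic_2pi (apply_bcontfun f)}"
  morphisms bcf_of_pcf Abs_pcf
  by (rule exI[of _ 0]) (simp add: periodic_2pi_def)

setup_lifting type_definition_pcf

definition pfun :: "pcf \<Rightarrow> real \<Rightarrow> complex" where
  "pfun f = apply_bcontfun (bcf_of_pcf f)"

definition Pfun :: "(real \<Rightarrow> complex) \<Rightarrow> pcf" where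
  "Pfun g = Abs_pcf (Bcontfun g)"

lemma pcf_eqI: "(\<And>x. pfun f x = pfun g x) \<Longrightarrow> f = g"
  unfolding pfun_def by (metis bcontfun_eqI bcf_of_pcf_inject)

lemma periodic_pfun: "periodic_2pi (pfun f)"
  using bcf_of_pcf[of f] by (simp add: pfun_def)

lemma pfun_add_2pi [simp]: "pfun f (x + 2 * pi) = pfun f x"
  using periodic_pfun[of f] by (simp add: periodic_2pi_def)

lemma continuous_on_pfun [continuous_intros]:
  "continuous_on S g \<Longrightarrow> continuous_on S (\<lambda>x. pfun f (g x))"
  unfolding pfun_def
  by (rule continuous_on_compose2[OF continuous_on_apply_bcontfun[of UNIV]]) auto

lemma periodic_2pi_reduce:
  assumes "periodic_2pi g"
  obtains y where "y \<in> {-pi..<pi}" "g x = g y" "\<exists>k::int. x = y + of_int k * (2 * pi)"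
proof -
  have shift: "g (y + of_int k * (2 * pi)) = g y" for k :: int and y
  proof (induction k rule: int_induct[where k = 0])
    case (step1 i)
    have "g (y + of_int (i + 1) * (2 * pi)) = g ((y + of_int i * (2 * pi)) + 2 * pi)"
      by (simp add: algebra_simps)
    thus ?case using assms step1 by (simp add: periodic_2pi_def)
  next
    case (step2 i)
    have "g (y + of_int i * (2 * pi)) = g ((y + of_int (i - 1) * (2 * pi)) + 2 * pi)"
      by (simp add: algebra_simps)
    thus ?case using assms step2 by (simp add: periodic_2pi_def)
  qed simp
  define k where "k = \<lfloor>(x + pi) / (2 * pi)\<rfloor>"
  define y where "y = x - of_int k * (2 * pi)"
  have "of_int k \<le> (x + pi) / (2 * pi)" "(x + pi) / (2 * pi) < of_int k + 1"
    unfolding k_def by linarith+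
  hence "y \<in> {-pi..<pi}"
    using pi_gt_zero unfolding y_def by (auto simp: field_simps)
  moreover have "x = y + of_int k * (2 * pi)" by (simp add: y_def)
  ultimately show ?thesis using that shift[of y k] by blast
qed

lemma pfun_Pfun:
  assumes "continuous_on UNIV g" "periodic_2pi g"
  shows "pfun (Pfun g) = g"
proof -
  have "compact (g ` {-pi..pi})"
    by (intro compact_continuous_image continuous_on_subset[OF assms(1)]) auto
  moreover have "range g \<subseteq> g ` {-pi..pi}"
  proof safe
    fix x
    obtain y where "y \<in> {-pi..<pi}" "g x = g y" using assms(2) by (rule periodic_2pi_reduce)
    thus "g x \<in> g ` {-pi..pi}" by auto
  qed
  ultimately have "bounded (range g)" using bounded_subset compact_imp_bounded by blast
  hence "g \<in> bcontfun" using assms(1) by (simp add: bcontfun_def)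
  hence 1: "apply_bcontfun (Bcontfun g) = g" by (rule Bcontfun_inverse)
  hence "bcf_of_pcf (Pfun g) = Bcontfun g"
    unfolding Pfun_def using assms(2) by (intro Abs_pcf_inverse) simp
  with 1 show ?thesis by (simp add: pfun_def)
qed

instantiation pcf :: real_vector
begin

lift_definition zero_pcf :: pcf is 0 by (simp add: periodic_2pi_def)
lift_definition plus_pcf :: "pcf \<Rightarrow> pcf \<Rightarrow> pcf" is "(+)" by (simp add: periodic_2pi_def)
lift_definition minus_pcf :: "pcf \<Rightarrow> pcf \<Rightarrow> pcf" is "(-)" by (simp add: periodic_2pi_def)
lift_definition uminus_pcf :: "pcf \<Rightarrow> pcf" is uminus by (simp add: periodic_2pi_def)
lift_definition scaleR_pcf :: "real \<Rightarrow> pcf \<Rightarrow> pcf" is scaleR by (simp add: periodic_2pi_def)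

instance
proof
  fix f g h :: pcf and a b :: real
  show "f + g + h = f + (g + h)" by transfer simp
  show "f + g = g + f" by transfer simp
  show "0 + f = f" by transfer simp
  show "- f + f = 0" by transfer simp
  show "f - g = f + - g" by transfer simp
  show "a *\<^sub>R (f + g) = a *\<^sub>R f + a *\<^sub>R g" by transfer (rule scaleR_add_right)
  show "(a + b) *\<^sub>R f = a *\<^sub>R f + b *\<^sub>R f" by transfer (rule scaleR_add_left)
  show "a *\<^sub>R b *\<^sub>R f = (a * b) *\<^sub>R f" by transfer simp
  show "1 *\<^sub>R f = f" by transfer simp
qed

end

instantiation pcf :: real_normed_vector
begin

lift_definition norm_pcf :: "pcf \<Rightarrow> real" is norm .
lift_definition dist_pcf :: "pcf \<Rightarrow> pcf \<Rightarrow> real" is dist .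
definition sgn_pcf :: "pcf \<Rightarrow> pcf" where "sgn_pcf f = f /\<^sub>R norm f"
definition uniformity_pcf :: "(pcf \<times> pcf) filter" where
  "uniformity_pcf = (INF e\<in>{0 <..}. principal {(x, y). dist x y < e})"
definition open_pcf :: "pcf set \<Rightarrow> bool" where
  "open_pcf S = (\<forall>x\<in>S. \<forall>\<^sub>F (x', y) in uniformity. x' = x \<longrightarrow> y \<in> S)"

instance
proof
  fix f g :: pcf and a :: real
  show "dist f g = norm (f - g)" by transfer (rule dist_norm)
  show "norm f = 0 \<longleftrightarrow> f = 0" by transfer simp
  show "norm (f + g) \<le> norm f + norm g" by transfer (rule norm_triangle_ineq)
  show "norm (a *\<^sub>R f) = \<bar>a\<bar> * norm f" by transfer simp
qed (simp_all add: sgn_pcf_def uniformity_pcf_def open_pcf_def)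

end

lemma pfun_simps [simp]:
  "pfun 0 x = 0" "pfun (f + g) x = pfun f x + pfun g x" "pfun (f - g) x = pfun f x - pfun g x"
  "pfun (- f) x = - pfun f x" "pfun (a *\<^sub>R f) x = a *\<^sub>R pfun f x"
  by (simp_all add: pfun_def zero_pcf.rep_eq plus_pcf.rep_eq minus_pcf.rep_eq uminus_pcf.rep_eq
      scaleR_pcf.rep_eq)

lemma norm_pfun_le: "norm (pfun f x) \<le> norm f"
  unfolding pfun_def norm_pcf.rep_eq by (rule norm_bounded)

lemma norm_pcf_leI:
  assumes "\<And>x. x \<in> {-pi..pi} \<Longrightarrow> norm (pfun f x) \<le> C"
  shows "norm f \<le> C"
  unfolding norm_pcf.rep_eq
proof (rule norm_bound)
  fix x
  obtain y where "y \<in> {-pi..<pi}" "pfun f x = pfun f y"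
    using periodic_pfun by (rule periodic_2pi_reduce)
  thus "norm (apply_bcontfun (bcf_of_pcf f) x) \<le> C"
    using assms[of y] by (simp add: pfun_def)
qed

instance pcf :: banach
proof
  fix X :: "nat \<Rightarrow> pcf"
  assume "Cauchy X"
  hence "Cauchy (\<lambda>n. bcf_of_pcf (X n))"
    unfolding Cauchy_def by (simp add: dist_pcf.rep_eq)
  then obtain l where l: "(\<lambda>n. bcf_of_pcf (X n)) \<longlonglongrightarrow> l"
    using Cauchy_convergent_iff convergent_def by blast
  have pt: "(\<lambda>n. pfun (X n) x) \<longlonglongrightarrow> apply_bcontfun l x" for x
    unfolding pfun_def
    by (rule tendsto_uniform_limitI[OF tendsto_bcontfun_uniform_limit[OF l]]) simp
  have "periodic_2pi (apply_bcontfun l)"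
    unfolding periodic_2pi_def
  proof
    fix x
    show "apply_bcontfun l (x + 2 * pi) = apply_bcontfun l x"
      using LIMSEQ_unique[OF pt[of x]] pt[of "x + 2 * pi"] by simp
  qed
  hence "bcf_of_pcf (Abs_pcf l) = l" by (intro Abs_pcf_inverse) simp
  hence "X \<longlonglongrightarrow> Abs_pcf l"
    using l unfolding tendsto_iff by (simp add: dist_pcf.rep_eq)
  thus "convergent X" by (auto simp: convergent_def)
qed

instantiation pcf :: times
begin
definition times_pcf :: "pcf \<Rightarrow> pcf \<Rightarrow> pcf" where
  "times_pcf f g = Pfun (\<lambda>x. pfun f x * pfun g x)"
instance ..
end

definition pconst :: "complex \<Rightarrow> pcf" where
  "pconst c = Pfun (\<lambda>_. c)"

definition pcnj :: "pcf \<Rightarrow> pcf" where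
  "pcnj f = Pfun (\<lambda>x. cnj (pfun f x))"

lemma pfun_times [simp]: "pfun (f * g) x = pfun f x * pfun g x"
  unfolding times_pcf_def
  by (subst pfun_Pfun) (auto intro!: continuous_intros simp: periodic_2pi_def)

lemma pfun_pconst [simp]: "pfun (pconst c) x = c"
  unfolding pconst_def
  by (subst pfun_Pfun) (auto simp: periodic_2pi_def)

lemma pfun_pcnj [simp]: "pfun (pcnj f) x = cnj (pfun f x)"
  unfolding pcnj_def
  by (subst pfun_Pfun) (auto intro!: continuous_intros simp: periodic_2pi_def)

instance pcf :: "{real_normed_algebra, comm_ring}"
proof
  fix f g h :: pcf and a :: real
  show "norm (f * g) \<le> norm f * norm g"
    by (rule norm_pcf_leI) (simp add: norm_mult mult_mono norm_pfun_le)
qed (auto intro!: pcf_eqI simp: algebra_simps)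

lemma bounded_linear_pconst: "bounded_linear pconst"
  by (rule bounded_linear_intro[where K = 1]) (auto intro!: pcf_eqI norm_pcf_leI)

lemma bounded_linear_pcnj: "bounded_linear pcnj"
  by (rule bounded_linear_intro[where K = 1]) (auto intro!: pcf_eqI norm_pcf_leI norm_pfun_le)

lemma pconst_0: "pconst 0 = 0"
  by (rule pcf_eqI) simp

definition pint :: "pcf \<Rightarrow> complex" where
  "pint f = integral {-pi..pi} (pfun f)"

lemma pfun_integrable: "pfun f integrable_on {a..b}"
  by (rule integrable_continuous_interval) (intro continuous_intros)

lemma norm_pint_le: "norm (pint f) \<le> norm f * (2 * pi)"
  unfolding pint_def
  using integral_bound[of "-pi" pi "pfun f" "norm f"] norm_pfun_le[of f]
  by (simp add: continuous_on_pfun continuous_on_id)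

lemma bounded_linear_pint: "bounded_linear pint"
proof (rule bounded_linear_intro)
  show "pint (f + g) = pint f + pint g" for f g
    unfolding pint_def by (subst integral_add[symmetric]) (auto intro!: pfun_integrable integral_cong)
  show "pint (a *\<^sub>R f) = a *\<^sub>R pint f" for a f
  proof -
    have "pfun (a *\<^sub>R f) = (\<lambda>x. a *\<^sub>R pfun f x)" by auto
    thus ?thesis by (simp add: pint_def)
  qed
  show "norm (pint f) \<le> norm f * (2 * pi)" for f by (rule norm_pint_le)
qed

lemmas pint_add = linear_add[OF bounded_linear.linear[OF bounded_linear_pint]]
  and pint_diff = linear_diff[OF bounded_linear.linear[OF bounded_linear_pint]]
  and pint_scaleR = linear_cmul[OF bounded_linear.linear[OF bounded_linear_pint]]

lemma pint_pconst [simp]: "pint (pconst c) = of_real (2 * pi) * c"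
proof -
  have "pint (pconst c) = integral {-pi..pi} (\<lambda>_. c)"
    unfolding pint_def by (rule integral_cong) simp
  thus ?thesis by (simp add: scaleR_conv_of_real)
qed

definition pmean :: "pcf \<Rightarrow> complex" where
  "pmean f = (1 / (2 * pi)) *\<^sub>R pint f"

lemma bounded_linear_pmean: "bounded_linear pmean"
  unfolding pmean_def
  by (rule bounded_linear_compose[OF bounded_linear_scaleR_right bounded_linear_pint])

lemmas pmean_add = linear_add[OF bounded_linear.linear[OF bounded_linear_pmean]]
  and pmean_diff = linear_diff[OF bounded_linear.linear[OF bounded_linear_pmean]]
  and pmean_scaleR = linear_cmul[OF bounded_linear.linear[OF bounded_linear_pmean]]

lemma pmean_pconst [simp]: "pmean (pconst c) = c"
  by (simp add: pmean_def scaleR_conv_of_real)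

definition pinner :: "pcf \<Rightarrow> pcf \<Rightarrow> real" where
  "pinner f g = Re (pint (f * pcnj g))"

lemma bounded_linear_pinner_left: "bounded_linear (\<lambda>f. pinner f g)"
  unfolding pinner_def
  by (intro bounded_linear_compose[OF bounded_linear_Re] bounded_linear_compose[OF bounded_linear_pint]
      bounded_linear_mult_left)

lemma pinner_add_left: "pinner (f + g) h = pinner f h + pinner g h"
  and pinner_diff_left: "pinner (f - g) h = pinner f h - pinner g h"
  and pinner_minus_left: "pinner (- f) h = - pinner f h"
  and pinner_scaleR_left: "pinner (a *\<^sub>R f) h = a * pinner f h"
  and pinner_zero_left: "pinner 0 h = 0"
proof -
  interpret bounded_linear "\<lambda>f. pinner f h" by (rule bounded_linear_pinner_left)
  show "pinner (f + g) h = pinner f h + pinner g h" by (rule add)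
  show "pinner (f - g) h = pinner f h - pinner g h" by (rule diff)
  show "pinner (- f) h = - pinner f h" by (rule neg)
  show "pinner (a *\<^sub>R f) h = a * pinner f h" by (simp add: scaleR)
  show "pinner 0 h = 0" by (rule zero)
qed

lemmas pinner_simps = pinner_add_left pinner_diff_left pinner_minus_left pinner_scaleR_left
  pinner_zero_left

lemma pinner_self:
  shows "pinner f f \<ge> 0" and "pinner f f = 0 \<Longrightarrow> f = 0"
proof -
  have eq: "pinner f f = integral {-pi..pi} (\<lambda>x. (cmod (pfun f x))\<^sup>2)"
  proof -
    have "Re (integral {-pi..pi} (pfun (f * pcnj f))) = integral {-pi..pi} (Re \<circ> pfun (f * pcnj f))"
      by (rule integral_linear[OF pfun_integrable bounded_linear_Re, symmetric])
    also have "Re \<circ> pfun (f * pcnj f) = (\<lambda>x. (cmod (pfun f x))\<^sup>2)"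
      by (rule ext, simp add: cmod_power2, simp add: power2_eq_square)
    finally show ?thesis by (simp only: pinner_def pint_def)
  qed
  show "pinner f f \<ge> 0" unfolding eq
    by (rule integral_nonneg) (auto intro!: integrable_continuous_interval continuous_intros)
  assume "pinner f f = 0"
  have "(cmod (pfun f x))\<^sup>2 = 0" if "x \<in> {-pi..pi}" for x
    using that \<open>pinner f f = 0\<close> unfolding eq
    by (subst (asm) integral_eq_0_iff) (auto intro!: continuous_intros)
  hence "norm f \<le> 0" by (intro norm_pcf_leI) simp
  thus "f = 0" by simp
qed

section \<open>Derivatives and primitives of periodic functions\<close>

text \<open>
  A relation between two periodic continuous functions, so that every function it applies to is of
  class \<open>C\<^sup>1\<close>.
\<close>

definition has_pderiv :: "pcf \<Rightarrow> pcf \<Rightarrow> bool" where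
  "has_pderiv f f' \<longleftrightarrow> (\<forall>x. (pfun f has_vector_derivative pfun f' x) (at x))"

named_theorems pderiv_intros

lemma has_pderiv_pconst [pderiv_intros]: "has_pderiv (pconst c) 0"
proof -
  have "pfun (pconst c) = (\<lambda>_. c)" by auto
  thus ?thesis by (auto simp: has_pderiv_def)
qed

lemma has_pderiv_add [pderiv_intros]:
  assumes "has_pderiv f f'" "has_pderiv g g'"
  shows "has_pderiv (f + g) (f' + g')"
proof -
  have "pfun (f + g) = (\<lambda>x. pfun f x + pfun g x)" by auto
  thus ?thesis using assms by (auto simp: has_pderiv_def intro!: has_vector_derivative_add)
qed

lemma has_pderiv_diff [pderiv_intros]:
  assumes "has_pderiv f f'" "has_pderiv g g'"
  shows "has_pderiv (f - g) (f' - g')"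
proof -
  have "pfun (f - g) = (\<lambda>x. pfun f x - pfun g x)" by auto
  thus ?thesis using assms by (auto simp: has_pderiv_def intro!: has_vector_derivative_diff)
qed

lemma has_pderiv_scaleR [pderiv_intros]:
  assumes "has_pderiv f f'"
  shows "has_pderiv (a *\<^sub>R f) (a *\<^sub>R f')"
proof -
  have "pfun (a *\<^sub>R f) = (\<lambda>x. a *\<^sub>R pfun f x)" by auto
  thus ?thesis using assms
    by (auto simp: has_pderiv_def intro!: bounded_linear.has_vector_derivative[OF bounded_linear_scaleR_right])
qed

lemma has_pderiv_mult [pderiv_intros]:
  assumes "has_pderiv f f'" "has_pderiv g g'"
  shows "has_pderiv (f * g) (f * g' + f' * g)"
proof -
  have "pfun (f * g) = (\<lambda>x. pfun f x * pfun g x)" by auto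
  thus ?thesis using assms by (auto simp: has_pderiv_def intro!: has_vector_derivative_mult)
qed

lemma has_pderiv_pcnj [pderiv_intros]:
  assumes "has_pderiv f f'"
  shows "has_pderiv (pcnj f) (pcnj f')"
proof -
  have "pfun (pcnj f) = (\<lambda>x. cnj (pfun f x))" by auto
  thus ?thesis using assms
    by (auto simp: has_pderiv_def intro!: bounded_linear.has_vector_derivative[OF bounded_linear_cnj])
qed

lemma has_pderiv_unique:
  assumes "has_pderiv f f'" "has_pderiv f g'"
  shows "f' = g'"
  using assms by (intro pcf_eqI) (auto simp: has_pderiv_def intro: vector_derivative_unique_at)

lemma pmean_has_pderiv:
  assumes "has_pderiv f f'"
  shows "pmean f' = 0"
proof -
  have "(pfun f' has_integral pfun f pi - pfun f (- pi)) {-pi..pi}"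
    using assms by (intro fundamental_theorem_of_calculus)
      (auto simp: has_pderiv_def intro: has_vector_derivative_at_within)
  moreover have "pfun f pi = pfun f (- pi)" using pfun_add_2pi[of f "-pi"] by simp
  ultimately have "pint f' = 0" unfolding pint_def by (simp add: integral_unique)
  thus ?thesis by (simp add: pmean_def)
qed

lemma has_pderiv_0_imp_const:
  assumes "has_pderiv f 0"
  shows "f = pconst (pmean f)"
proof -
  have "(pfun f has_vector_derivative 0) (at x within UNIV)" for x
    using assms by (simp add: has_pderiv_def)
  from has_vector_derivative_zero_constant[OF convex_UNIV this]
  obtain c where "\<And>x. pfun f x = c" by auto
  hence "f = pconst c" by (intro pcf_eqI) simp
  thus ?thesis by simp
qed

lemma continuous_antiderivative:
  fixes g :: "real \<Rightarrow> 'a::euclidean_space"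
  assumes "continuous_on UNIV g"
  shows "\<exists>G. \<forall>x. (G has_vector_derivative g x) (at x)"
proof (intro exI allI)
  fix x :: real
  define a b where "a = min 0 x - 1" and "b = max 0 x + 1"
  have "((\<lambda>u. LBINT y=(0::real)..u. g y) has_vector_derivative g x) (at x within {a..b})"
    by (rule interval_integral_FTC2)
       (auto simp: a_def b_def intro: continuous_on_subset[OF assms])
  moreover have "at x within {a..b} = at x"
    by (rule at_within_Icc_at) (auto simp: a_def b_def)
  ultimately show "((\<lambda>u. LBINT y=(0::real)..u. g y) has_vector_derivative g x) (at x)" by simp
qed

text \<open>
  A function with mean zero has a periodic primitive \<open>G\<close>: the increment \<open>G (x + 2\<pi>) - G x\<close> has
  derivative zero, and it vanishes at \<open>x = -\<pi>\<close>.
\<close>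

lemma mean_zero_primitive_exists:
  "\<exists>g. has_pderiv g (f - pconst (pmean f)) \<and> pmean g = 0"
proof -
  define h where "h = f - pconst (pmean f)"
  have mh: "pint h = 0" by (simp add: h_def pint_diff pmean_def scaleR_conv_of_real)
  obtain G where G: "\<And>x. (G has_vector_derivative pfun h x) (at x)"
    using continuous_antiderivative[of "pfun h"] continuous_on_pfun[OF continuous_on_id, of UNIV h] by auto
  have "((\<lambda>x. G (x + 2 * pi) - G x) has_vector_derivative 0) (at x within UNIV)" for x
  proof -
    have "((\<lambda>x. G (x + 2 * pi)) has_vector_derivative 1 *\<^sub>R pfun h (x + 2 * pi)) (at x)"
      by (rule vector_diff_chain_at[of "\<lambda>x. x + 2 * pi" 1 x G, unfolded o_def])
         (auto intro!: derivative_eq_intros G simp del: pfun_add_2pi)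
    from has_vector_derivative_diff[OF this G] show ?thesis by simp
  qed
  from has_vector_derivative_zero_constant[OF convex_UNIV this]
  obtain c where c: "\<And>x. G (x + 2 * pi) - G x = c" by auto
  have "(pfun h has_integral G pi - G (- pi)) {-pi..pi}"
    by (intro fundamental_theorem_of_calculus) (auto intro: has_vector_derivative_at_within G)
  hence "G pi - G (- pi) = 0" using mh by (simp add: pint_def integral_unique)
  hence "c = 0" using c[of "-pi"] by simp
  hence per: "periodic_2pi G" using c by (simp add: periodic_2pi_def)
  have "continuous_on UNIV G"
    by (rule continuous_at_imp_continuous_on) (use G has_vector_derivative_continuous in blast)
  hence "pfun (Pfun G) = G" using per by (rule pfun_Pfun)
  hence "has_pderiv (Pfun G) h" using G by (simp add: has_pderiv_def)
  hence "has_pderiv (Pfun G - pconst (pmean (Pfun G))) (h - 0)"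
    by (intro pderiv_intros)
  thus ?thesis unfolding h_def
    by (intro exI[of _ "Pfun G - pconst (pmean (Pfun G))"]) (simp add: pmean_diff)
qed

definition pprim :: "pcf \<Rightarrow> pcf" where
  "pprim f = (SOME g. has_pderiv g (f - pconst (pmean f)) \<and> pmean g = 0)"

lemma has_pderiv_pprim: "has_pderiv (pprim f) (f - pconst (pmean f))"
  and pmean_pprim: "pmean (pprim f) = 0"
  using someI_ex[OF mean_zero_primitive_exists[of f]] by (auto simp: pprim_def)

text \<open>
  This characterisation spares any formula for the primitive: linearity of \<open>pprim\<close> is an
  instance of it.
\<close>

lemma pprim_eqI:
  assumes "has_pderiv g (f - pconst (pmean f))" "pmean g = 0"
  shows "pprim f = g"
proof -
  have "has_pderiv (pprim f - g) 0"
    using has_pderiv_diff[OF has_pderiv_pprim[of f] assms(1)] by simp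
  from has_pderiv_0_imp_const[OF this] have "pprim f - g = pconst 0"
    using assms(2) by (simp add: pmean_diff pmean_pprim)
  also have "pconst 0 = 0" by (rule pconst_0)
  finally show ?thesis by simp
qed

lemma pprim_has_pderiv:
  assumes "has_pderiv f f'"
  shows "pprim f' = f - pconst (pmean f)"
proof (rule pprim_eqI)
  have "pconst 0 = 0" by (rule pconst_0)
  thus "has_pderiv (f - pconst (pmean f)) (f' - pconst (pmean f'))"
    using has_pderiv_diff[OF assms has_pderiv_pconst] pmean_has_pderiv[OF assms] by simp
qed (simp add: pmean_diff)

lemma norm_minus_pmean_le: "norm (f - pconst (pmean f)) \<le> 2 * norm f"
proof (rule norm_pcf_leI)
  fix x
  have "norm (pint f) \<le> norm f * (2 * pi)" by (rule norm_pint_le)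
  hence "norm (pmean f) \<le> norm f" by (simp add: pmean_def field_simps)
  thus "norm (pfun (f - pconst (pmean f)) x) \<le> 2 * norm f"
    using norm_triangle_ineq4[of "pfun f x" "pmean f"] norm_pfun_le[of f x] by simp
qed

lemma pprim_lipschitz: "norm (pfun (pprim f) x - pfun (pprim f) y) \<le> 2 * norm f * \<bar>x - y\<bar>"
proof -
  have "norm (pfun (pprim f) x - pfun (pprim f) y) \<le> (2 * norm f) * norm (x - y)"
  proof (rule differentiable_bound[OF convex_UNIV])
    show "(pfun (pprim f) has_derivative (\<lambda>h. h *\<^sub>R pfun (f - pconst (pmean f)) z)) (at z within UNIV)" for z
      using has_pderiv_pprim[of f] by (simp add: has_pderiv_def has_vector_derivative_def)
    show "onorm (\<lambda>h. h *\<^sub>R pfun (f - pconst (pmean f)) z) \<le> 2 * norm f" for z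
    proof (rule onorm_bound)
      fix h :: real
      have "norm (pfun (f - pconst (pmean f)) z) \<le> 2 * norm f"
        using norm_pfun_le norm_minus_pmean_le by (rule order_trans)
      thus "norm (h *\<^sub>R pfun (f - pconst (pmean f)) z) \<le> 2 * norm f * norm h"
        unfolding norm_scaleR real_norm_def mult.commute[of _ "\<bar>h\<bar>"] by (intro mult_left_mono) auto
    qed simp
  qed auto
  thus ?thesis by simp
qed

text \<open>
  A mean-zero function is bounded by its oscillation, which the Lipschitz bound controls.
\<close>

lemma norm_pprim_le: "norm (pprim f) \<le> 4 * pi * norm f"
proof (rule norm_pcf_leI)
  fix x assume x: "x \<in> {-pi..pi}"
  have "norm (integral {-pi..pi} (\<lambda>y. pfun (pprim f) x - pfun (pprim f) y)) \<le> (4 * pi * norm f) * (pi - (- pi))"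
  proof (rule integral_bound)
    fix y assume y: "y \<in> {-pi..pi}"
    have "norm (pfun (pprim f) x - pfun (pprim f) y) \<le> 2 * norm f * \<bar>x - y\<bar>" by (rule pprim_lipschitz)
    also have "\<dots> \<le> 2 * norm f * (2 * pi)" using x y by (intro mult_left_mono) auto
    finally show "norm (pfun (pprim f) x - pfun (pprim f) y) \<le> 4 * pi * norm f" by (simp add: mult_ac)
  qed (auto intro!: continuous_intros)
  also have "integral {-pi..pi} (\<lambda>y. pfun (pprim f) x - pfun (pprim f) y)
      = of_real (2 * pi) * pfun (pprim f) x - pint (pprim f)"
    unfolding pint_def by (subst integral_diff) (auto intro: pfun_integrable simp: scaleR_conv_of_real)
  also have "pint (pprim f) = 0" using pmean_pprim[of f] by (simp add: pmean_def)
  finally show "norm (pfun (pprim f) x) \<le> 4 * pi * norm f" by (simp add: norm_mult field_simps)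
qed

lemma bounded_linear_pprim: "bounded_linear pprim"
proof (rule bounded_linear_intro)
  show "pprim (f + g) = pprim f + pprim g" for f g
  proof (rule pprim_eqI)
    have "f + g - pconst (pmean (f + g)) = (f - pconst (pmean f)) + (g - pconst (pmean g))"
      by (rule pcf_eqI) (simp add: pmean_add)
    thus "has_pderiv (pprim f + pprim g) (f + g - pconst (pmean (f + g)))"
      using has_pderiv_add[OF has_pderiv_pprim[of f] has_pderiv_pprim[of g]] by (simp only:)
  qed (simp add: pmean_add pmean_pprim)
  show "pprim (a *\<^sub>R f) = a *\<^sub>R pprim f" for a f
  proof (rule pprim_eqI)
    have "a *\<^sub>R f - pconst (pmean (a *\<^sub>R f)) = a *\<^sub>R (f - pconst (pmean f))"
      by (rule pcf_eqI) (simp add: pmean_scaleR algebra_simps)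
    thus "has_pderiv (a *\<^sub>R pprim f) (a *\<^sub>R f - pconst (pmean (a *\<^sub>R f)))"
      using has_pderiv_scaleR[OF has_pderiv_pprim[of f]] by (simp only:)
  qed (simp add: pmean_scaleR pmean_pprim)
  show "norm (pprim f) \<le> norm f * (4 * pi)" for f
    using norm_pprim_le[of f] by (simp add: mult_ac)
qed

lemmas pprim_add = linear_add[OF bounded_linear.linear[OF bounded_linear_pprim]]
  and pprim_scaleR = linear_cmul[OF bounded_linear.linear[OF bounded_linear_pprim]]

text \<open>
  Primitives of a bounded family are equicontinuous, so that the theorem of Arzela and Ascoli applies.
\<close>

lemma compact_operator_pprim: "compact_operator pprim"
  unfolding compact_operator_def
proof (intro conjI allI impI bounded_linear_pprim)
  fix f :: "nat \<Rightarrow> pcf" assume "bounded (range f)"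
  then obtain B where B: "\<And>n. norm (f n) \<le> B" by (auto simp: bounded_iff)
  have B0: "B \<ge> 0" using B[of 0] norm_ge_zero order_trans by blast
  have M: "norm (pfun (pprim (f n)) x) \<le> 4 * pi * B" for n x
  proof -
    have "norm (pfun (pprim (f n)) x) \<le> norm (pprim (f n))" by (rule norm_pfun_le)
    also have "\<dots> \<le> 4 * pi * norm (f n)" by (rule norm_pprim_le)
    also have "\<dots> \<le> 4 * pi * B" using B by (intro mult_left_mono) auto
    finally show ?thesis .
  qed
  have lip: "norm (pfun (pprim (f n)) x - pfun (pprim (f n)) y) \<le> 2 * B * \<bar>x - y\<bar>" for n x y
    by (rule order_trans[OF pprim_lipschitz]) (use B in \<open>auto intro!: mult_right_mono\<close>)
  obtain g r where r: "continuous_on {-pi..pi} g" "strict_mono (r :: nat \<Rightarrow> nat)"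
    "\<And>e. 0 < e \<Longrightarrow> \<exists>N. \<forall>n x. n \<ge> N \<and> x \<in> {-pi..pi} \<longrightarrow> norm (pfun (pprim (f (r n))) x - g x) < e"
  proof (rule Arzela_Ascoli[of "{-pi..pi}" "\<lambda>n. pfun (pprim (f n))" "4 * pi * B"])
    show "\<exists>d>0. \<forall>n y. y \<in> {- pi..pi} \<and> norm (x - y) < d \<longrightarrow>
             norm (pfun (pprim (f n)) x - pfun (pprim (f n)) y) < e"
      if "x \<in> {-pi..pi}" "0 < e" for x e
    proof (intro exI[of _ "e / (2 * B + 1)"] conjI allI impI)
      show "0 < e / (2 * B + 1)" using that B0 by simp
      fix n y assume "y \<in> {-pi..pi} \<and> norm (x - y) < e / (2 * B + 1)"
      hence "(2 * B + 1) * \<bar>x - y\<bar> < e" using B0 by (simp add: field_simps)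
      moreover have "2 * B * \<bar>x - y\<bar> \<le> (2 * B + 1) * \<bar>x - y\<bar>" by (simp add: mult_right_mono)
      ultimately show "norm (pfun (pprim (f n)) x - pfun (pprim (f n)) y) < e"
        using lip[of n x y] by linarith
    qed
  qed (use M in auto)
  have "Cauchy (\<lambda>n. pprim (f (r n)))"
  proof (rule CauchyI)
    fix e :: real assume e: "0 < e"
    then obtain N where N: "\<And>n x. n \<ge> N \<Longrightarrow> x \<in> {-pi..pi} \<Longrightarrow>
        norm (pfun (pprim (f (r n))) x - g x) < e / 4"
      using r(3)[of "e / 4"] by auto
    show "\<exists>N. \<forall>m\<ge>N. \<forall>n\<ge>N. norm (pprim (f (r m)) - pprim (f (r n))) < e"
    proof (intro exI[of _ N] allI impI)
      fix m n assume mn: "m \<ge> N" "n \<ge> N"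
      have "norm (pprim (f (r m)) - pprim (f (r n))) \<le> e / 2"
      proof (rule norm_pcf_leI)
        fix x assume x: "x \<in> {-pi..pi}"
        show "norm (pfun (pprim (f (r m)) - pprim (f (r n))) x) \<le> e / 2"
          using N[OF mn(1) x] N[OF mn(2) x]
            norm_triangle_ineq4[of "pfun (pprim (f (r m))) x - g x" "pfun (pprim (f (r n))) x - g x"]
          by simp
      qed
      thus "norm (pprim (f (r m)) - pprim (f (r n))) < e" using e by simp
    qed
  qed
  hence "convergent (\<lambda>n. pprim (f (r n)))" by (rule Cauchy_convergent)
  thus "\<exists>r. strict_mono r \<and> convergent (\<lambda>n. pprim (f (r n)))" using r(2) by blast
qed

text \<open>
  The solution \<open>v\<close> of \<open>v'' = w - mean w\<close> with \<open>mean v = mean w\<close>. It identifies the continuous functions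
  \<open>w\<close> with the functions \<open>v\<close> of class \<open>C\<^sup>2\<close>; below, \<open>w\<close> is called the density of \<open>v\<close>.
\<close>

definition psolve :: "pcf \<Rightarrow> pcf" where
  "psolve w = pconst (pmean w) + pprim (pprim w)"

lemma compact_operator_psolve: "compact_operator psolve"
  unfolding psolve_def
  by (intro compact_operator_add compact_operator_compose[OF bounded_linear_pconst]
      compact_operator_finite_rank bounded_linear_pmean
      compact_operator_compose[OF bounded_linear_pprim] compact_operator_pprim)

lemma has_pderiv_psolve: "has_pderiv (psolve w) (pprim w)"
proof -
  have "has_pderiv (psolve w) (0 + (pprim w - pconst (pmean (pprim w))))"
    unfolding psolve_def by (intro pderiv_intros has_pderiv_pprim)
  moreover have "pconst 0 = 0" by (rule pconst_0)
  ultimately show ?thesis by (simp add: pmean_pprim)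
qed

text \<open>
  Every function \<open>f\<close> of class \<open>C\<^sup>2\<close> has the density \<open>mean f + f''\<close>.
\<close>

lemma psolve_inverse:
  assumes "has_pderiv f f'" "has_pderiv f' f''"
  defines "w \<equiv> pconst (pmean f) + f''"
  shows "psolve w = f" "pprim w = f'" "w - pconst (pmean w) = f''"
proof -
  have m: "pmean w = pmean f" by (simp add: w_def pmean_add pmean_has_pderiv[OF assms(2)])
  show 3: "w - pconst (pmean w) = f''" unfolding m by (simp add: w_def)
  show 2: "pprim w = f'"
    by (rule pprim_eqI) (use assms(2) pmean_has_pderiv[OF assms(1)] 3 in auto)
  show "psolve w = f"
    unfolding psolve_def 2 m pprim_has_pderiv[OF assms(1)] by simp
qed

lemmas psolve_linear = compact_operator_psolve[unfolded compact_operator_def, THEN conjunct1]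
lemmas psolve_add = linear_add[OF bounded_linear.linear[OF psolve_linear]]
  and psolve_scaleR = linear_cmul[OF bounded_linear.linear[OF psolve_linear]]

lemma pmean_psolve: "pmean (psolve w) = pmean w"
  by (simp add: psolve_def pmean_add pmean_pprim)

lemma psolve_eq_0: "psolve w = 0 \<Longrightarrow> w = 0"
proof -
  assume w: "psolve w = 0"
  have z: "has_pderiv 0 0" using has_pderiv_pconst[of 0] by (simp add: pconst_0)
  have "pprim w = 0" using has_pderiv_unique[OF has_pderiv_psolve[of w]] z w by simp
  hence "w - pconst (pmean w) = 0"
    using has_pderiv_unique[OF has_pderiv_pprim[of w]] z by simp
  moreover have "pmean w = 0" using pmean_psolve[of w] w pmean_scaleR[of 0 0] by simp
  ultimately show "w = 0" by (simp add: pconst_0)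
qed

definition pshift :: "real \<Rightarrow> pcf \<Rightarrow> pcf" where
  "pshift s f = Pfun (\<lambda>x. pfun f (x - s))"

lemma pfun_pshift [simp]: "pfun (pshift s f) x = pfun f (x - s)"
proof -
  have "pfun f (x + 2 * pi - s) = pfun f (x - s)" for x
    using pfun_add_2pi[of f "x - s"] by (simp add: algebra_simps)
  thus ?thesis unfolding pshift_def
    by (subst pfun_Pfun) (auto intro!: continuous_intros simp: periodic_2pi_def)
qed

lemma norm_pshift_le: "norm (pshift s f) \<le> norm f"
  by (rule norm_pcf_leI) (simp add: norm_pfun_le)

lemma has_pderiv_pshift:
  assumes "has_pderiv f f'"
  shows "has_pderiv (pshift s f) (pshift s f')"
  unfolding has_pderiv_def
proof
  fix x
  have "((\<lambda>x. pfun f (x - s)) has_vector_derivative 1 *\<^sub>R pfun f' (x - s)) (at x)"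
    using assms by (intro vector_diff_chain_at[of "\<lambda>x. x - s" 1 x "pfun f", unfolded o_def])
      (auto intro!: derivative_eq_intros simp: has_pderiv_def)
  moreover have "pfun (pshift s f) = (\<lambda>x. pfun f (x - s))" by auto
  ultimately show "(pfun (pshift s f) has_vector_derivative pfun (pshift s f') x) (at x)" by simp
qed

section \<open>Lyapunov--Schmidt reduction at a non-degenerate wave\<close>

text \<open>
  The hypotheses of the bifurcation problem in classical form, in a frame in which the wave is not
  translated. \<open>W\<close> stands for \<open>\<i>\<close> times the translated potential, \<open>\<psi>\<close> for the cokernel function,
  \<open>c\<close> for \<open>\<zeta> - \<i> \<mu>\<close> and \<open>g\<close> for \<open>\<i> f0\<close>. The last two assumptions are the simple zero of the effective
  potential.
\<close>

locale nondegenerate_wave =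
  fixes d :: real and c g :: complex and U U1 U2 \<psi> W W1 :: pcf
  assumes d: "d \<noteq> 0"
    and U: "has_pderiv U U1" "has_pderiv U1 U2"
    and wave: "- d *\<^sub>R U2 + pconst c * U - U * U * pcnj U + pconst g = 0"
    and W: "has_pderiv W W1"
    and kernel: "\<And>\<phi> \<phi>1 \<phi>2. has_pderiv \<phi> \<phi>1 \<Longrightarrow> has_pderiv \<phi>1 \<phi>2 \<Longrightarrow>
        - d *\<^sub>R \<phi>2 + (pconst c - 2 *\<^sub>R (U * pcnj U)) * \<phi> - U * U * pcnj \<phi> = 0 \<Longrightarrow>
        \<exists>r. \<phi> = r *\<^sub>R U1"
    and cokernel: "\<And>\<phi> \<phi>1 \<phi>2. has_pderiv \<phi> \<phi>1 \<Longrightarrow> has_pderiv \<phi>1 \<phi>2 \<Longrightarrow>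
        pinner (- d *\<^sub>R \<phi>2 + (pconst c - 2 *\<^sub>R (U * pcnj U)) * \<phi> - U * U * pcnj \<phi>) \<psi> = 0"
    and zero: "pinner (W * U1) \<psi> = 0"
    and simple: "pinner (W1 * U1) \<psi> \<noteq> 0"
begin

text \<open>
  The linearisation at \<open>U\<close>. The second derivative \<open>\<phi>2\<close> of the argument is a separate parameter because
  differentiation is a relation here.
\<close>

definition lin :: "pcf \<Rightarrow> pcf \<Rightarrow> pcf" where
  "lin \<phi> \<phi>2 = - d *\<^sub>R \<phi>2 + (pconst c - 2 *\<^sub>R (U * pcnj U)) * \<phi> - U * U * pcnj \<phi>"

text \<open>
  Half the second derivative of \<open>u \<mapsto> |u|\<^sup>2 u\<close> at \<open>U\<close>, as a symmetric real bilinear map; \<open>hess v v\<close> is the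
  quadratic part of \<open>|U + v|\<^sup>2 (U + v)\<close>.
\<close>

definition hess :: "pcf \<Rightarrow> pcf \<Rightarrow> pcf" where
  "hess x y = pcnj U * x * y + U * x * pcnj y + U * y * pcnj x"

lemma hess_commute: "hess x y = hess y x"
  by (rule pcf_eqI) (simp add: hess_def algebra_simps)

lemma hess_scaleR: "hess x (r *\<^sub>R y) = r *\<^sub>R hess x y" "hess (r *\<^sub>R y) x = r *\<^sub>R hess y x"
  by (rule pcf_eqI, simp add: hess_def algebra_simps)+

lemma bounded_bilinear_hess: "bounded_bilinear hess"
proof -
  note b = bounded_bilinear_post[OF bounded_linear_mult_right]
  note m = bounded_bilinear_mult
  have "bounded_bilinear (\<lambda>x y. pcnj U * (x * y) + U * (x * pcnj y) + U * (pcnj x * y))"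
    by (intro bounded_bilinear_sum b m bounded_bilinear.comp[OF m bounded_linear_ident bounded_linear_pcnj]
        bounded_bilinear.comp[OF m bounded_linear_pcnj bounded_linear_ident])
  moreover have "(\<lambda>x y. pcnj U * (x * y) + U * (x * pcnj y) + U * (pcnj x * y)) = hess"
    by (intro ext) (simp add: hess_def algebra_simps)
  ultimately show ?thesis by simp
qed

text \<open>
  Differentiating \<open>lin \<phi> = h\<close>: the coefficients of the linearisation depend on \<open>U\<close>, and their derivatives
  contribute the Hessian term. The equation itself provides the third derivative of \<open>\<phi>\<close>.
\<close>

lemma lin_differentiate:
  assumes "has_pderiv \<phi> \<phi>1" "has_pderiv \<phi>1 \<phi>2" "lin \<phi> \<phi>2 = h" "has_pderiv h h1"
  shows "\<exists>\<phi>3. has_pderiv \<phi>2 \<phi>3 \<and> lin \<phi>1 \<phi>3 = h1 + 2 *\<^sub>R hess U1 \<phi>"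
proof -
  have "\<phi>2 = (1 / d) *\<^sub>R ((pconst c - 2 *\<^sub>R (U * pcnj U)) * \<phi> - U * U * pcnj \<phi> - h)"
    using assms(3) d by (auto simp: lin_def)
  moreover have "has_pderiv ((1 / d) *\<^sub>R ((pconst c - 2 *\<^sub>R (U * pcnj U)) * \<phi> - U * U * pcnj \<phi> - h))
     ((1 / d) *\<^sub>R ((pconst c - 2 *\<^sub>R (U * pcnj U)) * \<phi>1 +
         (0 - 2 *\<^sub>R (U * pcnj U1 + U1 * pcnj U)) * \<phi> -
         (U * U * pcnj \<phi>1 + (U * U1 + U1 * U) * pcnj \<phi>) - h1))" (is "has_pderiv _ ?\<phi>3")
    by (intro pderiv_intros U assms)
  ultimately have "has_pderiv \<phi>2 ?\<phi>3" by simp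
  moreover have "lin \<phi>1 ?\<phi>3 = h1 + 2 *\<^sub>R hess U1 \<phi>"
    by (rule pcf_eqI) (use d in \<open>simp add: lin_def hess_def scaleR_conv_of_real field_simps\<close>)
  ultimately show ?thesis by blast
qed

lemma lin_cokernel: "has_pderiv \<phi> \<phi>1 \<Longrightarrow> has_pderiv \<phi>1 \<phi>2 \<Longrightarrow> pinner (lin \<phi> \<phi>2) \<psi> = 0"
  unfolding lin_def by (rule cokernel)

text \<open>
  Differentiating the wave equation, that is, its invariance under translations.
\<close>

lemma lin_U1: "\<exists>U3. has_pderiv U2 U3 \<and> lin U1 U3 = 0"
proof -
  have "U2 = (1 / d) *\<^sub>R (pconst c * U - U * U * pcnj U + pconst g)"
  proof -
    have "d *\<^sub>R U2 = pconst c * U - U * U * pcnj U + pconst g"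
      using wave by (simp add: algebra_simps)
    hence "(1 / d) *\<^sub>R d *\<^sub>R U2 = (1 / d) *\<^sub>R (pconst c * U - U * U * pcnj U + pconst g)"
      by (rule arg_cong)
    thus ?thesis using d by simp
  qed
  moreover have "has_pderiv ((1 / d) *\<^sub>R (pconst c * U - U * U * pcnj U + pconst g))
     ((1 / d) *\<^sub>R ((pconst c * U1 + 0 * U) - (U * U * pcnj U1 + (U * U1 + U1 * U) * pcnj U) + 0))"
     (is "has_pderiv _ ?U3")
    by (intro pderiv_intros U)
  ultimately have "has_pderiv U2 ?U3" by simp
  moreover have "lin U1 ?U3 = 0"
    by (rule pcf_eqI) (use d in \<open>simp add: lin_def scaleR_conv_of_real field_simps\<close>)
  ultimately show ?thesis by blast
qed

lemma U1_nonzero: "pinner U1 U1 \<noteq> 0" and \<psi>_pos: "pinner \<psi> \<psi> > 0"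
proof -
  have "U1 \<noteq> 0" using simple by (auto simp: pinner_zero_left)
  thus "pinner U1 U1 \<noteq> 0" using pinner_self(2) by blast
  have "pcnj 0 = 0" by (rule pcf_eqI) simp
  moreover have "pint 0 = 0" using pint_scaleR[of 0 0] by simp
  ultimately have "\<psi> \<noteq> 0" using simple by (auto simp: pinner_def)
  thus "pinner \<psi> \<psi> > 0" using pinner_self[of \<psi>] by force
qed

text \<open>
  Differentiating the wave equation twice gives \<open>lin U'' = 2 hess U' U'\<close>, and the range of the
  linearisation is orthogonal to \<open>\<psi>\<close>.
\<close>

lemma hess_U1_U1: "pinner (hess U1 U1) \<psi> = 0"
proof -
  obtain U3 where U3: "has_pderiv U2 U3" "lin U1 U3 = 0" using lin_U1 by blast
  have "pconst 0 = 0" by (rule pconst_0)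
  hence "has_pderiv 0 0" using has_pderiv_pconst[of 0] by simp
  from lin_differentiate[OF U(2) U3 this] obtain U4
    where U4: "has_pderiv U3 U4" "lin U2 U4 = 2 *\<^sub>R hess U1 U1" by auto
  thus ?thesis using lin_cokernel[OF U3(1) U4(1)] by (simp add: pinner_simps)
qed

text \<open>
  The linearisation as an operator on the densities \<open>w\<close> of \<open>v = psolve w\<close>.
\<close>

definition L :: "pcf \<Rightarrow> pcf" where
  "L w = lin (psolve w) (w - pconst (pmean w))"

lemma L_cokernel: "pinner (L w) \<psi> = 0"
  unfolding L_def by (rule lin_cokernel[OF has_pderiv_psolve has_pderiv_pprim])

lemma L_kernel: "L w = 0 \<Longrightarrow> \<exists>r. psolve w = r *\<^sub>R U1"
  unfolding L_def lin_def by (rule kernel[OF has_pderiv_psolve has_pderiv_pprim])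

text \<open>
  Apart from \<open>- d w\<close>, all terms of \<open>L w\<close> depend on \<open>w\<close> through its mean or through \<open>psolve w\<close>.
\<close>

lemma L_split: "\<exists>C. compact_operator C \<and> (\<forall>w. L w = - d *\<^sub>R w + C w)"
proof -
  define C where "C = (\<lambda>w. d *\<^sub>R pconst (pmean w) +
    (((pconst c - 2 *\<^sub>R (U * pcnj U)) * psolve w) + (- (U * U)) * pcnj (psolve w)))"
  have "compact_operator C"
    unfolding C_def
    by (intro compact_operator_add compact_operator_compose[OF bounded_linear_scaleR_right]
        compact_operator_compose[OF bounded_linear_pconst] compact_operator_finite_rank
        bounded_linear_pmean compact_operator_compose[OF bounded_linear_mult_right]
        compact_operator_compose[OF bounded_linear_pcnj] compact_operator_psolve)
  moreover have "L w = - d *\<^sub>R w + C w" for w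
    by (rule pcf_eqI) (simp add: L_def lin_def C_def algebra_simps)
  ultimately show ?thesis by blast
qed

text \<open>
  Adding a rank-one operator with range spanned by \<open>\<psi>\<close> repairs the degeneracy of \<open>L\<close>: as \<open>L\<close> takes
  values orthogonal to \<open>\<psi>\<close>, the two summands vanish separately, and injectivity only has to be checked
  on the kernel of \<open>L\<close>.
\<close>

lemma bordered_invertible:
  assumes l: "bounded_linear (l :: pcf \<Rightarrow> real)"
    and nz: "\<And>w. L w = 0 \<Longrightarrow> l w = 0 \<Longrightarrow> w = 0"
  shows "\<exists>B. bounded_linear B \<and> (\<forall>x. L (B x) + l (B x) *\<^sub>R \<psi> = x)"
proof -
  obtain C where C: "compact_operator C" "\<And>w. L w = - d *\<^sub>R w + C w" using L_split by blast
  have "\<exists>B. bounded_linear B \<and> (\<forall>x. (- d) *\<^sub>R B x + (C (B x) + l (B x) *\<^sub>R \<psi>) = x)"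
  proof (rule compact_perturbation_invertible)
    show "compact_operator (\<lambda>x. C x + l x *\<^sub>R \<psi>)"
      by (intro compact_operator_add C compact_operator_compose[OF bounded_linear_scaleR_left]
          compact_operator_finite_rank l)
    fix w assume "(- d) *\<^sub>R w + (C w + l w *\<^sub>R \<psi>) = 0"
    hence *: "L w + l w *\<^sub>R \<psi> = 0" unfolding C(2) add.assoc .
    hence "pinner (L w + l w *\<^sub>R \<psi>) \<psi> = 0" by (simp add: pinner_zero_left)
    hence "l w = 0" using \<psi>_pos by (simp add: pinner_simps L_cokernel)
    thus "w = 0" using nz * by simp
  qed (use d in simp)
  thus ?thesis by (auto simp: C(2) algebra_simps)
qed

lemma L_linear: "bounded_linear L"
proof -
  obtain C where C: "compact_operator C" "\<And>w. L w = - d *\<^sub>R w + C w" using L_split by blast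
  have "bounded_linear (\<lambda>w. (- d) *\<^sub>R w + C w)"
    using C(1) by (intro bounded_linear_add bounded_linear_scaleR_right) (simp add: compact_operator_def)
  moreover have "L = (\<lambda>w. (- d) *\<^sub>R w + C w)" using C(2) by auto
  ultimately show ?thesis by simp
qed

lemmas L_add = linear_add[OF bounded_linear.linear[OF L_linear]]
  and L_scaleR = linear_cmul[OF bounded_linear.linear[OF L_linear]]

text \<open>
  The range of \<open>L\<close> is the full orthogonal complement of \<open>\<psi>\<close>. Border \<open>L\<close> with the inner product with
  \<open>U'\<close>, which is nonzero on every nonzero multiple of \<open>U'\<close>; in a solution of the bordered equation with
  right-hand side orthogonal to \<open>\<psi>\<close> the border is zero.
\<close>

lemma L_range:
  assumes "pinner h \<psi> = 0"
  shows "\<exists>w. L w = h"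
proof -
  have "\<exists>B. bounded_linear B \<and> (\<forall>x. L (B x) + pinner (psolve (B x)) U1 *\<^sub>R \<psi> = x)"
  proof (rule bordered_invertible)
    show "bounded_linear (\<lambda>w. pinner (psolve w) U1)"
      by (rule bounded_linear_compose[OF bounded_linear_pinner_left psolve_linear])
    fix w assume w: "L w = 0" "pinner (psolve w) U1 = 0"
    then obtain r where r: "psolve w = r *\<^sub>R U1" using L_kernel by blast
    hence "r = 0" using w(2) U1_nonzero by (simp add: pinner_simps)
    thus "w = 0" using r psolve_eq_0 by simp
  qed
  then obtain w where w: "L w + pinner (psolve w) U1 *\<^sub>R \<psi> = h" by blast
  hence "pinner (L w + pinner (psolve w) U1 *\<^sub>R \<psi>) \<psi> = 0" using assms by simp
  hence "pinner (psolve w) U1 = 0" using \<psi>_pos by (simp add: pinner_simps L_cokernel)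
  thus ?thesis using w by auto
qed

text \<open>
  Differentiating \<open>lin v = - W U'\<close> for \<open>v = psolve w\<close> gives \<open>lin v' = - W' U' - W U'' + 2 hess U' v\<close>. The left-hand side is
  orthogonal to \<open>\<psi>\<close>, so that the simple zero of the effective potential enters here.
\<close>

lemma corrector_transversal:
  assumes "L w = - (W * U1)"
  shows "pinner (W * U2 - 2 *\<^sub>R hess U1 (psolve w)) \<psi> = - pinner (W1 * U1) \<psi>"
proof -
  have "has_pderiv ((- 1) *\<^sub>R (W * U1)) ((- 1) *\<^sub>R (W * U2 + W1 * U1))"
    by (intro pderiv_intros U W)
  hence "has_pderiv (- (W * U1)) ((- 1) *\<^sub>R (W * U2 + W1 * U1))" by simp
  from lin_differentiate[OF has_pderiv_psolve has_pderiv_pprim assms[unfolded L_def] this]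
  obtain \<phi>3 where \<phi>3: "has_pderiv (w - pconst (pmean w)) \<phi>3"
    "lin (pprim w) \<phi>3 = (- 1) *\<^sub>R (W * U2 + W1 * U1) + 2 *\<^sub>R hess U1 (psolve w)" by blast
  from lin_cokernel[OF has_pderiv_pprim \<phi>3(1)] show ?thesis
    by (simp add: \<phi>3(2) pinner_simps)
qed

text \<open>
  The equation for \<open>v\<close> at order zero leaves the multiple of \<open>U'\<close> in \<open>v\<close> free. The solvability condition at the
  next order is affine in this multiple, because \<open>hess U' U'\<close> is orthogonal to \<open>\<psi>\<close>; its slope is
  \<open>- \<langle>W' U', \<psi>\<rangle>\<close>, hence it determines the multiple.
\<close>

lemma first_order_corrector:
  "\<exists>w. L w = - (W * U1) \<and> pinner (W * pprim w - hess (psolve w) (psolve w)) \<psi> = 0"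
proof -
  obtain w0 where w0: "L w0 = - (W * U1)"
    using L_range[of "- (W * U1)"] zero by (auto simp: pinner_simps)
  obtain U3 where U3: "has_pderiv U2 U3" "lin U1 U3 = 0" using lin_U1 by blast
  \<comment> \<open>The density of \<open>U'\<close>.\<close>
  define w1 where "w1 = pconst (pmean U1) + U3"
  note w1 = psolve_inverse[OF U(2) U3(1), folded w1_def]
  have Lw1: "L w1 = 0" by (simp add: L_def w1 U3)
  define D where "D = pinner (W1 * U1) \<psi>"
  define k where "k = pinner (W * pprim w0 - hess (psolve w0) (psolve w0)) \<psi>"
  define w where "w = w0 + (k / D) *\<^sub>R w1"
  have "L w = - (W * U1)" by (simp add: w_def L_add L_scaleR w0 Lw1)
  moreover have "pinner (W * pprim w - hess (psolve w) (psolve w)) \<psi> = 0"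
  proof -
    have "W * pprim w - hess (psolve w) (psolve w) = (W * pprim w0 - hess (psolve w0) (psolve w0))
        + (k / D) *\<^sub>R (W * U2 - 2 *\<^sub>R hess U1 (psolve w0)) - (k / D)\<^sup>2 *\<^sub>R hess U1 U1"
      unfolding w_def psolve_add psolve_scaleR pprim_add pprim_scaleR w1
      by (rule pcf_eqI) (simp add: hess_def scaleR_conv_of_real algebra_simps power2_eq_square)
    hence "pinner (W * pprim w - hess (psolve w) (psolve w)) \<psi> = k + (k / D) * (- D)"
      using corrector_transversal[OF w0]
      by (simp only: pinner_add_left pinner_diff_left[of _ "_ *\<^sub>R _"] pinner_scaleR_left hess_U1_U1)
         (simp add: k_def D_def)
    thus ?thesis using simple by (simp add: D_def)
  qed
  ultimately show ?thesis by blast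
qed

text \<open>
  On the kernel of \<open>L\<close>, which corresponds to the multiples of \<open>U'\<close>, the bordering functional is injective by
  \<open>corrector_transversal\<close>.
\<close>

lemma linearization_invertible:
  assumes ws: "L ws = - (W * U1)"
  shows "\<exists>B. bounded_linear B \<and>
    (\<forall>x. L (B x) + pinner (W * pprim (B x) - 2 *\<^sub>R hess (psolve ws) (psolve (B x))) \<psi> *\<^sub>R \<psi> = x)"
proof (rule bordered_invertible)
  have "bounded_linear (\<lambda>z. hess (psolve ws) (psolve z))"
    by (rule bounded_linear_compose[OF bounded_bilinear.bounded_linear_right[OF bounded_bilinear_hess]
        psolve_linear])
  thus "bounded_linear (\<lambda>z. pinner (W * pprim z - 2 *\<^sub>R hess (psolve ws) (psolve z)) \<psi>)"
    by (intro bounded_linear_compose[OF bounded_linear_pinner_left] bounded_linear_sub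
        bounded_linear_compose[OF bounded_linear_mult_right] bounded_linear_pprim
        bounded_linear_compose[OF bounded_linear_scaleR_right])
  fix z assume z: "L z = 0" "pinner (W * pprim z - 2 *\<^sub>R hess (psolve ws) (psolve z)) \<psi> = 0"
  then obtain r where r: "psolve z = r *\<^sub>R U1" using L_kernel by blast
  have "has_pderiv (psolve z) (r *\<^sub>R U2)" unfolding r by (intro pderiv_intros U)
  hence "pprim z = r *\<^sub>R U2" using has_pderiv_psolve has_pderiv_unique by blast
  hence "W * pprim z - 2 *\<^sub>R hess (psolve ws) (psolve z) = r *\<^sub>R (W * U2 - 2 *\<^sub>R hess U1 (psolve ws))"
    unfolding r hess_commute[of U1] by (simp add: hess_scaleR scaleR_diff_right)
  hence "r * (- pinner (W1 * U1) \<psi>) = 0"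
    using z(2) corrector_transversal[OF ws] by (simp add: pinner_scaleR_left)
  hence "r = 0" using simple by simp
  thus "z = 0" using r psolve_eq_0 by simp
qed

text \<open>
  Here \<open>w \<epsilon>\<close> is the density of \<open>v\<close> in the ansatz \<open>u = U + \<epsilon> v\<close>. The modified equation is expanded around a
  first-order corrector \<open>ws\<close> and multiplied by the inverse \<open>B\<close> of its linearisation there.
\<close>

theorem branch:
  "\<exists>\<epsilon>s M w. 0 < \<epsilon>s \<and> continuous_on {-\<epsilon>s<..<\<epsilon>s} w \<and>
     (\<forall>\<epsilon>\<in>{-\<epsilon>s<..<\<epsilon>s}. norm (w \<epsilon>) \<le> M \<and>
       (let u = U + \<epsilon> *\<^sub>R psolve (w \<epsilon>); u1 = U1 + \<epsilon> *\<^sub>R pprim (w \<epsilon>);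
            u2 = U2 + \<epsilon> *\<^sub>R (w \<epsilon> - pconst (pmean (w \<epsilon>)))
        in - d *\<^sub>R u2 + \<epsilon> *\<^sub>R (W * u1) + pconst c * u - u * u * pcnj u + pconst g = 0))"
proof -
  obtain ws where ws: "L ws = - (W * U1)"
    "pinner (W * pprim ws - hess (psolve ws) (psolve ws)) \<psi> = 0"
    using first_order_corrector by blast
  define l where "l = (\<lambda>z. pinner (W * pprim z - 2 *\<^sub>R hess (psolve ws) (psolve z)) \<psi>)"
  obtain B where B: "bounded_linear B" "\<And>x. L (B x) + l (B x) *\<^sub>R \<psi> = x"
    using linearization_invertible[OF ws(1)] unfolding l_def by blast
  define v where "v = (\<lambda>z. psolve (ws + z))"
  \<comment> \<open>The modified equation at \<open>ws + z\<close> is \<open>L z + l z \<psi> + \<beta> z z + \<epsilon> G \<epsilon> z = 0\<close>, where \<open>\<beta>\<close> comes from the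
  quadratic part of \<open>R 0\<close> and the last term of \<open>G\<close> from the part of \<open>R\<close> that carries a factor \<open>\<epsilon>\<close>.\<close>
  define R where "R = (\<lambda>\<epsilon> z. W * pprim (ws + z) - hess (v z) (v z) - \<epsilon> *\<^sub>R (v z * v z * pcnj (v z)))"
  define \<beta> where "\<beta> = (\<lambda>x y. - (pinner (hess (psolve x) (psolve y)) \<psi> *\<^sub>R \<psi>))"
  define G where "G = (\<lambda>\<epsilon> z. R \<epsilon> z + - (pinner (v z * v z * pcnj (v z)) \<psi> *\<^sub>R \<psi>))"
  have \<beta>: "bounded_bilinear \<beta>"
    unfolding \<beta>_def
    by (intro bounded_bilinear_post[OF bounded_linear_minus[OF bounded_linear_ident]]
        bounded_bilinear_post[OF bounded_linear_scaleR_left]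
        bounded_bilinear_post[OF bounded_linear_pinner_left]
        bounded_bilinear.comp[OF bounded_bilinear_hess psolve_linear psolve_linear])
  have arg: "locally_lipschitz (\<lambda>p :: real \<times> pcf. ws + snd p)"
    by (intro locally_lipschitz_add locally_lipschitz_const
        locally_lipschitz_bounded_linear bounded_linear_snd)
  have vL: "locally_lipschitz (\<lambda>p :: real \<times> pcf. v (snd p))"
    unfolding v_def by (rule locally_lipschitz_compose_linear[OF psolve_linear arg])
  have cubic: "locally_lipschitz (\<lambda>p :: real \<times> pcf. v (snd p) * v (snd p) * pcnj (v (snd p)))"
    by (intro locally_lipschitz_bilinear[OF bounded_bilinear_mult] vL
        locally_lipschitz_compose_linear[OF bounded_linear_pcnj])
  have RL: "locally_lipschitz (\<lambda>p :: real \<times> pcf. R (fst p) (snd p))"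
    unfolding R_def diff_conv_add_uminus
    by (intro locally_lipschitz_add locally_lipschitz_compose_linear[OF bounded_linear_mult_right]
        locally_lipschitz_compose_linear[OF bounded_linear_pprim] arg
        locally_lipschitz_compose_linear[OF bounded_linear_minus[OF bounded_linear_ident]]
        locally_lipschitz_bilinear[OF bounded_bilinear_hess] vL
        locally_lipschitz_bilinear[OF bounded_bilinear_scaleR] cubic
        locally_lipschitz_bounded_linear bounded_linear_fst)
  have GL: "locally_lipschitz (\<lambda>p :: real \<times> pcf. G (fst p) (snd p))"
    unfolding G_def
    by (intro locally_lipschitz_add RL cubic
        locally_lipschitz_compose_linear[OF bounded_linear_minus[OF bounded_linear_ident]]
        locally_lipschitz_compose_linear[OF bounded_linear_scaleR_left]
        locally_lipschitz_compose_linear[OF bounded_linear_pinner_left])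
  obtain \<epsilon>1 z where z: "\<epsilon>1 > 0" "continuous_on {-\<epsilon>1<..<\<epsilon>1} z"
    "\<And>\<epsilon>. \<epsilon> \<in> {-\<epsilon>1<..<\<epsilon>1} \<Longrightarrow> norm (z \<epsilon>) \<le> 1"
    "\<And>\<epsilon>. \<epsilon> \<in> {-\<epsilon>1<..<\<epsilon>1} \<Longrightarrow> z \<epsilon> + B (\<beta> (z \<epsilon>) (z \<epsilon>) + \<epsilon> *\<^sub>R G \<epsilon> (z \<epsilon>)) = 0"
    using perturbed_zero_curve[OF B(1) \<beta> GL] by blast
  \<comment> \<open>The second bound keeps the factor \<open>\<epsilon> + \<langle>\<psi>, \<psi>\<rangle>\<close> positive that appears when pairing with \<open>\<psi>\<close>.\<close>
  define \<epsilon>s where "\<epsilon>s = min \<epsilon>1 (pinner \<psi> \<psi>)"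
  have sub: "{-\<epsilon>s<..<\<epsilon>s} \<subseteq> {-\<epsilon>1<..<\<epsilon>1}" by (auto simp: \<epsilon>s_def)
  have solves: "L (ws + z \<epsilon>) + W * U1 + \<epsilon> *\<^sub>R R \<epsilon> (z \<epsilon>) = 0" if "\<epsilon> \<in> {-\<epsilon>s<..<\<epsilon>s}" for \<epsilon>
  proof -
    define y where "y = z \<epsilon>"
    define \<rho> where "\<rho> = pinner (R \<epsilon> y) \<psi>"
    have "y = - B (\<beta> y y + \<epsilon> *\<^sub>R G \<epsilon> y)"
      unfolding y_def using z(4) that sub by (simp only: eq_neg_iff_add_eq_0 subset_iff)
    hence "y = B (- (\<beta> y y + \<epsilon> *\<^sub>R G \<epsilon> y))"
      unfolding linear_neg[OF bounded_linear.linear[OF B(1)]] .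
    hence Ay: "L y + l y *\<^sub>R \<psi> = - (\<beta> y y + \<epsilon> *\<^sub>R G \<epsilon> y)" by (metis B(2))
    have "R \<epsilon> y = (W * pprim ws - hess (psolve ws) (psolve ws))
        + (W * pprim y - 2 *\<^sub>R hess (psolve ws) (psolve y)) - hess (psolve y) (psolve y)
        - \<epsilon> *\<^sub>R (v y * v y * pcnj (v y))"
      unfolding R_def v_def psolve_add pprim_add
      by (rule pcf_eqI) (simp add: hess_def scaleR_conv_of_real algebra_simps)
    hence "\<rho> = 0 + l y - pinner (hess (psolve y) (psolve y)) \<psi> - \<epsilon> * pinner (v y * v y * pcnj (v y)) \<psi>"
      unfolding \<rho>_def l_def ws(2)[symmetric] by (simp only: pinner_simps)
    hence ly: "l y = \<rho> + pinner (hess (psolve y) (psolve y)) \<psi> + \<epsilon> * pinner (v y * v y * pcnj (v y)) \<psi>"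
      by simp
    have \<Phi>: "L (ws + y) + W * U1 + \<epsilon> *\<^sub>R R \<epsilon> y + \<rho> *\<^sub>R \<psi> = 0"
      using Ay unfolding L_add ws(1) G_def \<beta>_def ly by (simp add: algebra_simps)
    hence "pinner (L (ws + y) + W * U1 + \<epsilon> *\<^sub>R R \<epsilon> y + \<rho> *\<^sub>R \<psi>) \<psi> = 0"
      by (simp only: pinner_zero_left)
    hence "\<epsilon> * \<rho> + \<rho> * pinner \<psi> \<psi> = 0"
      by (simp add: pinner_simps L_cokernel zero \<rho>_def[symmetric])
    hence "\<rho> * (\<epsilon> + pinner \<psi> \<psi>) = 0" by (simp add: algebra_simps)
    moreover have "\<epsilon> + pinner \<psi> \<psi> > 0" using that by (auto simp: \<epsilon>s_def)
    ultimately have "\<rho> = 0" by simp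
    thus ?thesis using \<Phi> by (simp add: y_def)
  qed
  show ?thesis
  proof (rule exI[of _ \<epsilon>s], rule exI[of _ "norm ws + 1"], rule exI[of _ "\<lambda>\<epsilon>. ws + z \<epsilon>"],
      intro conjI ballI)
    show "0 < \<epsilon>s" using z(1) \<psi>_pos by (simp add: \<epsilon>s_def)
    show "continuous_on {-\<epsilon>s<..<\<epsilon>s} (\<lambda>\<epsilon>. ws + z \<epsilon>)"
      by (intro continuous_intros continuous_on_subset[OF z(2) sub])
    fix \<epsilon> assume e: "\<epsilon> \<in> {-\<epsilon>s<..<\<epsilon>s}"
    show "norm (ws + z \<epsilon>) \<le> norm ws + 1"
      using z(3)[of \<epsilon>] sub e by (intro norm_triangle_mono) auto
    define w where "w = ws + z \<epsilon>"
    define u2 where "u2 = w - pconst (pmean w)"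
    have eq: "lin (psolve w) u2 + W * U1 + \<epsilon> *\<^sub>R (W * pprim w - hess (psolve w) (psolve w)
        - \<epsilon> *\<^sub>R (psolve w * psolve w * pcnj (psolve w))) = 0"
      using solves[OF e] by (simp add: R_def v_def w_def L_def u2_def)
    have "- d *\<^sub>R (U2 + \<epsilon> *\<^sub>R u2) + \<epsilon> *\<^sub>R (W * (U1 + \<epsilon> *\<^sub>R pprim w)) + pconst c * (U + \<epsilon> *\<^sub>R psolve w)
        - (U + \<epsilon> *\<^sub>R psolve w) * (U + \<epsilon> *\<^sub>R psolve w) * pcnj (U + \<epsilon> *\<^sub>R psolve w) + pconst g
      = (- d *\<^sub>R U2 + pconst c * U - U * U * pcnj U + pconst g)
        + \<epsilon> *\<^sub>R (lin (psolve w) u2 + W * U1 + \<epsilon> *\<^sub>R (W * pprim w - hess (psolve w) (psolve w)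
            - \<epsilon> *\<^sub>R (psolve w * psolve w * pcnj (psolve w))))"
      by (rule pcf_eqI) (simp add: lin_def hess_def scaleR_conv_of_real algebra_simps)
    thus "let u = U + \<epsilon> *\<^sub>R psolve (ws + z \<epsilon>); u1 = U1 + \<epsilon> *\<^sub>R pprim (ws + z \<epsilon>);
            u2 = U2 + \<epsilon> *\<^sub>R (ws + z \<epsilon> - pconst (pmean (ws + z \<epsilon>)))
        in - d *\<^sub>R u2 + \<epsilon> *\<^sub>R (W * u1) + pconst c * u - u * u * pcnj u + pconst g = 0"
      unfolding Let_def w_def[symmetric] u2_def[symmetric] by (simp only: wave eq) simp
  qed
qed

end

section \<open>The fundamental lemma of the calculus of variations\<close>

lemma AE_lebesgue_iff_negligible:
  fixes P :: "'a::euclidean_space \<Rightarrow> bool"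
  shows "(AE x in lebesgue. P x) \<longleftrightarrow> negligible {x. \<not> P x}"
  by (simp add: completion.AE_iff_null_sets negligible_iff_null_sets)

lemma AE_lebesgue_translate:
  fixes P :: "real \<Rightarrow> bool"
  assumes "AE x in lebesgue. P x"
  shows "AE x in lebesgue. P (x + c)"
proof -
  have "{x. \<not> P (x + c)} = (+) (- c) ` {x. \<not> P x}"
    by (force simp: image_iff intro: exI[of _ "_ + c"])
  thus ?thesis using assms unfolding AE_lebesgue_iff_negligible
    by (simp only: negligible_translation)
qed

lemma AE_period_imp_AE:
  assumes P: "periodic_2pi P" and ae: "AE x in lebesgue. x \<in> {-pi..pi} \<longrightarrow> P x"
  shows "AE x in lebesgue. P x"
proof -
  define N where "N = {x. \<not> (x \<in> {-pi..pi} \<longrightarrow> P x)}"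
  have "{x. \<not> P x} \<subseteq> (\<Union>k::int. (+) (of_int k * (2 * pi)) ` N)"
  proof
    fix x assume x: "x \<in> {x. \<not> P x}"
    obtain y where y: "y \<in> {-pi..<pi}" "P x = P y" "\<exists>k::int. x = y + of_int k * (2 * pi)"
      using P by (rule periodic_2pi_reduce)
    then obtain k :: int where "x = of_int k * (2 * pi) + y" by auto
    moreover have "y \<in> N" using x y by (auto simp: N_def)
    ultimately show "x \<in> (\<Union>k::int. (+) (of_int k * (2 * pi)) ` N)" by blast
  qed
  moreover have "negligible (\<Union>k::int. (+) (of_int k * (2 * pi)) ` N)"
    using ae unfolding AE_lebesgue_iff_negligible N_def
    by (intro negligible_countable_Union) (auto intro!: negligible_translation)
  ultimately show ?thesis
    unfolding AE_lebesgue_iff_negligible by (rule negligible_subset[rotated])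
qed

lemma continuous_AE_eq_imp_eq:
  fixes f g :: "real \<Rightarrow> 'a::t2_space"
  assumes "continuous_on UNIV f" "continuous_on UNIV g" "AE x in lebesgue. f x = g x"
  shows "f = g"
proof -
  have "open {x. f x \<noteq> g x}" using assms by (intro open_Collect_neq)
  moreover have "negligible {x. f x \<noteq> g x}"
    using assms(3) by (simp add: AE_lebesgue_iff_negligible)
  ultimately have "{x. f x \<noteq> g x} = {}" using open_not_negligible by blast
  thus ?thesis by auto
qed

lemma set_integrable_mult_continuous:
  fixes f :: "real \<Rightarrow> complex"
  assumes f: "set_integrable lebesgue {a..b} f" and h: "continuous_on UNIV h"
  shows "set_integrable lebesgue {a..b} (\<lambda>x. f x * h x)"
proof -
  have "(\<lambda>x. h x * f x) absolutely_integrable_on {a..b}"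
  proof (rule absolutely_integrable_bounded_measurable_product[where h = "(*)"])
    show "bilinear ((*) :: complex \<Rightarrow> complex \<Rightarrow> complex)"
      by (simp add: bilinear_conv_bounded_bilinear bounded_bilinear_mult)
    show "bounded (h ` {a..b})"
      by (intro compact_imp_bounded compact_continuous_image continuous_on_subset[OF h]) auto
    show "h \<in> borel_measurable (lebesgue_on {a..b})"
      by (rule continuous_imp_measurable_on_sets_lebesgue) (auto intro: continuous_on_subset[OF h])
  qed (use f in auto)
  thus ?thesis by (simp add: mult.commute)
qed

text \<open>
  On a bounded interval \<open>|f| \<le> |f|\<^sup>2 + 1\<close> is integrable.
\<close>

lemma L2per_set_integrable:
  assumes "f \<in> L2per"
  shows "set_integrable lebesgue {-pi..pi} f"
proof (rule set_integrable_bound)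
  have "set_integrable lebesgue {-pi..pi} (\<lambda>x. (cmod (f x))\<^sup>2)" using assms by (simp add: L2per_def)
  moreover have "set_integrable lebesgue {-pi..pi} (\<lambda>x. 1 :: real)"
    by (rule absolutely_integrable_continuous_real) auto
  ultimately show "set_integrable lebesgue {-pi..pi} (\<lambda>x. (cmod (f x))\<^sup>2 + 1)"
    by (rule set_integral_add)
  show "set_borel_measurable lebesgue {-pi..pi} f"
    using assms by (auto simp: L2per_def set_borel_measurable_def
        intro!: borel_measurable_scaleR borel_measurable_indicator)
  show "AE x in lebesgue. x \<in> {-pi..pi} \<longrightarrow> norm (f x) \<le> norm ((cmod (f x))\<^sup>2 + 1)"
  proof (intro AE_I2 impI)
    fix x
    have "0 \<le> (cmod (f x) - 1)\<^sup>2" by simp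
    thus "norm (f x) \<le> norm ((cmod (f x))\<^sup>2 + 1)"
      by (simp add: power2_eq_square algebra_simps) (smt (verit) norm_ge_zero)
  qed
qed

text \<open>
  Restricting derivatives of entire functions gives all derivatives on the real line at once.
\<close>

lemma test_function_entire:
  assumes F: "F holomorphic_on UNIV" and \<eta>: "\<And>x. \<eta> x = Re (F (of_real x))" and "periodic_2pi \<eta>"
  shows "\<eta> \<in> test_functions"
proof -
  have D: "((\<lambda>x. Re (G (of_real x))) has_real_derivative Re (deriv G (of_real x))) (at x)"
    if "G holomorphic_on UNIV" for G x
  proof -
    have "(G has_field_derivative deriv G (of_real x)) (at (of_real x))"
      using that by (simp add: holomorphic_derivI)
    hence "((\<lambda>x. G (of_real x)) has_vector_derivative deriv G (of_real x)) (at x)"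
      by (rule has_vector_derivative_real_field)
    from bounded_linear.has_vector_derivative[OF bounded_linear_Re this]
    show ?thesis by (simp add: has_real_derivative_iff_has_vector_derivative)
  qed
  have *: "\<exists>G. G holomorphic_on UNIV \<and> (deriv ^^ n) \<eta> = (\<lambda>x. Re (G (of_real x)))" for n
  proof (induction n)
    case 0
    thus ?case using F \<eta> by (auto intro!: exI[of _ F])
  next
    case (Suc n)
    then obtain G where G: "G holomorphic_on UNIV" "(deriv ^^ n) \<eta> = (\<lambda>x. Re (G (of_real x)))"
      by blast
    have "(deriv ^^ Suc n) \<eta> = (\<lambda>x. Re (deriv G (of_real x)))"
      using D[OF G(1)] by (auto simp: G(2) intro!: DERIV_imp_deriv)
    moreover have "deriv G holomorphic_on UNIV" using G(1) by (simp add: holomorphic_deriv)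
    ultimately show ?case by blast
  qed
  have "(deriv ^^ n) \<eta> differentiable at x" for n x
  proof -
    obtain G where G: "G holomorphic_on UNIV" "(deriv ^^ n) \<eta> = (\<lambda>x. Re (G (of_real x)))"
      using *[of n] by blast
    show ?thesis using D[OF G(1), of x] unfolding G(2) real_differentiable_def by blast
  qed
  thus ?thesis using assms(3) by (simp add: test_functions_def)
qed

lemma cis_add_2pi [simp]: "cis (x + 2 * pi) = cis x"
  by (simp add: complex_eq_iff)

text \<open>
  Polynomials in \<open>cos x\<close> and \<open>sin x\<close> supply enough test functions: by the theorem of Stone and Weierstrass
  they approximate every continuous function on the circle.
\<close>

lemma trigonometric_polynomial_test_function:
  assumes "real_polynomial_function p"
  shows "(\<lambda>x. p (cis x)) \<in> test_functions"
proof -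
  have "\<exists>F. F holomorphic_on UNIV \<and> (\<forall>x. F (of_real x) = of_real (p (cis x)))"
    using assms
  proof induction
    case (linear f)
    interpret bounded_linear f by fact
    have "f (cis x) = cos x * f 1 + sin x * f \<i>" for x
    proof -
      have "cis x = cos x *\<^sub>R 1 + sin x *\<^sub>R \<i>" by (simp add: complex_eq_iff)
      thus ?thesis by (simp only: add scaleR real_scaleR_def)
    qed
    thus ?case
      by (intro exI[of _ "\<lambda>z. cos z * of_real (f 1) + sin z * of_real (f \<i>)"])
         (auto intro!: holomorphic_intros simp: cos_of_real sin_of_real)
  next
    case (const c)
    show ?case by (rule exI[of _ "\<lambda>_. of_real c"]) auto
  next
    case (add f g)
    then obtain F G where "F holomorphic_on UNIV" "\<forall>x. F (of_real x) = of_real (f (cis x))"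
      "G holomorphic_on UNIV" "\<forall>x. G (of_real x) = of_real (g (cis x))" by blast
    thus ?case by (intro exI[of _ "\<lambda>z. F z + G z"]) (auto intro!: holomorphic_intros)
  next
    case (mult f g)
    then obtain F G where "F holomorphic_on UNIV" "\<forall>x. F (of_real x) = of_real (f (cis x))"
      "G holomorphic_on UNIV" "\<forall>x. G (of_real x) = of_real (g (cis x))" by blast
    thus ?case by (intro exI[of _ "\<lambda>z. F z * G z"]) (auto intro!: holomorphic_intros)
  qed
  then obtain F where "F holomorphic_on UNIV" "\<And>x. F (of_real x) = of_real (p (cis x))" by blast
  thus ?thesis by (intro test_function_entire[of F]) (auto simp: periodic_2pi_def)
qed

lemma test_function_continuous:
  assumes "\<eta> \<in> test_functions"
  shows "continuous_on S \<eta>" "continuous_on S (deriv \<eta>)"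
    "(\<eta> has_real_derivative deriv \<eta> x) (at x)"
proof -
  have d: "(deriv ^^ n) \<eta> differentiable at x" for n x
    using assms by (simp add: test_functions_def)
  have c: "continuous_on S ((deriv ^^ n) \<eta>)" for n
    using d[of n] by (intro continuous_at_imp_continuous_on ballI differentiable_imp_continuous_within)
  show "continuous_on S \<eta>" using c[of 0] by simp
  show "continuous_on S (deriv \<eta>)" using c[of 1] by simp
  show "(\<eta> has_real_derivative deriv \<eta> x) (at x)"
    using d[of 0 x] DERIV_deriv_iff_real_differentiable by (simp add: real_differentiable_def)
qed

lemma integral_eq_0_circle:
  fixes g :: "real \<Rightarrow> complex" and H :: "complex \<Rightarrow> real"
  assumes g: "set_integrable lebesgue {-pi..pi} g" and H: "continuous_on UNIV H"
    and orth: "\<And>\<eta>. \<eta> \<in> test_functions \<Longrightarrow> (LINT x:{-pi..pi}|lebesgue. g x * of_real (\<eta> x)) = 0"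
  shows "(LINT x:{-pi..pi}|lebesgue. g x * of_real (H (cis x))) = 0"
proof -
  define A where "A = (LINT x:{-pi..pi}|lebesgue. norm (g x))"
  have A: "A \<ge> 0" unfolding A_def set_lebesgue_integral_def by (rule integral_nonneg_AE) auto
  have "norm (LINT x:{-pi..pi}|lebesgue. g x * of_real (H (cis x))) \<le> e * A" if e: "e > 0" for e
  proof -
    obtain p where p: "real_polynomial_function p" "\<And>z. z \<in> sphere 0 1 \<Longrightarrow> \<bar>H z - p z\<bar> < e"
      using Stone_Weierstrass_real_polynomial_function[of "sphere 0 (1::real)" H e] e
        continuous_on_subset[OF H] by auto
    have \<eta>: "(\<lambda>x. p (cis x)) \<in> test_functions" by (rule trigonometric_polynomial_test_function[OF p(1)])
    have i1: "set_integrable lebesgue {-pi..pi} (\<lambda>x. g x * of_real (H (cis x)))"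
      by (intro set_integrable_mult_continuous g continuous_intros continuous_on_compose2[OF H]) auto
    have i2: "set_integrable lebesgue {-pi..pi} (\<lambda>x. g x * of_real (p (cis x)))"
      by (intro set_integrable_mult_continuous g continuous_intros test_function_continuous(1)[OF \<eta>])
    have "(LINT x:{-pi..pi}|lebesgue. g x * of_real (H (cis x)))
        = (LINT x:{-pi..pi}|lebesgue. g x * of_real (H (cis x)) - g x * of_real (p (cis x)))"
      using orth[OF \<eta>] by (simp add: set_integral_diff(2)[OF i1 i2])
    also have "norm \<dots> \<le> (LINT x:{-pi..pi}|lebesgue. norm (g x * of_real (H (cis x)) - g x * of_real (p (cis x))))"
      by (rule set_integral_norm_bound[OF set_integral_diff(1)[OF i1 i2]])
    also have "\<dots> \<le> (LINT x:{-pi..pi}|lebesgue. e * norm (g x))"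
    proof (rule set_integral_mono)
      show "set_integrable lebesgue {-pi..pi} (\<lambda>x. norm (g x * of_real (H (cis x)) - g x * of_real (p (cis x))))"
        by (rule set_integrable_norm[OF set_integral_diff(1)[OF i1 i2]])
      show "set_integrable lebesgue {-pi..pi} (\<lambda>x. e * norm (g x))"
        by (intro set_integrable_mult_right set_integrable_norm g)
      fix x
      have "norm (g x * of_real (H (cis x)) - g x * of_real (p (cis x))) = norm (g x) * \<bar>H (cis x) - p (cis x)\<bar>"
        by (simp add: right_diff_distrib[symmetric] norm_mult flip: of_real_diff)
      also have "\<dots> \<le> norm (g x) * e" using p(2)[of "cis x"] by (intro mult_left_mono) auto
      finally show "norm (g x * of_real (H (cis x)) - g x * of_real (p (cis x))) \<le> e * norm (g x)"
        by (simp add: mult.commute)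
    qed
    also have "\<dots> = e * A" by (simp add: A_def)
    finally show ?thesis .
  qed note bound = this
  show ?thesis
  proof (rule ccontr)
    assume nz: "(LINT x:{-pi..pi}|lebesgue. g x * of_real (H (cis x))) \<noteq> 0"
    define n where "n = norm (LINT x:{-pi..pi}|lebesgue. g x * of_real (H (cis x)))"
    have n: "n > 0" using nz by (simp add: n_def)
    have "n \<le> n / (2 * (A + 1)) * A" using bound[of "n / (2 * (A + 1))"] n A by (simp add: n_def)
    also have "\<dots> < n"
    proof -
      have "0 < A * n + n * 2" using n A by (intro add_nonneg_pos) auto
      thus ?thesis using A by (simp add: field_simps)
    qed
    finally show False by simp
  qed
qed

lemma cis_inj_on: "inj_on cis {-pi<..pi}"
  by (rule inj_on_inverseI[of _ Arg]) (auto intro!: cis_Arg_unique simp: sgn_div_norm)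

text \<open>
  The indicator function of a compact subset of the circle is the pointwise limit of the continuous functions
  \<open>max 0 (1 - n dist(z, K))\<close>. The endpoints \<open>-\<pi>\<close> and \<open>\<pi>\<close> are the same point of the circle, which does not
  matter for integrals.
\<close>

lemma integral_eq_0_compact:
  fixes g :: "real \<Rightarrow> complex"
  assumes g: "set_integrable lebesgue {-pi..pi} g"
    and orth: "\<And>\<eta>. \<eta> \<in> test_functions \<Longrightarrow> (LINT x:{-pi..pi}|lebesgue. g x * of_real (\<eta> x)) = 0"
    and F: "closed F" "F \<subseteq> {-pi..pi}"
  shows "(LINT x:F|lebesgue. g x) = 0"
proof (cases "F = {}")
  case False
  define K where "K = cis ` F"
  have F_compact: "compact F" using F compact_eq_bounded_closed bounded_subset[OF bounded_closed_interval] by blast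
  have "closed K"
    unfolding K_def by (intro compact_imp_closed compact_continuous_image F_compact continuous_intros)
  have K_ne: "K \<noteq> {}" using False by (simp add: K_def)
  define H where "H = (\<lambda>n z. max 0 (1 - real n * infdist z K))"
  have Hc: "continuous_on UNIV (H n)" for n unfolding H_def by (intro continuous_intros)
  have H0: "(LINT x:{-pi..pi}|lebesgue. g x * of_real (H n (cis x))) = 0" for n
    by (rule integral_eq_0_circle[OF g Hc orth])
  have gm: "(\<lambda>x. indicator {-pi..pi} x *\<^sub>R g x) \<in> borel_measurable lebesgue"
    using g by (simp add: set_integrable_def)
  have FK: "indicator K (cis x) = (indicator F x :: real)" if "x \<in> {-pi<..<pi}" for x
  proof -
    have "x \<in> F" if cK: "cis x \<in> K"
    proof -
      obtain y where y: "y \<in> F" "cis x = cis y" using cK by (auto simp: K_def)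
      show ?thesis
      proof (cases "y = -pi")
        case True
        hence "cis x = cis pi" using y by (simp add: complex_eq_iff)
        hence "x = pi" using cis_inj_on \<open>x \<in> {-pi<..<pi}\<close> by (auto simp: inj_on_def)
        thus ?thesis using \<open>x \<in> {-pi<..<pi}\<close> by simp
      next
        case False
        hence "x = y" using cis_inj_on \<open>x \<in> {-pi<..<pi}\<close> y F(2) by (force simp: inj_on_def)
        thus ?thesis using y by simp
      qed
    qed
    thus ?thesis by (auto simp: K_def indicator_def)
  qed
  have lim: "(\<lambda>n. H n z) \<longlonglongrightarrow> indicator K z" for z
  proof (cases "z \<in> K")
    case True
    thus ?thesis by (simp add: H_def)
  next
    case False
    hence pos: "infdist z K > 0" using \<open>closed K\<close> K_ne infdist_pos_not_in_closed by blast
    obtain N where N: "real N * infdist z K > 1" using pos reals_Archimedean3 by blast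
    have "H n z = 0" if "n \<ge> N" for n
    proof -
      have "real N * infdist z K \<le> real n * infdist z K" using that pos by (intro mult_right_mono) auto
      thus ?thesis using N by (simp add: H_def)
    qed
    hence "\<forall>\<^sub>F n in sequentially. H n z = 0" by (auto simp: eventually_sequentially)
    thus ?thesis using False by (auto intro: tendsto_eventually)
  qed
  have "(\<lambda>n. LINT x|lebesgue. indicator {-pi..pi} x *\<^sub>R (g x * of_real (H n (cis x))))
      \<longlonglongrightarrow> (LINT x|lebesgue. indicator F x *\<^sub>R g x)"
  proof (rule integral_dominated_convergence[where w = "\<lambda>x. norm (indicator {-pi..pi} x *\<^sub>R g x)"])
    have "set_integrable lebesgue F g"
      using g F by (intro set_integrable_subset[OF g]) auto
    thus "(\<lambda>x. indicator F x *\<^sub>R g x) \<in> borel_measurable lebesgue" by (simp add: set_integrable_def)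
    show "(\<lambda>x. indicator {-pi..pi} x *\<^sub>R (g x * of_real (H n (cis x)))) \<in> borel_measurable lebesgue" for n
    proof -
      have "set_integrable lebesgue {-pi..pi} (\<lambda>x. g x * of_real (H n (cis x)))"
        by (intro set_integrable_mult_continuous g continuous_intros continuous_on_compose2[OF Hc]) auto
      thus ?thesis by (simp add: set_integrable_def)
    qed
    show "integrable lebesgue (\<lambda>x. norm (indicator {-pi..pi} x *\<^sub>R g x))"
      using g unfolding set_integrable_def by (rule integrable_norm)
    have "AE x in lebesgue. x \<noteq> pi \<and> x \<noteq> - pi"
      unfolding AE_lebesgue_iff_negligible by (rule negligible_subset[of "{pi, -pi}"]) auto
    thus "AE x in lebesgue. (\<lambda>n. indicator {-pi..pi} x *\<^sub>R (g x * of_real (H n (cis x))))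
        \<longlonglongrightarrow> indicator F x *\<^sub>R g x"
    proof eventually_elim
      case (elim x)
      show ?case
      proof (cases "x \<in> {-pi..pi}")
        case True
        have "(\<lambda>n. g x * of_real (H n (cis x))) \<longlonglongrightarrow> g x * of_real (indicator K (cis x))"
          by (intro tendsto_intros lim)
        thus ?thesis using True FK[of x] elim by (simp add: mult.commute scaleR_conv_of_real)
      next
        case False
        hence "x \<notin> F" using F(2) by blast
        thus ?thesis using False by simp
      qed
    qed
    show "AE x in lebesgue. norm (indicator {-pi..pi} x *\<^sub>R (g x * of_real (H n (cis x))))
        \<le> norm (indicator {-pi..pi} x *\<^sub>R g x)" for n
    proof (intro AE_I2)
      fix x
      have "\<bar>H n (cis x)\<bar> \<le> 1" by (auto simp: H_def infdist_nonneg)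
      hence "norm (g x) * \<bar>H n (cis x)\<bar> \<le> norm (g x) * 1" by (intro mult_left_mono) auto
      thus "norm (indicator {-pi..pi} x *\<^sub>R (g x * of_real (H n (cis x))))
        \<le> norm (indicator {-pi..pi} x *\<^sub>R g x)"
        by (auto simp: norm_mult indicator_def)
    qed
  qed
  hence "(\<lambda>n. 0 :: complex) \<longlonglongrightarrow> (LINT x|lebesgue. indicator F x *\<^sub>R g x)"
    using H0 by (simp add: set_lebesgue_integral_def)
  thus ?thesis by (simp add: set_lebesgue_integral_def LIMSEQ_const_iff)
qed (simp add: set_lebesgue_integral_def)

text \<open>
  Up to a null set \<open>{r > 0}\<close> is a countable union of closed sets. The integral of the positive function \<open>r\<close>
  over each of them vanishes, so they are null sets.
\<close>

lemma AE_le_0_if_integral_closed_0: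
  fixes r :: "real \<Rightarrow> real"
  assumes r: "set_integrable lebesgue I r" and I: "I \<in> sets lebesgue"
    and int: "\<And>F. closed F \<Longrightarrow> F \<subseteq> I \<Longrightarrow> (LINT x:F|lebesgue. r x) = 0"
  shows "AE x in lebesgue. x \<in> I \<longrightarrow> r x \<le> 0"
proof -
  define E where "E = {x. indicator I x *\<^sub>R r x > 0}"
  have meas: "(\<lambda>x. indicator I x *\<^sub>R r x) \<in> borel_measurable lebesgue"
    using r by (simp add: set_integrable_def)
  have "E \<in> sets lebesgue"
    using borel_measurable_less[OF borel_measurable_const meas, of 0] unfolding E_def by simp
  then obtain C T where CT: "fsigma C" "T \<in> null_sets lebesgue" "C \<union> T = E"
    using lebesgue_set_almost_fsigma by metis
  from CT(1) obtain F :: "nat \<Rightarrow> real set" where F: "\<And>n. closed (F n)" "C = \<Union>(range F)"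
    by (auto elim: fsigma.cases)
  have FE: "F n \<subseteq> E" for n using F(2) CT(3) by blast
  have FI: "F n \<subseteq> I" for n
    by (rule subsetI, rule ccontr) (use FE[of n] in \<open>auto simp: E_def\<close>)
  have pos: "r x > 0" if "x \<in> F n" for x n
  proof -
    have "x \<in> E" "x \<in> I" using FE FI that by blast+
    thus ?thesis by (simp add: E_def)
  qed
  have "AE x in lebesgue. x \<notin> F n" for n
  proof -
    have "set_integrable lebesgue (F n) r"
      using F(1)[of n] by (intro set_integrable_subset[OF r _ FI]) auto
    hence i: "integrable lebesgue (\<lambda>x. indicator (F n) x *\<^sub>R r x)" by (simp add: set_integrable_def)
    have "(LINT x|lebesgue. indicator (F n) x *\<^sub>R r x) = 0"
      using int[OF F(1) FI] by (simp add: set_lebesgue_integral_def)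
    hence "AE x in lebesgue. indicator (F n) x *\<^sub>R r x = 0"
      using integral_nonneg_eq_0_iff_AE[OF i] pos by (force simp: indicator_def less_imp_le)
    thus ?thesis
    proof eventually_elim
      case (elim x)
      thus ?case using pos[of x n] by (auto simp: indicator_def)
    qed
  qed
  hence "AE x in lebesgue. \<forall>n. x \<notin> F n" by (simp add: AE_all_countable)
  moreover have "AE x in lebesgue. x \<notin> T" using CT(2) by (rule AE_not_in)
  ultimately show ?thesis
  proof eventually_elim
    case (elim x)
    hence "x \<notin> E" using CT(3) F(2) by blast
    thus ?case by (auto simp: E_def indicator_def)
  qed
qed

text \<open>
  If \<open>g\<close> is orthogonal to the test functions, then also to the continuous functions of \<open>cis x\<close>, hence to the indicator
  functions of closed sets. So the real and the imaginary part of \<open>g\<close> are neither positive nor negative on a set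
  of positive measure.
\<close>

theorem fundamental_lemma:
  fixes g :: "real \<Rightarrow> complex"
  assumes g: "set_integrable lebesgue {-pi..pi} g"
    and orth: "\<And>\<eta>. \<eta> \<in> test_functions \<Longrightarrow> (LINT x:{-pi..pi}|lebesgue. g x * of_real (\<eta> x)) = 0"
  shows "AE x in lebesgue. x \<in> {-pi..pi} \<longrightarrow> g x = 0"
proof -
  have *: "AE x in lebesgue. x \<in> {-pi..pi} \<longrightarrow> l (g x) \<le> 0" if l: "bounded_linear l" for l :: "complex \<Rightarrow> real"
  proof (rule AE_le_0_if_integral_closed_0)
    interpret l: bounded_linear l by fact
    have scale: "(\<lambda>x. indicator S x *\<^sub>R l (g x)) = (\<lambda>x. l (indicator S x *\<^sub>R g x))" for S
      by (simp add: l.scaleR)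
    show "set_integrable lebesgue {-pi..pi} (\<lambda>x. l (g x))"
      using g unfolding set_integrable_def scale by (rule integrable_bounded_linear[OF l])
    fix F :: "real set" assume F: "closed F" "F \<subseteq> {-pi..pi}"
    have "set_integrable lebesgue F g" using F by (intro set_integrable_subset[OF g]) auto
    hence "(LINT x:F|lebesgue. l (g x)) = l (LINT x:F|lebesgue. g x)"
      unfolding set_lebesgue_integral_def set_integrable_def scale by (rule integral_bounded_linear[OF l])
    thus "(LINT x:F|lebesgue. l (g x)) = 0"
      using integral_eq_0_compact[OF g orth F] l.zero by simp
  qed auto
  have "AE x in lebesgue. (x \<in> {-pi..pi} \<longrightarrow> Re (g x) \<le> 0) \<and> (x \<in> {-pi..pi} \<longrightarrow> - Re (g x) \<le> 0) \<and>
      (x \<in> {-pi..pi} \<longrightarrow> Im (g x) \<le> 0) \<and> (x \<in> {-pi..pi} \<longrightarrow> - Im (g x) \<le> 0)"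
    by (intro AE_conjI * bounded_linear_Re bounded_linear_Im bounded_linear_minus)
  thus ?thesis by eventually_elim (auto simp: complex_eq_iff)
qed

section \<open>Weak derivatives of periodic functions\<close>

lemma continuous_set_integrable:
  fixes f :: "real \<Rightarrow> complex"
  shows "continuous_on UNIV f \<Longrightarrow> set_integrable lebesgue {a..b} f"
  by (rule absolutely_integrable_continuous_real) (rule continuous_on_subset, auto)

lemma pfun_set_integrable: "set_integrable lebesgue {a..b} (pfun f)"
  by (rule continuous_set_integrable) (intro continuous_intros)

lemma LINT_pfun: "(LINT x:{-pi..pi}|lebesgue. pfun f x) = pint f"
  unfolding pint_def by (rule set_lebesgue_integral_eq_integral(2)[OF pfun_set_integrable])

text \<open>
  A function on the interval with equal boundary values factors through \<open>cis\<close>. The induced function on the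
  circle is continuous because preimages of closed sets are images of compact sets under \<open>cis\<close>.
\<close>

lemma periodic_extension:
  fixes h :: "real \<Rightarrow> complex"
  assumes h: "continuous_on {-pi..pi} h" and eq: "h (-pi) = h pi"
  shows "\<exists>u. \<forall>x\<in>{-pi..pi}. pfun u x = h x"
proof -
  \<comment> \<open>\<open>Arg\<close> inverts \<open>cis\<close> on the interval, except that it sends the left endpoint to the right one.\<close>
  have "\<exists>H. \<forall>x\<in>{-pi..pi}. H (cis x) = h x"
  proof (intro exI ballI)
    fix x assume x: "x \<in> {-pi..pi}"
    have "Arg (cis x) = x \<or> x = -pi \<and> Arg (cis x) = pi"
    proof (cases "x = -pi")
      case True
      hence "cis x = cis pi" by (simp add: complex_eq_iff)
      hence "Arg (cis x) = pi" by (intro cis_Arg_unique) (auto simp: sgn_div_norm)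
      thus ?thesis using True by simp
    next
      case False
      thus ?thesis using x by (auto intro!: cis_Arg_unique simp: sgn_div_norm)
    qed
    thus "(h \<circ> Arg) (cis x) = h x" using eq by auto
  qed
  then obtain H where H: "\<And>x. x \<in> {-pi..pi} \<Longrightarrow> H (cis x) = h x" by blast
  have sph: "\<exists>x\<in>{-pi..pi}. z = cis x" if "z \<in> sphere 0 1" for z
  proof -
    have z: "norm z = 1" "z \<noteq> 0" using that by auto
    thus ?thesis using Arg_bounded[of z] cis_Arg[of z]
      by (intro bexI[of _ "Arg z"]) (auto simp: sgn_div_norm)
  qed
  have "continuous_on (sphere 0 1) H"
  proof (subst continuous_on_closed_vimage, simp, intro allI impI)
    fix B :: "complex set" assume "closed B"
    have "H -` B \<inter> sphere 0 1 = cis ` ({-pi..pi} \<inter> h -` B)"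
      using sph H by fastforce
    moreover have "compact (cis ` ({-pi..pi} \<inter> h -` B))"
    proof (intro compact_continuous_image)
      have "closed ({-pi..pi} \<inter> h -` B)"
        using continuous_closed_preimage[OF h _ \<open>closed B\<close>] by simp
      thus "compact ({-pi..pi} \<inter> h -` B)"
        by (simp add: compact_eq_bounded_closed bounded_Int)
    qed (intro continuous_intros)
    ultimately show "closed (H -` B \<inter> sphere 0 1)" by (simp add: compact_imp_closed)
  qed
  hence "continuous_on UNIV (\<lambda>x. H (cis x))"
    by (rule continuous_on_compose2) (auto intro!: continuous_intros)
  hence "pfun (Pfun (\<lambda>x. H (cis x))) = (\<lambda>x. H (cis x))"
    by (rule pfun_Pfun) (simp add: periodic_2pi_def)
  thus ?thesis using H by (intro exI[of _ "Pfun (\<lambda>x. H (cis x))"]) simp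
qed

lemma sigma_finite_lebesgue: "sigma_finite_measure (lebesgue :: 'a::euclidean_space measure)"
proof
  show "\<exists>A. countable A \<and> A \<subseteq> sets lebesgue \<and> \<Union>A = space (lebesgue :: 'a measure) \<and>
      (\<forall>a\<in>A. emeasure lebesgue a \<noteq> \<infinity>)"
  proof (intro exI conjI ballI)
    show "countable (range (\<lambda>n::nat. ball (0::'a) (real n)))" by simp
    show "\<Union>(range (\<lambda>n::nat. ball (0::'a) (real n))) = space lebesgue"
      by (auto intro: reals_Archimedean2)
    fix a :: "'a set" assume "a \<in> range (\<lambda>n::nat. ball (0::'a) (real n))"
    then obtain n where a: "a = ball 0 (real n)" by auto
    show "emeasure lebesgue a \<noteq> \<infinity>"
      using fmeasurableD2[OF lmeasurable_ball[of 0 "real n"]] unfolding a by simp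
  qed auto
qed

text \<open>
  Fubini's theorem on the triangle \<open>-\<pi> \<le> y \<le> x \<le> \<pi>\<close>, for an integrand \<open>g\<close> that need not be continuous.
\<close>

lemma integration_by_parts_indefinite:
  fixes g :: "real \<Rightarrow> complex"
  assumes g: "set_integrable lebesgue {-pi..pi} g" and e: "has_pderiv e e'"
  shows "(LINT x:{-pi..pi}|lebesgue. integral {-pi..x} g * pfun e' x)
       = (LINT y:{-pi..pi}|lebesgue. g y * (pfun e pi - pfun e y))"
proof -
  define I where "I = {-pi..pi}"
  interpret leb: sigma_finite_measure "lebesgue :: real measure" by (rule sigma_finite_lebesgue)
  interpret pair_sigma_finite "lebesgue :: real measure" "lebesgue :: real measure" ..
  define a where "a = (\<lambda>x. indicator I x *\<^sub>R pfun e' x)"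
  define b where "b = (\<lambda>y. indicator I y *\<^sub>R g y)"
  have a: "integrable lebesgue a"
    using pfun_set_integrable[of "-pi" pi e'] by (simp add: set_integrable_def a_def I_def)
  have b: "integrable lebesgue b" using g by (simp add: set_integrable_def b_def I_def)
  \<comment> \<open>The indicator functions of the interval are part of \<open>a\<close> and \<open>b\<close>, so only the condition \<open>y \<le> x\<close> remains.\<close>
  define k where "k = (\<lambda>x y. of_real (indicator {p. snd p \<le> fst p} (x, y)) * (a x * b y))"
  have am: "(\<lambda>p. a (fst p)) \<in> borel_measurable (lebesgue \<Otimes>\<^sub>M lebesgue)"
    by (rule measurable_compose[OF measurable_fst]) (use a in auto)
  have bm: "(\<lambda>p. b (snd p)) \<in> borel_measurable (lebesgue \<Otimes>\<^sub>M lebesgue)"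
    by (rule measurable_compose[OF measurable_snd]) (use b in auto)
  have ab: "integrable (lebesgue \<Otimes>\<^sub>M lebesgue) (\<lambda>p. a (fst p) * b (snd p))"
  proof (rule Fubini_integrable)
    show "(\<lambda>p. a (fst p) * b (snd p)) \<in> borel_measurable (lebesgue \<Otimes>\<^sub>M lebesgue)"
      by (rule borel_measurable_times[OF am bm])
    show "integrable lebesgue (\<lambda>x. \<integral>y. norm (a (fst (x, y)) * b (snd (x, y))) \<partial>lebesgue)"
      using a by (simp add: norm_mult)
    show "AE x in lebesgue. integrable lebesgue (\<lambda>y. a (fst (x, y)) * b (snd (x, y)))"
      using b by simp
  qed
  have idm: "(\<lambda>x. x) \<in> borel_measurable (lebesgue :: real measure)"
    by (rule measurable_completion) simp
  have "{p \<in> space (lebesgue \<Otimes>\<^sub>M lebesgue). snd p \<le> (fst p :: real)} \<in> sets (lebesgue \<Otimes>\<^sub>M lebesgue)"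
    by (rule borel_measurable_le) (auto intro!: measurable_compose[OF measurable_fst idm]
        measurable_compose[OF measurable_snd idm])
  hence tri: "{p. snd p \<le> (fst p :: real)} \<in> sets (lebesgue \<Otimes>\<^sub>M lebesgue)"
    by (simp add: space_pair_measure)
  have "integrable (lebesgue \<Otimes>\<^sub>M lebesgue)
      (\<lambda>p. indicator {p. snd p \<le> fst p} p *\<^sub>R (a (fst p) * b (snd p)))"
    using tri ab by (rule integrable_mult_indicator)
  moreover have "case_prod k = (\<lambda>p. indicator {p. snd p \<le> fst p} p *\<^sub>R (a (fst p) * b (snd p)))"
    by (auto simp: k_def scaleR_conv_of_real)
  ultimately have "integrable (lebesgue \<Otimes>\<^sub>M lebesgue) (case_prod k)" by simp
  hence fub: "(\<integral>y. (\<integral>x. k x y \<partial>lebesgue) \<partial>lebesgue) = (\<integral>x. (\<integral>y. k x y \<partial>lebesgue) \<partial>lebesgue)"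
    by (rule Fubini_integral)
  have "(\<integral>y. k x y \<partial>lebesgue) = indicator I x *\<^sub>R (integral {-pi..x} g * pfun e' x)" for x
  proof (cases "x \<in> I")
    case True
    have gi: "set_integrable lebesgue {-pi..x} g"
      using True by (intro set_integrable_subset[OF g]) (auto simp: I_def)
    have "k x y = (indicator {-pi..x} y *\<^sub>R g y) * pfun e' x" for y
      using True by (auto simp: k_def a_def b_def I_def indicator_def)
    hence "(\<integral>y. k x y \<partial>lebesgue) = (\<integral>y. indicator {-pi..x} y *\<^sub>R g y \<partial>lebesgue) * pfun e' x"
      by (simp only: integral_mult_left_zero)
    thus ?thesis using True set_lebesgue_integral_eq_integral(2)[OF gi]
      by (simp add: set_lebesgue_integral_def)
  next
    case False
    hence "k x y = 0" for y by (simp add: k_def a_def)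
    thus ?thesis using False by simp
  qed
  moreover have "(\<integral>x. k x y \<partial>lebesgue) = indicator I y *\<^sub>R (g y * (pfun e pi - pfun e y))" for y
  proof (cases "y \<in> I")
    case True
    have "k x y = g y * (indicator {y..pi} x *\<^sub>R pfun e' x)" for x
      using True by (auto simp: k_def a_def b_def I_def indicator_def)
    hence "(\<integral>x. k x y \<partial>lebesgue) = g y * (LINT x:{y..pi}|lebesgue. pfun e' x)"
      by (simp only: integral_mult_right_zero set_lebesgue_integral_def)
    also have "(LINT x:{y..pi}|lebesgue. pfun e' x) = integral {y..pi} (pfun e')"
      by (rule set_lebesgue_integral_eq_integral(2)[OF pfun_set_integrable])
    also have "\<dots> = pfun e pi - pfun e y"
      using True e by (intro integral_unique fundamental_theorem_of_calculus)
        (auto simp: I_def has_pderiv_def intro: has_vector_derivative_at_within)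
    finally show ?thesis using True by simp
  next
    case False
    hence "k x y = 0" for x by (simp add: k_def b_def)
    thus ?thesis using False by simp
  qed
  ultimately show ?thesis using fub by (simp add: set_lebesgue_integral_def I_def)
qed

lemma test_function_pcf:
  assumes "\<eta> \<in> test_functions"
  shows "\<exists>e e'. has_pderiv e e' \<and> (\<forall>x. pfun e x = of_real (\<eta> x)) \<and> (\<forall>x. pfun e' x = of_real (deriv \<eta> x))"
proof -
  note \<eta> = test_function_continuous[OF assms]
  have per: "periodic_2pi \<eta>" using assms by (simp add: test_functions_def)
  have "((\<lambda>x. \<eta> (x + 2 * pi)) has_real_derivative deriv \<eta> (x + 2 * pi)) (at x)" for x
    using \<eta>(3)[of "x + 2 * pi"] by (simp only: DERIV_shift)
  hence "periodic_2pi (deriv \<eta>)"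
    using per by (auto simp: periodic_2pi_def intro: DERIV_imp_deriv[symmetric])
  hence e': "pfun (Pfun (\<lambda>x. of_real (deriv \<eta> x))) = (\<lambda>x. of_real (deriv \<eta> x))"
    by (intro pfun_Pfun continuous_intros \<eta>) (simp add: periodic_2pi_def)
  have e: "pfun (Pfun (\<lambda>x. of_real (\<eta> x))) = (\<lambda>x. of_real (\<eta> x))"
    using per by (intro pfun_Pfun continuous_intros \<eta>) (simp add: periodic_2pi_def)
  have "has_pderiv (Pfun (\<lambda>x. of_real (\<eta> x))) (Pfun (\<lambda>x. of_real (deriv \<eta> x)))"
    unfolding has_pderiv_def e e'
    using \<eta>(3) by (auto intro!: has_vector_derivative_of_real
        simp flip: has_real_derivative_iff_has_vector_derivative)
  thus ?thesis using e e' by metis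
qed

lemma has_pderiv_is_weak_deriv:
  assumes "has_pderiv f f'"
  shows "is_weak_deriv (pfun f) (pfun f')"
  unfolding is_weak_deriv_def
proof
  fix \<eta> assume "\<eta> \<in> test_functions"
  then obtain e e' where e: "has_pderiv e e'" "\<And>x. pfun e x = of_real (\<eta> x)"
    "\<And>x. pfun e' x = of_real (deriv \<eta> x)" using test_function_pcf by metis
  have "pmean (f * e' + f' * e) = 0"
    by (rule pmean_has_pderiv[OF has_pderiv_mult[OF assms e(1)]])
  hence "pint (f * e') = - pint (f' * e)"
    by (simp add: pmean_def pint_add eq_neg_iff_add_eq_0)
  thus "(LINT x:{-pi..pi}|lebesgue. pfun f x * of_real (deriv \<eta> x)) =
      - (LINT x:{-pi..pi}|lebesgue. pfun f' x * of_real (\<eta> x))"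
    by (simp add: LINT_pfun[symmetric] e)
qed

lemma const_1_test_function: "(\<lambda>_. 1) \<in> test_functions"
  by (rule test_function_entire[of "\<lambda>_. 1"]) (auto simp: periodic_2pi_def)

lemma set_integrable_mult_test:
  fixes f :: "real \<Rightarrow> complex"
  assumes "set_integrable lebesgue {-pi..pi} f" "\<eta> \<in> test_functions"
  shows "set_integrable lebesgue {-pi..pi} (\<lambda>x. f x * of_real (\<eta> x))"
    "set_integrable lebesgue {-pi..pi} (\<lambda>x. f x * of_real (deriv \<eta> x))"
proof -
  show "set_integrable lebesgue {-pi..pi} (\<lambda>x. f x * of_real (\<eta> x))"
    by (intro set_integrable_mult_continuous assms(1) continuous_intros
        test_function_continuous[OF assms(2)])
  show "set_integrable lebesgue {-pi..pi} (\<lambda>x. f x * of_real (deriv \<eta> x))"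
    by (intro set_integrable_mult_continuous assms(1) continuous_intros
        test_function_continuous[OF assms(2)])
qed

text \<open>
  Test with the constant function.
\<close>

lemma weak_deriv_mean_zero:
  assumes "is_weak_deriv f g"
  shows "(LINT x:{-pi..pi}|lebesgue. g x) = 0"
proof -
  have "deriv (\<lambda>_. 1 :: real) = (\<lambda>_. 0)" by (auto intro: DERIV_imp_deriv)
  thus ?thesis using assms const_1_test_function
    unfolding is_weak_deriv_def by (force dest: bspec)
qed

lemma weak_deriv_unique:
  assumes "g \<in> L2per" "h \<in> L2per" "is_weak_deriv f g" "is_weak_deriv f h"
  shows "AE x in lebesgue. g x = h x"
proof -
  note gi = L2per_set_integrable[OF assms(1)] and hi = L2per_set_integrable[OF assms(2)]
  have "AE x in lebesgue. x \<in> {-pi..pi} \<longrightarrow> g x - h x = 0"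
  proof (rule fundamental_lemma)
    show "set_integrable lebesgue {-pi..pi} (\<lambda>x. g x - h x)"
      by (rule set_integral_diff(1)[OF gi hi])
    fix \<eta> assume \<eta>: "\<eta> \<in> test_functions"
    show "(LINT x:{-pi..pi}|lebesgue. (g x - h x) * of_real (\<eta> x)) = 0"
      using assms(3,4) \<eta>
        set_integral_diff(2)[OF set_integrable_mult_test(1)[OF gi \<eta>] set_integrable_mult_test(1)[OF hi \<eta>]]
      by (simp add: left_diff_distrib is_weak_deriv_def)
  qed
  hence ae: "AE x in lebesgue. x \<in> {-pi..pi} \<longrightarrow> g x = h x" by simp
  show ?thesis
    by (rule AE_period_imp_AE[OF _ ae]) (use assms(1,2) in \<open>simp add: L2per_def periodic_2pi_def\<close>)
qed

lemma mean_zero_test_function_primitive: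
  assumes "\<theta> \<in> test_functions"
  shows "\<exists>\<eta>\<in>test_functions. \<forall>x. deriv \<eta> x = \<theta> x - integral {-pi..pi} \<theta> / (2 * pi)"
proof -
  define m where "m = integral {-pi..pi} \<theta> / (2 * pi)"
  obtain e where e: "\<And>x. pfun e x = of_real (\<theta> x)" using test_function_pcf[OF assms] by metis
  have "pint e = of_real (integral {-pi..pi} \<theta>)"
    unfolding pint_def
    by (subst integral_linear[OF _ bounded_linear_of_real, symmetric])
       (auto simp: e o_def intro!: integral_cong integrable_continuous_interval test_function_continuous assms)
  hence me: "pmean e = of_real m" by (simp add: pmean_def m_def scaleR_conv_of_real field_simps)
  define \<eta> where "\<eta> = (\<lambda>x. Re (pfun (pprim e) x))"
  have D: "(\<eta> has_real_derivative \<theta> x - m) (at x)" for x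
    using bounded_linear.has_vector_derivative[OF bounded_linear_Re has_pderiv_pprim[of e, unfolded has_pderiv_def, rule_format, of x]]
    by (simp add: \<eta>_def has_real_derivative_iff_has_vector_derivative e me)
  have d\<eta>: "deriv \<eta> = (\<lambda>x. \<theta> x - m)" using DERIV_imp_deriv[OF D] by blast
  have d\<theta>: "deriv (\<lambda>x. \<theta> x - m) = deriv \<theta>"
  proof
    fix x
    have "((\<lambda>x. \<theta> x - m) has_real_derivative deriv \<theta> x - 0) (at x)"
      by (intro DERIV_diff DERIV_const test_function_continuous(3)[OF assms])
    thus "deriv (\<lambda>x. \<theta> x - m) x = deriv \<theta> x" by (simp add: DERIV_imp_deriv)
  qed
  have t: "(deriv ^^ n) \<theta> differentiable at x" for n x using assms by (simp add: test_functions_def)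
  have "(deriv ^^ n) \<eta> differentiable at x" for n x
  proof (cases n)
    case 0
    thus ?thesis using D[of x] by (auto simp: real_differentiable_def)
  next
    case (Suc k)
    show ?thesis
    proof (cases k)
      case 0
      thus ?thesis using Suc t[of 0 x] by (simp add: d\<eta>)
    next
      case (Suc j)
      hence "(deriv ^^ n) \<eta> = (deriv ^^ j) (deriv (deriv \<eta>))"
        using \<open>n = Suc k\<close> by (simp add: funpow_swap1)
      also have "\<dots> = (deriv ^^ Suc j) \<theta>" by (simp add: d\<eta> d\<theta> funpow_swap1)
      finally show ?thesis using t[of "Suc j" x] by (simp only:)
    qed
  qed
  moreover have "periodic_2pi \<eta>" by (simp add: periodic_2pi_def \<eta>_def)
  ultimately show ?thesis
    by (intro bexI[of _ \<eta>]) (auto simp: test_functions_def d\<eta> m_def)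
qed

text \<open>
  Subtracting its mean from a test function \<open>\<theta>\<close> gives the derivative of a test function. Hence \<open>f\<close> is
  orthogonal to \<open>\<theta> - mean \<theta>\<close>, which says that \<open>f - mean f\<close> is orthogonal to \<open>\<theta>\<close>.
\<close>

lemma weak_deriv_zero_imp_const:
  assumes f: "set_integrable lebesgue {-pi..pi} f" and per: "periodic_2pi f"
    and weak: "is_weak_deriv f (\<lambda>_. 0)"
  shows "\<exists>c. AE x in lebesgue. f x = c"
proof -
  define c where "c = (LINT x:{-pi..pi}|lebesgue. f x) / of_real (2 * pi)"
  have ci: "set_integrable lebesgue {-pi..pi} (\<lambda>_. c)" by (rule continuous_set_integrable) auto
  have "AE x in lebesgue. x \<in> {-pi..pi} \<longrightarrow> f x - c = 0"
  proof (rule fundamental_lemma)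
    show "set_integrable lebesgue {-pi..pi} (\<lambda>x. f x - c)" by (rule set_integral_diff(1)[OF f ci])
    fix \<theta> assume \<theta>: "\<theta> \<in> test_functions"
    define m where "m = integral {-pi..pi} \<theta> / (2 * pi)"
    obtain \<eta> where \<eta>: "\<eta> \<in> test_functions" "\<And>x. deriv \<eta> x = \<theta> x - m"
      using mean_zero_test_function_primitive[OF \<theta>] by (auto simp: m_def)
    have f\<theta>: "set_integrable lebesgue {-pi..pi} (\<lambda>x. f x * of_real (\<theta> x))"
      and c\<theta>: "set_integrable lebesgue {-pi..pi} (\<lambda>x. c * of_real (\<theta> x))"
      and fm: "set_integrable lebesgue {-pi..pi} (\<lambda>x. f x * of_real m)"
      using set_integrable_mult_test(1)[OF f \<theta>] set_integrable_mult_test(1)[OF ci \<theta>]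
        set_integrable_mult_continuous[OF f, of "\<lambda>_. of_real m"] by auto
    have "0 = (LINT x:{-pi..pi}|lebesgue. f x * of_real (deriv \<eta> x))"
      using weak \<eta>(1) by (simp add: is_weak_deriv_def)
    also have "\<dots> = (LINT x:{-pi..pi}|lebesgue. f x * of_real (\<theta> x) - f x * of_real m)"
      by (simp add: \<eta>(2) right_diff_distrib)
    also have "\<dots> = (LINT x:{-pi..pi}|lebesgue. f x * of_real (\<theta> x)) - (LINT x:{-pi..pi}|lebesgue. f x * of_real m)"
      by (rule set_integral_diff(2)[OF f\<theta> fm])
    also have "(LINT x:{-pi..pi}|lebesgue. f x * of_real m) = (LINT x:{-pi..pi}|lebesgue. f x) * of_real m"
      by simp
    also have "\<dots> = c * of_real (integral {-pi..pi} \<theta>)" by (simp add: c_def m_def)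
    also have "\<dots> = c * (LINT x:{-pi..pi}|lebesgue. of_real (\<theta> x))"
    proof -
      have "(LINT x:{-pi..pi}|lebesgue. complex_of_real (\<theta> x)) = integral {-pi..pi} (of_real \<circ> \<theta>)"
        using set_lebesgue_integral_eq_integral(2)[OF continuous_set_integrable[of "\<lambda>x. of_real (\<theta> x)"]]
        by (simp add: o_def continuous_on_of_real test_function_continuous(1)[OF \<theta>])
      also have "\<dots> = of_real (integral {-pi..pi} \<theta>)"
        by (rule integral_linear[OF _ bounded_linear_of_real])
           (intro integrable_continuous_interval test_function_continuous[OF \<theta>])
      finally show ?thesis by simp
    qed
    also have "\<dots> = (LINT x:{-pi..pi}|lebesgue. c * of_real (\<theta> x))" by simp
    finally show "(LINT x:{-pi..pi}|lebesgue. (f x - c) * of_real (\<theta> x)) = 0"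
      by (simp add: left_diff_distrib set_integral_diff(2)[OF f\<theta> c\<theta>])
  qed
  hence ae: "AE x in lebesgue. x \<in> {-pi..pi} \<longrightarrow> f x = c" by simp
  have "AE x in lebesgue. f x = c"
    by (rule AE_period_imp_AE[OF _ ae]) (use per in \<open>simp add: periodic_2pi_def\<close>)
  thus ?thesis by blast
qed

section \<open>Continuous representatives of Sobolev functions\<close>

text \<open>
  \<open>u\<close> is the continuous version of \<open>f\<close>; it is unique by \<open>represents_unique\<close>.
\<close>

definition represents :: "pcf \<Rightarrow> (real \<Rightarrow> complex) \<Rightarrow> bool" where
  "represents u f \<longleftrightarrow> periodic_2pi f \<and> (AE x in lebesgue. f x = pfun u x)"

lemma represents_pfun [simp]: "represents u (pfun u)"
  by (simp add: represents_def periodic_pfun)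

lemma represents_unique: "represents u f \<Longrightarrow> represents v f \<Longrightarrow> u = v"
proof -
  assume uv: "represents u f" "represents v f"
  hence "AE x in lebesgue. f x = pfun u x" "AE x in lebesgue. f x = pfun v x"
    by (auto simp: represents_def)
  hence "AE x in lebesgue. pfun u x = pfun v x" by eventually_elim simp
  hence "pfun u = pfun v" by (intro continuous_AE_eq_imp_eq continuous_intros)
  thus "u = v" by (intro pcf_eqI) simp
qed

lemma represents_measurable:
  assumes "represents u f"
  shows "f \<in> borel_measurable lebesgue"
proof (rule borel_measurable_AE)
  have "pfun u \<in> borel_measurable borel"
    by (intro borel_measurable_continuous_onI continuous_intros)
  thus "pfun u \<in> borel_measurable lebesgue" by (simp add: measurable_completion)
  show "AE x in lebesgue. pfun u x = f x"
    using assms unfolding represents_def by (auto elim: eventually_mono)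
qed

lemma LINT_represents:
  assumes "f \<in> borel_measurable lebesgue" "AE x in lebesgue. f x = pfun u x"
  shows "(LINT x:{-pi..pi}|lebesgue. f x) = pint u"
proof -
  have "represents u (pfun u)" by simp
  note m = represents_measurable[OF this]
  have "(LINT x:{-pi..pi}|lebesgue. f x) = (LINT x:{-pi..pi}|lebesgue. pfun u x)"
    unfolding set_lebesgue_integral_def
  proof (rule integral_cong_AE)
    show "AE x in lebesgue. indicat_real {-pi..pi} x *\<^sub>R f x = indicat_real {-pi..pi} x *\<^sub>R pfun u x"
      using assms(2) by eventually_elim simp
  qed (auto intro!: borel_measurable_scaleR borel_measurable_indicator assms m)
  thus ?thesis by (simp add: LINT_pfun)
qed

lemma represents_L2per:
  assumes "represents u f"
  shows "f \<in> L2per"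
proof -
  note fm = represents_measurable[OF assms]
  have "set_integrable lebesgue {-pi..pi} (\<lambda>x. (cmod (f x))\<^sup>2)"
  proof (rule set_integrable_bound)
    show "set_integrable lebesgue {-pi..pi} (\<lambda>x. (norm u)\<^sup>2)"
      by (rule absolutely_integrable_continuous_real) auto
    show "set_borel_measurable lebesgue {-pi..pi} (\<lambda>x. (cmod (f x))\<^sup>2)"
      unfolding set_borel_measurable_def
      by (intro borel_measurable_scaleR borel_measurable_indicator borel_measurable_power
          measurable_compose[OF fm borel_measurable_norm]) auto
    have "AE x in lebesgue. f x = pfun u x" using assms by (simp add: represents_def)
    thus "AE x in lebesgue. x \<in> {-pi..pi} \<longrightarrow> norm ((cmod (f x))\<^sup>2) \<le> norm ((norm u)\<^sup>2)"
      by eventually_elim (auto intro!: power_mono norm_pfun_le)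
  qed
  thus ?thesis using fm assms by (simp add: L2per_def represents_def)
qed

lemma L2inner_represents:
  assumes "represents u f" "represents v g"
  shows "L2inner f g = pinner u v"
proof -
  have "(LINT x:{-pi..pi}|lebesgue. f x * cnj (g x)) = pint (u * pcnj v)"
  proof (rule LINT_represents)
    show "(\<lambda>x. f x * cnj (g x)) \<in> borel_measurable lebesgue"
      using represents_measurable[OF assms(1)] represents_measurable[OF assms(2)]
      by (intro borel_measurable_times)
         (auto intro!: measurable_compose[OF _ borel_measurable_continuous_onI, of _ _ cnj] continuous_intros)
    have "AE x in lebesgue. f x = pfun u x" "AE x in lebesgue. g x = pfun v x"
      using assms by (auto simp: represents_def)
    thus "AE x in lebesgue. f x * cnj (g x) = pfun (u * pcnj v) x" by eventually_elim simp
  qed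
  thus ?thesis by (simp add: L2inner_def pinner_def)
qed

lemma weak_deriv_cong_AE:
  assumes "is_weak_deriv f g" "f \<in> borel_measurable lebesgue" "f' \<in> borel_measurable lebesgue"
    "AE x in lebesgue. f x = f' x"
  shows "is_weak_deriv f' g"
proof -
  have "(LINT x:{-pi..pi}|lebesgue. f x * of_real (deriv \<eta> x)) =
      (LINT x:{-pi..pi}|lebesgue. f' x * of_real (deriv \<eta> x))" if "\<eta> \<in> test_functions" for \<eta>
    unfolding set_lebesgue_integral_def
  proof (rule integral_cong_AE)
    have "(\<lambda>x. complex_of_real (deriv \<eta> x)) \<in> borel_measurable borel"
      by (intro borel_measurable_continuous_onI continuous_intros test_function_continuous[OF that])
    hence "(\<lambda>x. complex_of_real (deriv \<eta> x)) \<in> borel_measurable lebesgue"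
      by (simp add: measurable_completion)
    thus "(\<lambda>x. indicat_real {-pi..pi} x *\<^sub>R (f x * complex_of_real (deriv \<eta> x))) \<in> borel_measurable lebesgue"
      "(\<lambda>x. indicat_real {-pi..pi} x *\<^sub>R (f' x * complex_of_real (deriv \<eta> x))) \<in> borel_measurable lebesgue"
      by (auto intro!: borel_measurable_scaleR borel_measurable_indicator borel_measurable_times assms)
    show "AE x in lebesgue. indicat_real {-pi..pi} x *\<^sub>R (f x * complex_of_real (deriv \<eta> x)) =
        indicat_real {-pi..pi} x *\<^sub>R (f' x * complex_of_real (deriv \<eta> x))"
      using assms(4) by eventually_elim simp
  qed
  thus ?thesis using assms(1) by (simp add: is_weak_deriv_def)
qed

lemma wderiv_H1per:
  assumes "f \<in> H1per"
  shows "wderiv f \<in> L2per" "is_weak_deriv f (wderiv f)"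
proof -
  have "\<exists>g. g \<in> L2per \<and> is_weak_deriv f g" using assms by (auto simp: H1per_def)
  from someI_ex[OF this] show "wderiv f \<in> L2per" "is_weak_deriv f (wderiv f)"
    unfolding wderiv_def by auto
qed

text \<open>
  The classical derivative is a weak derivative, hence almost everywhere equal to the one that \<open>wderiv\<close>
  selects.
\<close>

lemma represents_H1per:
  assumes f: "represents u f" and u: "has_pderiv u u'"
  shows "f \<in> H1per" "represents u' (wderiv f)"
proof -
  have w: "is_weak_deriv f (pfun u')"
  proof (rule weak_deriv_cong_AE[OF has_pderiv_is_weak_deriv[OF u]])
    show "AE x in lebesgue. pfun u x = f x"
      using f unfolding represents_def by (auto elim: eventually_mono)
  qed (use represents_measurable[OF f] represents_measurable[OF represents_pfun] in auto)
  have u': "pfun u' \<in> L2per" by (rule represents_L2per[OF represents_pfun])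
  show H1: "f \<in> H1per" unfolding H1per_def using represents_L2per[OF f] u' w by blast
  note wf = wderiv_H1per[OF H1]
  have "AE x in lebesgue. wderiv f x = pfun u' x"
    by (rule weak_deriv_unique[OF wf(1) u' wf(2) w])
  thus "represents u' (wderiv f)" using wf(1) by (simp add: represents_def L2per_def)
qed

lemma represents_H2per:
  assumes f: "represents u f" and u: "has_pderiv u u'" "has_pderiv u' u''"
  shows "f \<in> H2per" "represents u' (wderiv f)" "represents u'' (wderiv (wderiv f))"
  using represents_H1per[OF f u(1)] represents_H1per[OF _ u(2)] by (auto simp: H2per_def)

lemma H2norm_represents_nonneg:
  assumes f: "represents u f" and u: "has_pderiv u u'" "has_pderiv u' u''"
  shows "0 \<le> H2norm f"
proof -
  note r = represents_H2per[OF f u]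
  show ?thesis
    unfolding H2norm_def L2inner_represents[OF f f] L2inner_represents[OF r(2) r(2)]
      L2inner_represents[OF r(3) r(3)]
    by (simp add: pinner_self)
qed

lemma H2norm_represents_le:
  assumes f: "represents u f" and u: "has_pderiv u u'" "has_pderiv u' u''"
  shows "H2norm f \<le> sqrt (2 * pi) * (norm u + norm u' + norm u'')"
proof -
  have le: "pinner v v \<le> 2 * pi * (norm v)\<^sup>2" for v
  proof -
    have "pinner v v \<le> norm (pint (v * pcnj v))" unfolding pinner_def by (rule complex_Re_le_cmod)
    also have "\<dots> \<le> norm (v * pcnj v) * (pi - (- pi))"
      unfolding pint_def by (rule integral_bound) (auto intro!: continuous_intros norm_pfun_le simp del: pfun_times)
    also have "norm (v * pcnj v) \<le> (norm v)\<^sup>2"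
      by (rule norm_pcf_leI) (simp add: norm_mult power2_eq_square mult_mono norm_pfun_le)
    finally show ?thesis by (simp add: mult.commute mult_right_mono)
  qed
  note r = represents_H2per[OF f u]
  have "H2norm f = sqrt (pinner u u + pinner u' u' + pinner u'' u'')"
    by (simp add: H2norm_def L2inner_represents[OF f f] L2inner_represents[OF r(2) r(2)]
        L2inner_represents[OF r(3) r(3)])
  also have "\<dots> \<le> sqrt (2 * pi * ((norm u + norm u' + norm u'')\<^sup>2))"
  proof (rule real_sqrt_le_mono)
    have "pinner u u + pinner u' u' + pinner u'' u'' \<le> 2 * pi * ((norm u)\<^sup>2 + (norm u')\<^sup>2 + (norm u'')\<^sup>2)"
      using le[of u] le[of u'] le[of u''] by (simp add: algebra_simps)
    also have "(norm u)\<^sup>2 + (norm u')\<^sup>2 + (norm u'')\<^sup>2 \<le> (norm u + norm u' + norm u'')\<^sup>2"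
      by (simp add: power2_eq_square algebra_simps)
    finally show "pinner u u + pinner u' u' + pinner u'' u'' \<le> 2 * pi * ((norm u + norm u' + norm u'')\<^sup>2)"
      by (simp add: mult_left_mono)
  qed
  also have "\<dots> = sqrt (2 * pi) * (norm u + norm u' + norm u'')"
    by (simp add: real_sqrt_mult)
  finally show ?thesis .
qed

lemma weak_deriv_diff:
  assumes "is_weak_deriv f g" "is_weak_deriv f' g'"
    "set_integrable lebesgue {-pi..pi} f" "set_integrable lebesgue {-pi..pi} g"
    "set_integrable lebesgue {-pi..pi} f'" "set_integrable lebesgue {-pi..pi} g'"
  shows "is_weak_deriv (\<lambda>x. f x - f' x) (\<lambda>x. g x - g' x)"
  unfolding is_weak_deriv_def
proof
  fix \<eta> assume \<eta>: "\<eta> \<in> test_functions"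
  note i = set_integrable_mult_test[OF _ \<eta>]
  show "(LINT x:{-pi..pi}|lebesgue. (f x - f' x) * of_real (deriv \<eta> x)) =
      - (LINT x:{-pi..pi}|lebesgue. (g x - g' x) * of_real (\<eta> x))"
    using assms(1,2) \<eta>
      set_integral_diff(2)[OF i(2)[OF assms(3)] i(2)[OF assms(5)]]
      set_integral_diff(2)[OF i(1)[OF assms(4)] i(1)[OF assms(6)]]
    by (simp add: is_weak_deriv_def left_diff_distrib)
qed

lemma weak_deriv_same_imp_diff_const:
  assumes f: "f \<in> L2per" and g: "g \<in> L2per" "is_weak_deriv f g" and u: "is_weak_deriv (pfun u) g"
  shows "\<exists>c. represents (u + pconst c) f"
proof -
  note fi = L2per_set_integrable[OF f] and gi = L2per_set_integrable[OF g(1)]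
  have "\<exists>c. AE x in lebesgue. f x - pfun u x = c"
  proof (rule weak_deriv_zero_imp_const)
    show "set_integrable lebesgue {-pi..pi} (\<lambda>x. f x - pfun u x)"
      by (rule set_integral_diff(1)[OF fi pfun_set_integrable])
    show "periodic_2pi (\<lambda>x. f x - pfun u x)" using f by (simp add: L2per_def periodic_2pi_def)
    show "is_weak_deriv (\<lambda>x. f x - pfun u x) (\<lambda>_. 0)"
      using weak_deriv_diff[OF g(2) u fi gi pfun_set_integrable gi] by simp
  qed
  then obtain c where "AE x in lebesgue. f x - pfun u x = c" by blast
  hence "AE x in lebesgue. f x = pfun (u + pconst c) x" by eventually_elim (simp add: algebra_simps)
  thus ?thesis using f by (auto simp: represents_def L2per_def)
qed

text \<open>
  The mean-zero primitive of the continuous weak derivative differs from \<open>f\<close> by a constant.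
\<close>

lemma weak_deriv_continuous_imp_C1:
  assumes f: "f \<in> L2per" and g: "is_weak_deriv f g" "represents v g"
  shows "\<exists>u. represents u f \<and> has_pderiv u v"
proof -
  have "pint v = 0"
    using weak_deriv_mean_zero[OF g(1)] LINT_represents[OF represents_measurable[OF g(2)], of v] g(2)
    by (simp add: represents_def)
  hence mv: "pmean v = 0" by (simp add: pmean_def)
  have pp: "has_pderiv (pprim v) v" using has_pderiv_pprim[of v] by (simp add: mv pconst_0)
  have "is_weak_deriv (pfun (pprim v)) g"
  proof -
    have 1: "(LINT x:{-pi..pi}|lebesgue. g x * of_real (\<eta> x)) = (LINT x:{-pi..pi}|lebesgue. pfun v x * of_real (\<eta> x))"
      if "\<eta> \<in> test_functions" for \<eta>
      unfolding set_lebesgue_integral_def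
    proof (rule integral_cong_AE)
      have "set_integrable lebesgue {-pi..pi} (\<lambda>x. g x * of_real (\<eta> x))"
        "set_integrable lebesgue {-pi..pi} (\<lambda>x. pfun v x * of_real (\<eta> x))"
        using set_integrable_mult_test(1)[OF L2per_set_integrable[OF represents_L2per[OF g(2)]] that]
          set_integrable_mult_test(1)[OF pfun_set_integrable that] by auto
      thus "(\<lambda>x. indicat_real {-pi..pi} x *\<^sub>R (g x * of_real (\<eta> x))) \<in> borel_measurable lebesgue"
        "(\<lambda>x. indicat_real {-pi..pi} x *\<^sub>R (pfun v x * of_real (\<eta> x))) \<in> borel_measurable lebesgue"
        by (auto simp: set_integrable_def)
      have "AE x in lebesgue. g x = pfun v x" using g(2) by (simp add: represents_def)
      thus "AE x in lebesgue. indicat_real {-pi..pi} x *\<^sub>R (g x * of_real (\<eta> x)) =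
          indicat_real {-pi..pi} x *\<^sub>R (pfun v x * of_real (\<eta> x))" by eventually_elim simp
    qed
    show ?thesis using has_pderiv_is_weak_deriv[OF pp] 1 by (simp add: is_weak_deriv_def)
  qed
  from weak_deriv_same_imp_diff_const[OF f represents_L2per[OF g(2)] g(1) this]
  obtain c where "represents (pprim v + pconst c) f" by blast
  moreover have "has_pderiv (pprim v + pconst c) v"
    using has_pderiv_add[OF pp has_pderiv_pconst] by simp
  ultimately show ?thesis by blast
qed

text \<open>
  The indefinite integral of the weak derivative is continuous, and by Fubini's theorem it has the same weak
  derivative; so it differs from \<open>f\<close> by a constant.
\<close>

theorem H1per_continuous_representative:
  assumes f: "f \<in> H1per"
  shows "\<exists>u. represents u f"
proof -
  define g where "g = wderiv f"
  note g = wderiv_H1per[OF f, folded g_def]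
  note gi = L2per_set_integrable[OF g(1)]
  have g0: "(LINT x:{-pi..pi}|lebesgue. g x) = 0" by (rule weak_deriv_mean_zero[OF g(2)])
  define P where "P = (\<lambda>x. integral {-pi..x} g)"
  have "continuous_on {-pi..pi} P"
    unfolding P_def using set_lebesgue_integral_eq_integral(1)[OF gi]
    by (rule indefinite_integral_continuous_1)
  moreover have "P (-pi) = P pi"
    using g0 set_lebesgue_integral_eq_integral(2)[OF gi] by (simp add: P_def)
  ultimately obtain u where u: "\<And>x. x \<in> {-pi..pi} \<Longrightarrow> pfun u x = P x"
    using periodic_extension by blast
  have "is_weak_deriv (pfun u) g"
    unfolding is_weak_deriv_def
  proof
    fix \<eta> assume \<eta>: "\<eta> \<in> test_functions"
    then obtain e e' where e: "has_pderiv e e'" "\<And>x. pfun e x = of_real (\<eta> x)"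
      "\<And>x. pfun e' x = of_real (deriv \<eta> x)" using test_function_pcf by metis
    have "(LINT x:{-pi..pi}|lebesgue. pfun u x * of_real (deriv \<eta> x)) =
        (LINT x:{-pi..pi}|lebesgue. P x * pfun e' x)"
      unfolding set_lebesgue_integral_def
      by (rule Bochner_Integration.integral_cong) (auto simp: u e indicator_def)
    also have "\<dots> = (LINT y:{-pi..pi}|lebesgue. g y * (pfun e pi - pfun e y))"
      unfolding P_def by (rule integration_by_parts_indefinite[OF gi e(1)])
    also have "\<dots> = (LINT y:{-pi..pi}|lebesgue. g y * pfun e pi - g y * of_real (\<eta> y))"
      by (simp add: e right_diff_distrib)
    also have "\<dots> = (LINT y:{-pi..pi}|lebesgue. g y * pfun e pi) - (LINT y:{-pi..pi}|lebesgue. g y * of_real (\<eta> y))"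
      by (rule set_integral_diff(2)[OF set_integrable_mult_continuous[OF gi] set_integrable_mult_test(1)[OF gi \<eta>]]) auto
    also have "(LINT y:{-pi..pi}|lebesgue. g y * pfun e pi) = 0" using g0 by simp
    finally show "(LINT x:{-pi..pi}|lebesgue. pfun u x * of_real (deriv \<eta> x)) =
        - (LINT x:{-pi..pi}|lebesgue. g x * of_real (\<eta> x))" by simp
  qed
  with weak_deriv_same_imp_diff_const[OF _ g] f show ?thesis by (auto simp: H1per_def)
qed

theorem H2per_C1_representative:
  assumes f: "f \<in> H2per"
  shows "\<exists>u u'. represents u f \<and> represents u' (wderiv f) \<and> has_pderiv u u'"
proof -
  have H1: "f \<in> H1per" "wderiv f \<in> H1per" using f by (auto simp: H2per_def)
  obtain u' where u': "represents u' (wderiv f)" using H1per_continuous_representative[OF H1(2)] by blast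
  have "f \<in> L2per" using H1 by (simp add: H1per_def)
  from weak_deriv_continuous_imp_C1[OF this wderiv_H1per(2)[OF H1(1)] u'] u' show ?thesis by blast
qed

section \<open>The branch of solutions in the Sobolev space\<close>

text \<open>
  The equation expresses the weak second derivative of \<open>u0\<close> by the continuous version of \<open>u0\<close>; so it is
  continuous, and \<open>u0\<close> has a version of class \<open>C\<^sup>2\<close>.
\<close>

lemma stationary_solution_C2:
  assumes d: "d \<noteq> 0" and s: "stationary_solution d f0 \<zeta> \<mu> V 0 u0"
  shows "\<exists>U U1 U2. represents U u0 \<and> represents U1 (wderiv u0) \<and> has_pderiv U U1 \<and> has_pderiv U1 U2 \<and>
    - d *\<^sub>R U2 + pconst (of_real \<zeta> - \<i> * of_real \<mu>) * U - U * U * pcnj U + pconst (\<i> * of_real f0) = 0"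
proof -
  have H2: "u0 \<in> H2per" using s by (simp add: stationary_solution_def)
  then obtain U U1 where U: "represents U u0" "represents U1 (wderiv u0)" "has_pderiv U U1"
    using H2per_C1_representative by blast
  define U2 where "U2 = (1 / d) *\<^sub>R (pconst (of_real \<zeta> - \<i> * of_real \<mu>) * U - U * U * pcnj U
      + pconst (\<i> * of_real f0))"
  have wave: "- d *\<^sub>R U2 + pconst (of_real \<zeta> - \<i> * of_real \<mu>) * U - U * U * pcnj U
      + pconst (\<i> * of_real f0) = 0"
    using d by (simp add: U2_def)
  have H1: "wderiv u0 \<in> H1per" using H2 by (simp add: H2per_def)
  note w = wderiv_H1per[OF H1]
  have "AE x in lebesgue. - complex_of_real d * wderiv (wderiv u0) x
        + \<i> * complex_of_real 0 * complex_of_real (V x) * wderiv u0 x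
        + (complex_of_real \<zeta> - \<i> * complex_of_real \<mu>) * u0 x
        - complex_of_real ((cmod (u0 x))\<^sup>2) * u0 x + \<i> * complex_of_real f0 = 0"
    using s by (simp add: stationary_solution_def)
  moreover have "AE x in lebesgue. u0 x = pfun U x" using U(1) by (simp add: represents_def)
  ultimately have "AE x in lebesgue. wderiv (wderiv u0) x = pfun U2 x"
  proof eventually_elim
    case (elim x)
    have "complex_of_real ((cmod (u0 x))\<^sup>2) = u0 x * cnj (u0 x)" by (rule complex_norm_square)
    hence "of_real d * wderiv (wderiv u0) x = (of_real \<zeta> - \<i> * of_real \<mu>) * u0 x
        - u0 x * u0 x * cnj (u0 x) + \<i> * of_real f0"
      using elim(1) by (simp add: algebra_simps)
    hence "wderiv (wderiv u0) x = ((of_real \<zeta> - \<i> * of_real \<mu>) * u0 x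
        - u0 x * u0 x * cnj (u0 x) + \<i> * of_real f0) / of_real d"
      using d by (simp add: eq_divide_eq mult.commute)
    thus ?case by (simp add: U2_def elim(2) scaleR_conv_of_real)
  qed
  hence "represents U2 (wderiv (wderiv u0))" using w(1) by (simp add: represents_def L2per_def)
  moreover have "wderiv u0 \<in> L2per" using U(2) by (rule represents_L2per)
  ultimately obtain U1' where U1': "represents U1' (wderiv u0)" "has_pderiv U1' U2"
    using weak_deriv_continuous_imp_C1[OF _ w(2)] by blast
  have "U1' = U1" using U1'(1) U(2) by (rule represents_unique)
  thus ?thesis using U U1' wave by blast
qed

lemma lin_op_represents:
  assumes U: "represents U u0" and \<phi>: "has_pderiv \<phi> \<phi>1" "has_pderiv \<phi>1 \<phi>2"
  shows "represents (- d *\<^sub>R \<phi>2 + (pconst (of_real \<zeta> - \<i> * of_real \<mu>) - 2 *\<^sub>R (U * pcnj U)) * \<phi>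
      - U * U * pcnj \<phi>) (lin_op d \<zeta> \<mu> u0 (pfun \<phi>))"
  unfolding represents_def
proof
  note r = represents_H2per[OF represents_pfun \<phi>]
  show "periodic_2pi (lin_op d \<zeta> \<mu> u0 (pfun \<phi>))"
    using U r(3) by (simp add: represents_def periodic_2pi_def lin_op_def)
  have "AE x in lebesgue. u0 x = pfun U x" "AE x in lebesgue. wderiv (wderiv (pfun \<phi>)) x = pfun \<phi>2 x"
    using U r(3) by (auto simp: represents_def)
  thus "AE x in lebesgue. lin_op d \<zeta> \<mu> u0 (pfun \<phi>) x = pfun (- d *\<^sub>R \<phi>2 +
      (pconst (of_real \<zeta> - \<i> * of_real \<mu>) - 2 *\<^sub>R (U * pcnj U)) * \<phi> - U * U * pcnj \<phi>) x"
  proof eventually_elim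
    case (elim x)
    have "complex_of_real ((cmod (u0 x))\<^sup>2) = u0 x * cnj (u0 x)" by (rule complex_norm_square)
    thus ?case by (simp add: lin_op_def elim scaleR_conv_of_real power2_eq_square algebra_simps)
  qed
qed

lemma pfun_i_translate:
  fixes h :: "real \<Rightarrow> real"
  assumes "continuous_on UNIV h" "periodic_2pi h"
  shows "pfun (Pfun (\<lambda>x. \<i> * of_real (h (x + s)))) = (\<lambda>x. \<i> * of_real (h (x + s)))"
proof (rule pfun_Pfun)
  show "continuous_on UNIV (\<lambda>x. \<i> * complex_of_real (h (x + s)))"
    by (intro continuous_intros continuous_on_compose2[OF assms(1)]) auto
  show "periodic_2pi (\<lambda>x. \<i> * complex_of_real (h (x + s)))"
    unfolding periodic_2pi_def
  proof
    fix x
    have "x + 2 * pi + s = (x + s) + 2 * pi" by simp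
    thus "\<i> * complex_of_real (h (x + 2 * pi + s)) = \<i> * complex_of_real (h (x + s))"
      using assms(2) by (simp only: periodic_2pi_def)
  qed
qed

lemma periodic_2pi_DERIV:
  fixes V :: "real \<Rightarrow> real"
  assumes "periodic_2pi V" "\<And>x. (V has_real_derivative V' x) (at x)"
  shows "periodic_2pi V'"
  unfolding periodic_2pi_def
proof
  fix x
  have "((\<lambda>x. V (x + 2 * pi)) has_real_derivative V' (x + 2 * pi)) (at x)"
    using assms(2)[of "x + 2 * pi"] by (simp only: DERIV_shift)
  hence "(V has_real_derivative V' (x + 2 * pi)) (at x)"
    using assms(1) by (simp add: periodic_2pi_def)
  thus "V' (x + 2 * pi) = V' x" using assms(2) DERIV_unique by blast
qed

text \<open>
  Continuous versions turn \<open>V_eff\<close> into an integral of continuous functions, which can be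
  differentiated under the integral sign.
\<close>

lemma V_eff_derivative:
  assumes V: "\<And>x. (V has_real_derivative V' x) (at x)" "continuous_on UNIV V'" "periodic_2pi V"
    and u: "represents u1 (wderiv u0)" and \<psi>: "represents \<psi> \<phi>0"
  shows "V_eff V u0 \<phi>0 \<sigma> = pinner (Pfun (\<lambda>x. \<i> * of_real (V (x + \<sigma>))) * u1) \<psi>" (is ?A)
    and "(V_eff V u0 \<phi>0 has_real_derivative
      pinner (Pfun (\<lambda>x. \<i> * of_real (V' (x + \<sigma>))) * u1) \<psi>) (at \<sigma>)" (is ?B)
proof -
  have Vc: "continuous_on UNIV V"
    by (rule continuous_at_imp_continuous_on) (use V(1) DERIV_isCont in blast)
  note V'_per = periodic_2pi_DERIV[OF V(3) V(1)]
  note lift = pfun_i_translate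
  define k where "k = (\<lambda>x. Re (\<i> * pfun u1 x * cnj (pfun \<psi> x)))"
  have kc: "continuous_on S k" for S unfolding k_def by (intro continuous_intros)
  have pair: "pinner (Pfun (\<lambda>x. \<i> * of_real (h (x + s))) * u1) \<psi> = integral {-pi..pi} (\<lambda>x. h (x + s) * k x)"
    if h: "continuous_on UNIV h" "periodic_2pi h" for h :: "real \<Rightarrow> real" and s
  proof -
    define X where "X = Pfun (\<lambda>x. \<i> * of_real (h (x + s))) * u1 * pcnj \<psi>"
    have "Re (integral {-pi..pi} (pfun X)) = integral {-pi..pi} (Re \<circ> pfun X)"
      by (rule integral_linear[OF pfun_integrable bounded_linear_Re, symmetric])
    also have "Re \<circ> pfun X = (\<lambda>x. h (x + s) * k x)"
      by (rule ext) (simp add: X_def lift[OF h] k_def algebra_simps)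
    finally show ?thesis by (simp only: pinner_def pint_def X_def)
  qed
  have A: "V_eff V u0 \<phi>0 s = pinner (Pfun (\<lambda>x. \<i> * of_real (V (x + s))) * u1) \<psi>" for s
  proof -
    define X where "X = Pfun (\<lambda>x. \<i> * of_real (V (x + s))) * u1 * pcnj \<psi>"
    have rep: "represents X (\<lambda>x. \<i> * of_real (V (x + s)) * wderiv u0 x * cnj (\<phi>0 x))"
      unfolding represents_def
    proof
      have "V (x + 2 * pi + s) = V (x + s)" for x
      proof -
        have "x + 2 * pi + s = (x + s) + 2 * pi" by simp
        thus ?thesis using V(3) by (simp only: periodic_2pi_def)
      qed
      thus "periodic_2pi (\<lambda>x. \<i> * complex_of_real (V (x + s)) * wderiv u0 x * cnj (\<phi>0 x))"
        using u \<psi> by (simp add: represents_def periodic_2pi_def)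
      have "AE x in lebesgue. wderiv u0 x = pfun u1 x" "AE x in lebesgue. \<phi>0 x = pfun \<psi> x"
        using u \<psi> by (auto simp: represents_def)
      thus "AE x in lebesgue. \<i> * complex_of_real (V (x + s)) * wderiv u0 x * cnj (\<phi>0 x) = pfun X x"
        by eventually_elim (simp add: X_def lift[OF Vc V(3)])
    qed
    have "(LINT x:{-pi..pi}|lebesgue. \<i> * of_real (V (x + s)) * wderiv u0 x * cnj (\<phi>0 x)) = pint X"
      by (rule LINT_represents[OF represents_measurable[OF rep]]) (use rep in \<open>simp add: represents_def\<close>)
    thus ?thesis by (simp add: V_eff_def pinner_def X_def)
  qed
  show ?A by (rule A)
  have "((\<lambda>s. integral (cbox (-pi) pi) (\<lambda>x. V (x + s) * k x)) has_real_derivative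
      integral (cbox (-pi) pi) (\<lambda>x. V' (x + \<sigma>) * k x)) (at \<sigma> within UNIV)"
  proof (rule leibniz_rule_field_derivative)
    fix s t :: real
    have "((\<lambda>s. V (t + s)) has_real_derivative V' (t + s)) (at s)"
      using V(1)[of "s + t"] DERIV_shift[of V "V' (s + t)" s t] by (simp add: add.commute)
    thus "((\<lambda>s. V (t + s) * k t) has_real_derivative V' (t + s) * k t) (at s within UNIV)"
      by (intro DERIV_cmult_right)
    show "(\<lambda>x. V (x + s) * k x) integrable_on cbox (-pi) pi"
      by (intro integrable_continuous continuous_intros kc continuous_on_compose2[OF Vc]) auto
    show "continuous_on (UNIV \<times> cbox (-pi) pi) (\<lambda>(s, x). V' (x + s) * k x)"
      unfolding case_prod_beta
      by (intro continuous_intros continuous_on_compose2[OF V(2)] continuous_on_compose2[OF kc[of UNIV]]) auto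
  qed auto
  moreover have "V_eff V u0 \<phi>0 = (\<lambda>s. integral (cbox (-pi) pi) (\<lambda>x. V (x + s) * k x))"
    using A pair[OF Vc V(3)] by (intro ext) (simp add: cbox_interval)
  ultimately show ?B using pair[OF V(2) V'_per] by (simp add: cbox_interval)
qed

theorem theorem1:
  fixes d f0 \<zeta> \<mu> \<sigma>0 :: real
    and V :: "real \<Rightarrow> real"
    and u0 \<phi>0 :: "real \<Rightarrow> complex"
  assumes "d \<noteq> 0"
    and "periodic_2pi V"
    and "V C1_differentiable_on UNIV"
    and "stationary_solution d f0 \<zeta> \<mu> V 0 u0"
    and "non_constant u0"
    and "non_degenerate d \<zeta> \<mu> u0"
    and "\<phi>0 \<in> H2per"
    and "adjoint_kernel H2per (lin_op d \<zeta> \<mu> u0) = real_span1 \<phi>0"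
    and "simple_zero (V_eff V u0 \<phi>0) \<sigma>0"
  shows "\<exists>\<epsilon>s>0. \<exists>C>0. \<exists>u :: real \<Rightarrow> real \<Rightarrow> complex.
           H2_continuous_on {-\<epsilon>s<..<\<epsilon>s} u \<and>
           (\<forall>\<epsilon>\<in>{-\<epsilon>s<..<\<epsilon>s}.
              stationary_solution d f0 \<zeta> \<mu> V \<epsilon> (u \<epsilon>) \<and>
              H2norm (\<lambda>x. u \<epsilon> x - u0 (x - \<sigma>0)) \<le> C * \<bar>\<epsilon>\<bar>)"
proof -
  define c where "c = complex_of_real \<zeta> - \<i> * complex_of_real \<mu>"
  define g where "g = \<i> * complex_of_real f0"
  obtain U U1 U2 where U_rep: "represents U u0" "represents U1 (wderiv u0)" "has_pderiv U U1" "has_pderiv U1 U2"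
    and wave: "- d *\<^sub>R U2 + pconst c * U - U * U * pcnj U + pconst g = 0"
    unfolding c_def g_def using stationary_solution_C2[OF assms(1,4)] by blast
  obtain \<psi> where \<psi>: "represents \<psi> \<phi>0" using H2per_C1_representative[OF assms(7)] by blast
  obtain V' where V': "\<And>x. (V has_real_derivative V' x) (at x)" "continuous_on UNIV V'"
    using assms(3) unfolding C1_differentiable_on_def
    by (auto simp: has_real_derivative_iff_has_vector_derivative)
  define W where "W = Pfun (\<lambda>x. \<i> * of_real (V (x + \<sigma>0)))"
  define W1 where "W1 = Pfun (\<lambda>x. \<i> * of_real (V' (x + \<sigma>0)))"
  have Vc: "continuous_on UNIV V"
    by (rule continuous_at_imp_continuous_on) (use V'(1) DERIV_isCont in blast)
  note V'_per = periodic_2pi_DERIV[OF assms(2) V'(1)]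
  have W_apply: "pfun W = (\<lambda>x. \<i> * of_real (V (x + \<sigma>0)))" "pfun W1 = (\<lambda>x. \<i> * of_real (V' (x + \<sigma>0)))"
    unfolding W_def W1_def by (intro pfun_i_translate Vc V' assms(2) V'_per)+
  have W_deriv: "has_pderiv W W1"
    unfolding has_pderiv_def W_apply
  proof
    fix x
    have "((\<lambda>x. V (x + \<sigma>0)) has_real_derivative V' (x + \<sigma>0)) (at x)"
      using V'(1)[of "x + \<sigma>0"] by (simp only: DERIV_shift)
    hence "((\<lambda>x. complex_of_real (V (x + \<sigma>0))) has_vector_derivative of_real (V' (x + \<sigma>0))) (at x)"
      by (intro has_vector_derivative_of_real) (simp add: has_real_derivative_iff_has_vector_derivative)
    thus "((\<lambda>x. \<i> * complex_of_real (V (x + \<sigma>0))) has_vector_derivative \<i> * of_real (V' (x + \<sigma>0))) (at x)"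
      by (rule has_vector_derivative_mult_right)
  qed
  note Veff = V_eff_derivative[OF V' assms(2) U_rep(2) \<psi>, of \<sigma>0, folded W_def W1_def]
  interpret nondegenerate_wave d c g U U1 U2 \<psi> W W1
  proof
    show "d \<noteq> 0" by fact
    show "has_pderiv U U1" "has_pderiv U1 U2" by fact+
    show "- d *\<^sub>R U2 + pconst c * U - U * U * pcnj U + pconst g = 0" by fact
    show "has_pderiv W W1" by fact
    show "pinner (W * U1) \<psi> = 0" using assms(9) Veff(1) by (simp add: simple_zero_def)
    show "pinner (W1 * U1) \<psi> \<noteq> 0"
      using assms(9) Veff(2) DERIV_unique unfolding simple_zero_def by blast
  next
    fix \<phi> \<phi>1 \<phi>2 assume \<phi>: "has_pderiv \<phi> \<phi>1" "has_pderiv \<phi>1 \<phi>2"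
    note rep = lin_op_represents[OF U_rep(1) \<phi>, of d \<zeta> \<mu>, folded c_def]
    note r = represents_H2per[OF represents_pfun \<phi>]
    show "\<exists>r. \<phi> = r *\<^sub>R U1"
      if z: "- d *\<^sub>R \<phi>2 + (pconst c - 2 *\<^sub>R (U * pcnj U)) * \<phi> - U * U * pcnj \<phi> = 0"
    proof -
      have "pfun \<phi> \<in> op_kernel H2per (lin_op d \<zeta> \<mu> u0)"
        using rep r(1) unfolding z by (simp add: op_kernel_def represents_def)
      hence "pfun \<phi> \<in> real_span1 (wderiv u0)" using assms(6) by (simp add: non_degenerate_def)
      then obtain r where "AE x in lebesgue. pfun \<phi> x = of_real r * wderiv u0 x"
        by (auto simp: real_span1_def)
      moreover have "AE x in lebesgue. wderiv u0 x = pfun U1 x" using U_rep(2) by (simp add: represents_def)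
      ultimately have "AE x in lebesgue. pfun \<phi> x = pfun (r *\<^sub>R U1) x"
        by eventually_elim (simp add: scaleR_conv_of_real)
      hence "represents (r *\<^sub>R U1) (pfun \<phi>)" by (simp add: represents_def periodic_pfun)
      hence "\<phi> = r *\<^sub>R U1" using represents_unique[OF represents_pfun] by blast
      thus ?thesis ..
    qed
    \<comment> \<open>Membership of \<open>\<phi>0\<close> in the adjoint kernel says that \<open>\<phi>0\<close> is orthogonal to the range of the linearisation.\<close>
    have "\<phi>0 \<in> real_span1 \<phi>0"
      using represents_L2per[OF \<psi>] by (auto simp: real_span1_def intro: exI[of _ 1])
    hence "\<phi>0 \<in> adjoint_kernel H2per (lin_op d \<zeta> \<mu> u0)" using assms(8) by simp
    hence "L2inner (lin_op d \<zeta> \<mu> u0 (pfun \<phi>)) \<phi>0 = L2inner (pfun \<phi>) (\<lambda>x. 0)"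
      using r(1) by (auto simp: adjoint_kernel_def adjoint_graph_def)
    thus "pinner (- d *\<^sub>R \<phi>2 + (pconst c - 2 *\<^sub>R (U * pcnj U)) * \<phi> - U * U * pcnj \<phi>) \<psi> = 0"
      using L2inner_represents[OF rep \<psi>] by (simp add: L2inner_def set_lebesgue_integral_def)
  qed
  obtain \<epsilon>s M w where es: "0 < \<epsilon>s" and wc: "continuous_on {-\<epsilon>s<..<\<epsilon>s} w"
    and wM: "\<And>\<epsilon>. \<epsilon> \<in> {-\<epsilon>s<..<\<epsilon>s} \<Longrightarrow> norm (w \<epsilon>) \<le> M"
    and weq: "\<And>\<epsilon>. \<epsilon> \<in> {-\<epsilon>s<..<\<epsilon>s} \<Longrightarrow>
       (let u = U + \<epsilon> *\<^sub>R psolve (w \<epsilon>); u1 = U1 + \<epsilon> *\<^sub>R pprim (w \<epsilon>);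
            u2 = U2 + \<epsilon> *\<^sub>R (w \<epsilon> - pconst (pmean (w \<epsilon>)))
        in - d *\<^sub>R u2 + \<epsilon> *\<^sub>R (W * u1) + pconst c * u - u * u * pcnj u + pconst g = 0)"
    using branch by blast
  define v where "v = (\<lambda>\<epsilon>. U + \<epsilon> *\<^sub>R psolve (w \<epsilon>))"
  define v1 where "v1 = (\<lambda>\<epsilon>. U1 + \<epsilon> *\<^sub>R pprim (w \<epsilon>))"
  define v2 where "v2 = (\<lambda>\<epsilon>. U2 + \<epsilon> *\<^sub>R (w \<epsilon> - pconst (pmean (w \<epsilon>))))"
  have v: "has_pderiv (v \<epsilon>) (v1 \<epsilon>)" "has_pderiv (v1 \<epsilon>) (v2 \<epsilon>)" for \<epsilon>
    unfolding v_def v1_def v2_def by (intro pderiv_intros U has_pderiv_psolve has_pderiv_pprim)+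
  define u where "u = (\<lambda>\<epsilon>. pfun (pshift \<sigma>0 (v \<epsilon>)))"
  have u_rep: "represents (pshift \<sigma>0 (v \<epsilon>)) (u \<epsilon>)" for \<epsilon> by (simp add: u_def)
  note u_H2 = represents_H2per[OF u_rep has_pderiv_pshift[OF v(1)] has_pderiv_pshift[OF v(2)]]
  have vc: "continuous_on {-\<epsilon>s<..<\<epsilon>s} v" "continuous_on {-\<epsilon>s<..<\<epsilon>s} v1" "continuous_on {-\<epsilon>s<..<\<epsilon>s} v2"
    unfolding v_def v1_def v2_def
    by (intro continuous_intros wc bounded_linear.continuous_on[OF psolve_linear]
        bounded_linear.continuous_on[OF bounded_linear_pprim]
        bounded_linear.continuous_on[OF bounded_linear_pconst]
        bounded_linear.continuous_on[OF bounded_linear_pmean])+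
  have cont: "H2_continuous_on {-\<epsilon>s<..<\<epsilon>s} u"
    unfolding H2_continuous_on_def
  proof (intro conjI ballI)
    fix t assume t: "t \<in> {-\<epsilon>s<..<\<epsilon>s}"
    show "u t \<in> H2per" by (rule u_H2)
    have rep: "represents (pshift \<sigma>0 (v s - v t)) (\<lambda>x. u s x - u t x)" for s
      by (simp add: represents_def u_def periodic_2pi_def del: pfun_pshift)
         (simp add: periodic_pfun[unfolded periodic_2pi_def])
    note pd = has_pderiv_pshift[OF has_pderiv_diff[OF v(1) v(1)]]
      has_pderiv_pshift[OF has_pderiv_diff[OF v(2) v(2)]]
    have bound: "norm (H2norm (\<lambda>x. u s x - u t x))
        \<le> sqrt (2 * pi) * (norm (v s - v t) + norm (v1 s - v1 t) + norm (v2 s - v2 t))" for s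
    proof -
      have "H2norm (\<lambda>x. u s x - u t x) \<le> sqrt (2 * pi) * (norm (pshift \<sigma>0 (v s - v t))
          + norm (pshift \<sigma>0 (v1 s - v1 t)) + norm (pshift \<sigma>0 (v2 s - v2 t)))"
        by (rule H2norm_represents_le[OF rep pd])
      also have "\<dots> \<le> sqrt (2 * pi) * (norm (v s - v t) + norm (v1 s - v1 t) + norm (v2 s - v2 t))"
        by (intro mult_left_mono add_mono norm_pshift_le) auto
      finally show ?thesis using H2norm_represents_nonneg[OF rep pd] by simp
    qed
    have "((\<lambda>s. sqrt (2 * pi) * (norm (v s - v t) + norm (v1 s - v1 t) + norm (v2 s - v2 t)))
        \<longlongrightarrow> sqrt (2 * pi) * (norm (v t - v t) + norm (v1 t - v1 t) + norm (v2 t - v2 t)))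
        (at t within {-\<epsilon>s<..<\<epsilon>s})"
      using vc t unfolding continuous_on_def by (intro tendsto_intros) auto
    hence "((\<lambda>s. sqrt (2 * pi) * (norm (v s - v t) + norm (v1 s - v1 t) + norm (v2 s - v2 t)))
        \<longlongrightarrow> 0) (at t within {-\<epsilon>s<..<\<epsilon>s})" by simp
    thus "((\<lambda>s. H2norm (\<lambda>x. u s x - u t x)) \<longlongrightarrow> 0) (at t within {-\<epsilon>s<..<\<epsilon>s})"
      by (rule Lim_null_comparison[OF always_eventually, rotated]) (use bound in blast)
  qed
  obtain K where K: "K > 0" "\<And>x. norm (psolve x) \<le> norm x * K"
    using bounded_linear.pos_bounded[OF psolve_linear] by blast
  \<comment> \<open>The summands bound \<open>v\<close>, \<open>v'\<close> and \<open>v''\<close> in terms of the density; adding \<open>1\<close> makes \<open>C\<close> positive.\<close>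
  define C where "C = sqrt (2 * pi) * (M * K + 4 * pi * M + 2 * M) + 1"
  have M: "M \<ge> 0" using order_trans[OF norm_ge_zero wM[of 0]] es by simp
  have C: "C > 0" unfolding C_def using M K(1) by (intro add_nonneg_pos mult_nonneg_nonneg add_nonneg_nonneg) auto
  have main: "stationary_solution d f0 \<zeta> \<mu> V \<epsilon> (u \<epsilon>) \<and> H2norm (\<lambda>x. u \<epsilon> x - u0 (x - \<sigma>0)) \<le> C * \<bar>\<epsilon>\<bar>"
    if e: "\<epsilon> \<in> {-\<epsilon>s<..<\<epsilon>s}" for \<epsilon>
  proof
    have pt: "- of_real d * pfun (v2 \<epsilon>) y + of_real \<epsilon> * (\<i> * of_real (V (y + \<sigma>0)) * pfun (v1 \<epsilon>) y)
        + c * pfun (v \<epsilon>) y - pfun (v \<epsilon>) y * pfun (v \<epsilon>) y * cnj (pfun (v \<epsilon>) y) + g = 0" for y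
      using arg_cong[OF weq[OF e, unfolded Let_def], of "\<lambda>f. pfun f y"]
      by (simp add: v_def v1_def v2_def scaleR_conv_of_real W_apply)
    have "AE x in lebesgue. wderiv (u \<epsilon>) x = pfun (pshift \<sigma>0 (v1 \<epsilon>)) x"
      "AE x in lebesgue. wderiv (wderiv (u \<epsilon>)) x = pfun (pshift \<sigma>0 (v2 \<epsilon>)) x"
      using u_H2 by (auto simp: represents_def)
    hence "AE x in lebesgue. - complex_of_real d * wderiv (wderiv (u \<epsilon>)) x
        + \<i> * complex_of_real \<epsilon> * complex_of_real (V x) * wderiv (u \<epsilon>) x
        + (complex_of_real \<zeta> - \<i> * complex_of_real \<mu>) * u \<epsilon> x
        - complex_of_real ((cmod (u \<epsilon> x))\<^sup>2) * u \<epsilon> x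
        + \<i> * complex_of_real f0 = 0"
    proof eventually_elim
      case (elim x)
      have "complex_of_real ((cmod (u \<epsilon> x))\<^sup>2) = u \<epsilon> x * cnj (u \<epsilon> x)" by (rule complex_norm_square)
      moreover have "u \<epsilon> x = pfun (v \<epsilon>) (x - \<sigma>0)" by (simp add: u_def)
      ultimately show ?case
        using pt[of "x - \<sigma>0"] by (simp add: elim c_def g_def algebra_simps)
    qed
    thus "stationary_solution d f0 \<zeta> \<mu> V \<epsilon> (u \<epsilon>)"
      using u_H2(1) by (simp add: stationary_solution_def)
  next
    have rep: "represents (pshift \<sigma>0 (\<epsilon> *\<^sub>R psolve (w \<epsilon>))) (\<lambda>x. u \<epsilon> x - u0 (x - \<sigma>0))"
      unfolding represents_def
    proof
      have "u0 (x + 2 * pi - \<sigma>0) = u0 (x - \<sigma>0)" for x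
      proof -
        have "x + 2 * pi - \<sigma>0 = (x - \<sigma>0) + 2 * pi" by simp
        thus ?thesis using U_rep(1) by (simp only: represents_def periodic_2pi_def)
      qed
      thus "periodic_2pi (\<lambda>x. u \<epsilon> x - u0 (x - \<sigma>0))"
        unfolding u_def periodic_2pi_def by (simp only: pfun_add_2pi) simp
      have "AE x in lebesgue. u0 x = pfun U x" using U_rep(1) by (simp add: represents_def)
      from AE_lebesgue_translate[OF this, of "- \<sigma>0"]
      show "AE x in lebesgue. u \<epsilon> x - u0 (x - \<sigma>0) = pfun (pshift \<sigma>0 (\<epsilon> *\<^sub>R psolve (w \<epsilon>))) x"
        by eventually_elim (simp add: u_def v_def)
    qed
    have "H2norm (\<lambda>x. u \<epsilon> x - u0 (x - \<sigma>0)) \<le> sqrt (2 * pi) * (norm (pshift \<sigma>0 (\<epsilon> *\<^sub>R psolve (w \<epsilon>)))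
        + norm (pshift \<sigma>0 (\<epsilon> *\<^sub>R pprim (w \<epsilon>))) + norm (pshift \<sigma>0 (\<epsilon> *\<^sub>R (w \<epsilon> - pconst (pmean (w \<epsilon>))))))"
      by (rule H2norm_represents_le[OF rep])
         (intro has_pderiv_pshift pderiv_intros has_pderiv_psolve has_pderiv_pprim)+
    also have "\<dots> \<le> sqrt (2 * pi) * (norm (\<epsilon> *\<^sub>R psolve (w \<epsilon>))
        + norm (\<epsilon> *\<^sub>R pprim (w \<epsilon>)) + norm (\<epsilon> *\<^sub>R (w \<epsilon> - pconst (pmean (w \<epsilon>)))))"
      by (intro mult_left_mono add_mono norm_pshift_le) auto
    also have "\<dots> = sqrt (2 * pi) * (norm (psolve (w \<epsilon>)) + norm (pprim (w \<epsilon>)) + norm (w \<epsilon> - pconst (pmean (w \<epsilon>)))) * \<bar>\<epsilon>\<bar>"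
      unfolding norm_scaleR by (simp add: algebra_simps)
    also have "\<dots> \<le> sqrt (2 * pi) * (M * K + 4 * pi * M + 2 * M) * \<bar>\<epsilon>\<bar>"
    proof (intro mult_right_mono mult_left_mono add_mono)
      show "norm (psolve (w \<epsilon>)) \<le> M * K"
        by (rule order_trans[OF K(2)]) (use wM[OF e] K(1) in \<open>auto intro: mult_right_mono\<close>)
      show "norm (pprim (w \<epsilon>)) \<le> 4 * pi * M"
        by (rule order_trans[OF norm_pprim_le]) (use wM[OF e] in auto)
      show "norm (w \<epsilon> - pconst (pmean (w \<epsilon>))) \<le> 2 * M"
        by (rule order_trans[OF norm_minus_pmean_le]) (use wM[OF e] in auto)
    qed auto
    also have "\<dots> \<le> C * \<bar>\<epsilon>\<bar>" unfolding C_def by (intro mult_right_mono) auto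
    finally show "H2norm (\<lambda>x. u \<epsilon> x - u0 (x - \<sigma>0)) \<le> C * \<bar>\<epsilon>\<bar>" .
  qed
  show ?thesis using es C cont main by blast
qed

end
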